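(* Let $K$ be a semi-perfect field, let $d>1$ be an arbitrary integer, and let $s\ge 0$ be an integer. Then there exists an integer $s'$ (depending only on $K$, $d$ and $s$; in particular not on $n$ or $f$) such that for every $n$ and every homogeneous form $f\in K[x_1,\ldots,x_n]$ of degree $d$: if $\mathrm{str}(f)>s'$ then $\mathrm{astr}(f)>s$.
   Context: A field $K$ is semi-perfect if $\mathrm{char}(K)=0$, or $\mathrm{char}(K)=p>0$ and $[K:K^p]<\infty$. For a homogeneous form $f\in K[x_1,\ldots,x_n]$ of degree $d>1$, the strength $\mathrm{str}(f)$ is the minimal $s$ for which there is an expression $f=\sum_{i=1}^s g_i h_i$ with $g_i,h_i\in K[x_1,\ldots,x_n]$ homogeneous forms of degrees $<d$. The absolute strength $\mathrm{astr}(f)$ is the strength of $f$ regarded as a form over the algebraic closure $\overline{K}$, i.e. as an element of $\overline K[x_1,\ldots,x_n]$. *)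

theory Defs
  imports "HOL-Library.Poly_Mapping" "HOL-Algebra.Algebraic_Closure_Type"
    "HOL-Algebra.Embedded_Algebras"
begin

text \<open>
  An element of \<open>(nat \<Rightarrow>\<^sub>0 nat) \<Rightarrow>\<^sub>0 'a\<close> is a polynomial over \<open>'a\<close> in the
  variables \<open>x\<^sub>0, x\<^sub>1, \<dots>\<close>; \<open>K[x\<^sub>1,\<dots>,x\<^sub>n]\<close> is rendered as the
  polynomials in which only variables with index below \<open>n\<close> occur. Sum and product are those of
  \<^theory>\<open>HOL-Library.Poly_Mapping\<close>.
\<close>

type_synonym 'a multipoly = "(nat \<Rightarrow>\<^sub>0 nat) \<Rightarrow>\<^sub>0 'a"

definition mon_degree :: "(nat \<Rightarrow>\<^sub>0 nat) \<Rightarrow> nat" where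
  "mon_degree m = (\<Sum>i\<in>Poly_Mapping.keys m. Poly_Mapping.lookup m i)"

text \<open>As usual, the zero polynomial is a form of every degree.\<close>

definition is_form :: "nat \<Rightarrow> nat \<Rightarrow> 'a::zero multipoly \<Rightarrow> bool" where
  "is_form n d p \<longleftrightarrow> (\<forall>m\<in>Poly_Mapping.keys p. Poly_Mapping.keys m \<subseteq> {..<n} \<and> mon_degree m = d)"

definition strength_expr ::
    "nat \<Rightarrow> nat \<Rightarrow> 'a::comm_ring_1 multipoly \<Rightarrow> nat \<Rightarrow> bool" where
  "strength_expr n d f s \<longleftrightarrow>
     (\<exists>g h :: nat \<Rightarrow> 'a multipoly.
        (\<forall>i<s. (\<exists>e<d. is_form n e (g i)) \<and> (\<exists>e<d. is_form n e (h i))) \<and>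
        f = (\<Sum>i<s. g i * h i))"

text \<open>
  The degree \<open>d\<close> is a parameter because the zero form has no degree of its own. For \<open>d > 1\<close>
  every form of degree \<open>d\<close> in \<open>n\<close> variables has an expression (factor one variable out of each
  monomial), so the minimum below exists.
\<close>

definition strength :: "nat \<Rightarrow> nat \<Rightarrow> 'a::comm_ring_1 multipoly \<Rightarrow> nat" where
  "strength n d f = (LEAST s. strength_expr n d f s)"

definition abs_strength :: "nat \<Rightarrow> nat \<Rightarrow> 'a::field multipoly \<Rightarrow> nat" where
  "abs_strength n d f =
     strength n d (Poly_Mapping.map to_ac f :: 'a alg_closure multipoly)"

text \<open>
  In characteristic \<open>p > 0\<close> the image of \<open>x \<mapsto> x\<^sup>p\<close> is the subfield \<open>K\<^sup>p\<close>, and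
  \<open>[K : K\<^sup>p] < \<infinity>\<close> says that \<open>K\<close> has finite dimension over it.
\<close>

definition semi_perfect :: "'a::field itself \<Rightarrow> bool" where
  "semi_perfect _ \<longleftrightarrow>
     CHAR('a) = 0 \<or>
     (CHAR('a) > 0 \<and>
      ring.finite_dimension (ring_of_type_algebra :: 'a ring)
        (range (\<lambda>x :: 'a. x ^ CHAR('a))) UNIV)"

end

(*
  Suppose forms f_k over K have strength > k but absolute strength at most s, and let x be the class of
  the sequence in the ultraproduct R of the polynomial rings over the algebraic closure. Then x is
  decomposable in R, i.e. a sum of products of elements of smaller positive degree. Let Q be the subalgebra
  of R spanned by the ultraproducts of forms over K. It suffices to show that x is decomposable in Q: a
  K-linear retraction of the closure onto K then bounds the strength of infinitely many f_k.
  Choose homogeneous elements E of Q that form a basis of Q modulo decomposables of R, and extend them to a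
  set Y that does the same for R. By induction on the degree, R is a polynomial ring on Y (the method of
  Erman, Sam and Snowden) and Q is generated by E: all Hasse derivatives of a polynomial expression F(Y) of
  an element of Q lie in K'[E], where K' is the ground field of R, and this forces the partial derivatives
  of F in the variables outside E to vanish. So, up to factors that are p-th powers (p the
  characteristic), F involves E only; these factors are removed by descent to K, using that K is
  semi-perfect.
*)
theory Submission
  imports Defs "HOL-Computational_Algebra.Formal_Power_Series"
begin

section \<open>Polynomials and Hasse derivatives\<close>

subsection \<open>Evaluation homomorphisms\<close>

text \<open>The direct descent fails quantitatively: an expression over the closure lives over a
  finite extension of K whose degree is not controlled by \<open>d\<close> and \<open>s\<close>, so
  expanding it in a basis of that extension gives no uniform bound. In the ultraproduct only the
  finiteness of a sum matters; the price is that the bound is not explicit. Q is a span over K', the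
  ground field of R, so that generators of both can be compared over one field. Hasse derivatives
  replace ordinary ones because the latter vanish on polynomials in the p-th powers of the
  variables, whereas a form of positive degree is zero once all its Hasse derivatives of positive
  order are. Still, what is shown to vanish is an ordinary derivative in the generators, so
  exponents are controlled only modulo p. The p-th powers left over are the obstacle, and finiteness
  of K over its subfield of p-th powers keeps the number of terms needed to remove them bounded
  along the sequence.\<close>

locale comm_ring_hom =
  fixes f :: "'a::comm_ring_1 \<Rightarrow> 'b::comm_ring_1"
  assumes hom_one: "f 1 = 1"
    and hom_add: "f (x + y) = f x + f y"
    and hom_mult: "f (x * y) = f x * f y"
begin

lemma hom_zero: "f 0 = 0"
  using hom_add[of 0 0] by simp

lemma hom_sum: "f (sum g A) = (\<Sum>i\<in>A. f (g i))"
  by (induction A rule: infinite_finite_induct) (auto simp: hom_zero hom_add)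

lemma hom_prod: "f (prod g A) = (\<Prod>i\<in>A. f (g i))"
  by (induction A rule: infinite_finite_induct) (auto simp: hom_one hom_mult)

lemma hom_power: "f (x ^ n) = f x ^ n"
  by (induction n) (auto simp: hom_one hom_mult)

lemma hom_of_nat: "f (of_nat n) = of_nat n"
  by (induction n) (auto simp: hom_zero hom_one hom_add)

lemma hom_uminus: "f (- x) = - f x"
  using hom_add[of x "- x"] by (simp add: hom_zero eq_neg_iff_add_eq_0 add.commute)

lemma hom_diff: "f (x - y) = f x - f y"
  using hom_add[of x "- y"] by (simp add: hom_uminus)

end

lemma comm_ring_hom_comp:
  "comm_ring_hom f \<Longrightarrow> comm_ring_hom g \<Longrightarrow> comm_ring_hom (\<lambda>x. g (f x))"
  by (simp add: comm_ring_hom_def)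

abbreviation (input) "keys \<equiv> Poly_Mapping.keys"
abbreviation (input) "lookup \<equiv> Poly_Mapping.lookup"
abbreviation (input) "single \<equiv> Poly_Mapping.single"

type_synonym ('v, 'a) mpoly = "('v \<Rightarrow>\<^sub>0 nat) \<Rightarrow>\<^sub>0 'a"

lemma poly_mapping_sum_single:
  fixes F :: "'k \<Rightarrow>\<^sub>0 'a::comm_monoid_add"
  shows "F = (\<Sum>\<mu>\<in>keys F. single \<mu> (lookup F \<mu>))"
  by (rule poly_mapping_eqI)
    (simp add: lookup_sum lookup_single when_def sum.delta' in_keys_iff cong: if_cong)

lemma poly_mapping_add_induct [case_names zero add single]:
  fixes F :: "'k \<Rightarrow>\<^sub>0 'a::comm_monoid_add"
  assumes "P 0" "\<And>F G. P F \<Longrightarrow> P G \<Longrightarrow> P (F + G)" "\<And>\<mu> a. P (single \<mu> a)"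
  shows "P F"
proof -
  have "P (\<Sum>\<mu>\<in>A. single \<mu> (lookup F \<mu>))" for A
    by (induction A rule: infinite_finite_induct) (auto intro: assms)
  then show ?thesis
    by (subst poly_mapping_sum_single)
qed

lemma obtain_key:
  assumes "F \<noteq> 0"
  obtains \<mu> where "\<mu> \<in> keys F"
  using assms by (metis poly_mapping_eqI in_keys_iff lookup_zero)

lemma split_off_variable:
  fixes \<mu> :: "'v \<Rightarrow>\<^sub>0 nat"
  assumes "u \<in> keys \<mu>"
  shows "\<mu> = single u 1 + (\<mu> - single u 1)" and "keys (\<mu> - single u 1) \<subseteq> keys \<mu>"
  using assms by (auto simp: poly_mapping_eq_iff fun_eq_iff lookup_add lookup_minus lookup_single when_def in_keys_iff)

definition pvar :: "'v \<Rightarrow> ('v, 'a::comm_ring_1) mpoly" where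
  "pvar u = single (single u 1) 1"

definition mon_eval :: "('v \<Rightarrow> 'r::comm_monoid_mult) \<Rightarrow> ('v \<Rightarrow>\<^sub>0 nat) \<Rightarrow> 'r" where
  "mon_eval v \<mu> = (\<Prod>u\<in>keys \<mu>. v u ^ lookup \<mu> u)"

definition poly_eval ::
    "('a::zero \<Rightarrow> 'r::comm_semiring_1) \<Rightarrow> ('v \<Rightarrow> 'r) \<Rightarrow> ('v, 'a) mpoly \<Rightarrow> 'r" where
  "poly_eval h v F = (\<Sum>\<mu>\<in>keys F. h (lookup F \<mu>) * mon_eval v \<mu>)"

lemma mon_eval_superset:
  assumes "finite A" "keys \<mu> \<subseteq> A"
  shows "mon_eval v \<mu> = (\<Prod>u\<in>A. v u ^ lookup \<mu> u)"
  unfolding mon_eval_def using assms by (intro prod.mono_neutral_left) (auto simp: in_keys_iff)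

lemma mon_eval_zero [simp]: "mon_eval v 0 = 1"
  by (simp add: mon_eval_def)

lemma mon_eval_add: "mon_eval v (\<mu> + \<nu>) = mon_eval v \<mu> * mon_eval v \<nu>"
proof -
  let ?A = "keys \<mu> \<union> keys \<nu>"
  have "keys (\<mu> + \<nu>) \<subseteq> ?A" by (rule keys_add)
  then show ?thesis
    by (simp add: mon_eval_superset[of ?A] lookup_add power_add prod.distrib)
qed

lemma mon_eval_single [simp]: "mon_eval v (single u n) = v u ^ n"
  by (simp add: mon_eval_def)

lemma mon_eval_cong:
  "(\<And>u. u \<in> keys \<mu> \<Longrightarrow> v u = w u) \<Longrightarrow> mon_eval v \<mu> = mon_eval w \<mu>"
  by (simp add: mon_eval_def)

lemma (in comm_ring_hom) hom_mon_eval: "f (mon_eval v \<mu>) = mon_eval (\<lambda>u. f (v u)) \<mu>"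
  by (simp add: mon_eval_def hom_prod hom_power)

lemma mon_eval_pvar: "mon_eval pvar \<mu> = (single \<mu> 1 :: ('v, 'a::comm_ring_1) mpoly)"
proof (induction \<mu> rule: poly_mapping_add_induct)
  case zero
  show ?case by simp
next
  case (add \<mu> \<nu>)
  then show ?case by (simp add: mon_eval_add mult_single)
next
  case (single u n)
  show ?case
    by (induction n) (auto simp: pvar_def mult_single single_add[symmetric])
qed

lemma poly_eval_single:
  "h 0 = 0 \<Longrightarrow> poly_eval h v (single \<mu> a) = h a * mon_eval v \<mu>"
  by (simp add: poly_eval_def)

lemma poly_eval_cong:
  assumes "\<And>\<mu> u. \<mu> \<in> keys F \<Longrightarrow> u \<in> keys \<mu> \<Longrightarrow> v u = w u"
  shows "poly_eval h v F = poly_eval h w F"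
  unfolding poly_eval_def by (intro sum.cong refl arg_cong2[of _ _ _ _ "(*)"] mon_eval_cong assms)

lemma poly_eval_hom:
  assumes "comm_ring_hom h"
  shows "comm_ring_hom (poly_eval h v)"
proof -
  interpret comm_ring_hom h by fact
  have add: "poly_eval h v (F + G) = poly_eval h v F + poly_eval h v G" for F G
    unfolding poly_eval_def
    by (rule setsum_keys_plus_distrib) (auto simp: hom_zero hom_add distrib_right)
  have sgl: "poly_eval h v (single \<mu> a) = h a * mon_eval v \<mu>" for \<mu> a
    by (rule poly_eval_single) (rule hom_zero)
  have zero: "poly_eval h v 0 = 0"
    by (simp add: poly_eval_def)
  have "poly_eval h v (F * G) = poly_eval h v F * poly_eval h v G" for F G
  proof (induction F rule: poly_mapping_add_induct)
    case (single \<mu> a)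
    show ?case
    proof (induction G rule: poly_mapping_add_induct)
      case (single \<nu> b)
      show ?case by (simp add: mult_single sgl hom_mult mon_eval_add algebra_simps)
    qed (auto simp: zero add algebra_simps)
  qed (auto simp: zero add algebra_simps)
  then show ?thesis
    by (intro comm_ring_hom.intro)
      (auto simp: add sgl hom_one simp flip: single_one)
qed

lemma poly_eval_pvar:
  "comm_ring_hom h \<Longrightarrow> poly_eval h v (pvar u) = v u"
  by (simp add: pvar_def poly_eval_single comm_ring_hom.hom_zero comm_ring_hom.hom_one)

lemma (in comm_ring_hom) hom_poly_eval:
  "f (poly_eval h v F) = poly_eval (\<lambda>a. f (h a)) (\<lambda>u. f (v u)) F"
  by (simp add: poly_eval_def hom_sum hom_mult hom_mon_eval)

lemma fps_nth_hom:
  assumes "comm_ring_hom f"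
  shows "comm_ring_hom (\<lambda>F. Abs_fps (\<lambda>n. f (fps_nth F n)))"
proof -
  interpret comm_ring_hom f by fact
  show ?thesis
    by unfold_locales
      (auto simp: fps_eq_iff hom_add hom_one hom_zero fps_mult_nth hom_sum hom_mult)
qed

lemma fps_const_hom: "comm_ring_hom (fps_const :: 'a::comm_ring_1 \<Rightarrow> _)"
  by unfold_locales auto

lemma single_zero_hom: "comm_ring_hom (single 0 :: 'a::comm_ring_1 \<Rightarrow> ('v, 'a) mpoly)"
  by unfold_locales (auto simp: single_add mult_single)

subsection \<open>Hasse derivatives\<close>

text \<open>The coefficient of t^j in the Taylor expansion of \<open>F\<close> at z + t, that is,
  the j-th derivative divided by j! in a form that makes sense in every characteristic. Since
  substitution is a ring homomorphism, additivity and the Leibniz rule are those of power series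
  coefficients.\<close>

definition hasse :: "'v \<Rightarrow> nat \<Rightarrow> ('v, 'a::comm_ring_1) mpoly \<Rightarrow> ('v, 'a) mpoly" where
  "hasse z j F = fps_nth (poly_eval (\<lambda>a. fps_const (single 0 a))
     (\<lambda>u. if u = z then fps_const (pvar u) + fps_X else fps_const (pvar u)) F) j"

context
  fixes z :: 'v
begin

interpretation T: comm_ring_hom "poly_eval (\<lambda>a. fps_const (single 0 a))
     (\<lambda>u. if u = z then fps_const (pvar u) + fps_X else fps_const (pvar u))
     :: ('v, 'a::comm_ring_1) mpoly \<Rightarrow> _"
  by (rule poly_eval_hom[OF comm_ring_hom_comp[OF single_zero_hom fps_const_hom]])

lemma hasse_add: "hasse z j (F + G) = hasse z j F + hasse z j G"
  by (simp add: hasse_def T.hom_add)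

lemma hasse_zero [simp]: "hasse z j 0 = 0"
  by (simp add: hasse_def T.hom_zero)

lemma hasse_sum: "hasse z j (sum F A) = (\<Sum>i\<in>A. hasse z j (F i))"
  by (simp add: hasse_def T.hom_sum fps_sum_nth)

lemma hasse_mult: "hasse z j (F * G) = (\<Sum>i=0..j. hasse z i F * hasse z (j - i) G)"
  by (simp add: hasse_def T.hom_mult fps_mult_nth)

end

lemma fps_nth_const_plus_X_power:
  fixes a :: "'a::comm_ring_1"
  shows "fps_nth ((fps_const a + fps_X) ^ m) j = of_nat (m choose j) * a ^ (m - j)"
proof -
  have "(fps_const a + fps_X) ^ m
      = (\<Sum>k\<le>m. of_nat (m choose k) * fps_X ^ k * fps_const a ^ (m - k))"
    by (subst add.commute) (rule binomial_ring)
  also have "\<dots> = (\<Sum>k\<le>m. fps_const (of_nat (m choose k) * a ^ (m - k)) * fps_X ^ k)"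
    by (intro sum.cong refl) (simp add: fps_of_nat[symmetric] mult_ac flip: fps_const_power fps_const_mult)
  also have "fps_nth \<dots> j = (\<Sum>k\<le>m. if k = j then of_nat (m choose k) * a ^ (m - k) else 0)"
    by (simp add: fps_sum_nth fps_X_power_nth eq_commute if_distrib cong: if_cong)
  also have "\<dots> = of_nat (m choose j) * a ^ (m - j)"
    by (auto simp: sum.delta binomial_eq_0)
  finally show ?thesis .
qed

lemma single_split:
  fixes \<mu> :: "'v \<Rightarrow>\<^sub>0 nat"
  obtains \<nu> where "\<mu> = \<nu> + single z (lookup \<mu> z)" "z \<notin> keys \<nu>"
proof
  have eq: "lookup (\<mu> - single z (lookup \<mu> z)) x = (if x = z then 0 else lookup \<mu> x)" for x
    by (auto simp: lookup_minus lookup_single when_def)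
  show "\<mu> = (\<mu> - single z (lookup \<mu> z)) + single z (lookup \<mu> z)"
    by (rule poly_mapping_eqI) (simp only: lookup_add eq, auto simp: lookup_single when_def)
  show "z \<notin> keys (\<mu> - single z (lookup \<mu> z))"
    unfolding in_keys_iff eq by simp
qed

lemma hasse_single:
  fixes a :: "'a::comm_ring_1"
  assumes "z \<notin> keys \<nu>"
  shows "hasse z j (single (\<nu> + single z m) a)
    = single (\<nu> + single z (m - j)) (of_nat (m choose j) * a)"
proof -
  define t :: "'b \<Rightarrow> ('b, 'a) mpoly fps" where
    "t = (\<lambda>u. if u = z then fps_const (pvar u) + fps_X else fps_const (pvar u))"
  interpret c: comm_ring_hom "fps_const :: ('b, 'a) mpoly \<Rightarrow> _"
    by (rule fps_const_hom)
  have "mon_eval t \<nu> = mon_eval (\<lambda>u. fps_const (pvar u)) \<nu>"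
    by (rule mon_eval_cong) (use assms in \<open>auto simp: t_def\<close>)
  then have 1: "mon_eval t \<nu> = fps_const (single \<nu> 1)"
    by (simp add: mon_eval_pvar flip: c.hom_mon_eval)
  have 2: "(pvar z :: ('b, 'a) mpoly) ^ k = single (single z k) 1" for k
    using mon_eval_pvar[of "single z k"] by simp
  have "hasse z j (single (\<nu> + single z m) a)
      = fps_nth (fps_const (single 0 a) * (fps_const (single \<nu> 1) * (fps_const (pvar z) + fps_X) ^ m)) j"
    unfolding hasse_def t_def[symmetric]
    by (subst poly_eval_single) (auto simp: mon_eval_add 1, simp add: t_def)
  also have "\<dots> = single 0 a * (single \<nu> 1 * (single 0 (of_nat (m choose j)) * single (single z (m - j)) 1))"
    by (simp add: fps_nth_const_plus_X_power 2)
  also have "\<dots> = single (\<nu> + single z (m - j)) (of_nat (m choose j) * a)"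
    by (simp only: mult_single) (simp add: mult_ac)
  finally show ?thesis .
qed

text \<open>Only the monomial \<open>\<kappa> + single z j\<close> contributes to the coefficient at
  \<open>\<kappa>\<close>. The factor is an integer, so Hasse derivatives commute with every change
  of coefficients.\<close>

lemma lookup_hasse:
  "lookup (hasse z j F) \<kappa> = of_nat ((lookup \<kappa> z + j) choose j) * lookup F (\<kappa> + single z j)"
proof (induction F rule: poly_mapping_add_induct)
  case (single \<mu> a)
  obtain \<nu> where \<nu>: "\<mu> = \<nu> + single z (lookup \<mu> z)" "z \<notin> keys \<nu>"
    by (rule single_split)
  obtain \<kappa>' where \<kappa>: "\<kappa> = \<kappa>' + single z (lookup \<kappa> z)" "z \<notin> keys \<kappa>'"
    by (rule single_split)
  define m k where "m = lookup \<mu> z" and "k = lookup \<kappa> z"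
  have eq: "\<nu> + single z a = \<kappa>' + single z b \<longleftrightarrow> \<nu> = \<kappa>' \<and> a = b" for a b
  proof
    assume h: "\<nu> + single z a = \<kappa>' + single z b"
    have "lookup (\<nu> + single z a) z = lookup (\<kappa>' + single z b) z"
      by (simp only: h)
    then have ab: "a = b"
      using \<nu>(2) \<kappa>(2) by (simp add: lookup_add in_keys_iff)
    show "\<nu> = \<kappa>' \<and> a = b"
      using h unfolding ab by (metis add_right_cancel)
  qed simp
  have \<mu>_eq: "\<mu> = \<nu> + single z m" and \<kappa>_eq: "\<kappa> = \<kappa>' + single z k"
    using \<nu>(1) \<kappa>(1) by (simp_all only: m_def k_def)
  have k2: "\<kappa> + single z j = \<kappa>' + single z (k + j)"
    unfolding \<kappa>_eq by (simp only: add.assoc single_add)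
  have "lookup (hasse z j (single \<mu> a)) \<kappa>
      = (of_nat (m choose j) * a when \<nu> = \<kappa>' \<and> m - j = k)"
    unfolding \<mu>_eq \<kappa>_eq hasse_single[OF \<nu>(2)] lookup_single eq ..
  moreover have "lookup (single \<mu> a) (\<kappa> + single z j) = (a when \<nu> = \<kappa>' \<and> m = k + j)"
    unfolding k2 unfolding \<mu>_eq lookup_single eq ..
  \<comment> \<open>For \<open>m < j\<close> the truncated difference \<open>m - j\<close> is 0 and
    may equal \<open>k\<close>; the binomial coefficient vanishes then.\<close>
  ultimately show ?case
    by (cases "m \<ge> j") (auto simp: when_def k_def[symmetric] binomial_eq_0)
qed (auto simp: hasse_add lookup_add distrib_left)

lemma hasse_0 [simp]: "hasse z 0 F = F"
  by (rule poly_mapping_eqI) (simp add: lookup_hasse)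

lemma hasse_const: "j > 0 \<Longrightarrow> hasse z j (single 0 a) = 0"
  by (rule poly_mapping_eqI)
    (auto simp: lookup_hasse lookup_single when_def poly_mapping_eq_iff fun_eq_iff lookup_add split: if_splits)

lemma keys_hasse: "\<kappa> \<in> keys (hasse z j F) \<Longrightarrow> \<kappa> + single z j \<in> keys F"
  by (auto simp: in_keys_iff lookup_hasse)

lemma hasse_notin:
  assumes "\<And>\<mu>. \<mu> \<in> keys G \<Longrightarrow> z \<notin> keys \<mu>" "j > 0"
  shows "hasse z j G = 0"
proof -
  have "keys (hasse z j G) = {}"
  proof (rule ccontr)
    assume "keys (hasse z j G) \<noteq> {}"
    then obtain \<kappa> where "\<kappa> \<in> keys (hasse z j G)" by blast
    then have "\<kappa> + single z j \<in> keys G" by (rule keys_hasse)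
    then have "z \<notin> keys (\<kappa> + single z j)" by (rule assms)
    then show False
      using assms(2) by (simp add: in_keys_iff lookup_add)
  qed
  then show ?thesis by (metis poly_mapping_eqI in_keys_iff empty_iff lookup_zero)
qed

lemma hasse_pvar: "hasse z 1 (pvar u) = (if u = z then 1 else 0)"
proof (cases "u = z")
  case True
  have "hasse z 1 (single (0 + single z 1) (1::'b)) = single (0 + single z (1 - 1)) (of_nat (1 choose 1) * 1)"
    by (rule hasse_single) simp
  then show ?thesis using True by (simp add: pvar_def)
next
  case False
  then show ?thesis by (intro trans[OF hasse_notin]) (auto simp: pvar_def split: if_splits)
qed

section \<open>Partial derivatives of the coefficients of power series, and the chain rule\<close>

definition fps_pderiv :: "'v \<Rightarrow> ('v, 'a::comm_ring_1) mpoly fps \<Rightarrow> ('v, 'a) mpoly fps" where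
  "fps_pderiv z f = Abs_fps (\<lambda>j. hasse z 1 (fps_nth f j))"

lemma fps_pderiv_sum: "fps_pderiv z (sum f A) = (\<Sum>i\<in>A. fps_pderiv z (f i))"
  by (simp add: fps_pderiv_def fps_eq_iff fps_sum_nth hasse_sum)

lemma fps_pderiv_mult: "fps_pderiv z (f * g) = fps_pderiv z f * g + f * fps_pderiv z g"
  by (simp add: fps_pderiv_def fps_eq_iff fps_mult_nth hasse_sum hasse_mult sum.distrib add.commute)

lemma fps_pderiv_const: "fps_pderiv z (fps_const (single 0 a)) = 0"
  by (simp add: fps_pderiv_def fps_eq_iff hasse_const)

lemma fps_pderiv_1: "fps_pderiv z 1 = 0"
  using fps_pderiv_const[of z 1] by simp

lemma fps_pderiv_power:
  "fps_pderiv z (f ^ n) = of_nat n * f ^ (n - 1) * fps_pderiv z f"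
proof (induction n)
  case (Suc n)
  then show ?case
    by (cases n) (simp_all add: fps_pderiv_mult fps_pderiv_1 algebra_simps)
qed (simp add: fps_pderiv_1)

lemma fps_pderiv_prod_eq_0:
  "(\<And>u. u \<in> A \<Longrightarrow> fps_pderiv z (f u) = 0) \<Longrightarrow> fps_pderiv z (prod f A) = 0"
  by (induction A rule: infinite_finite_induct) (simp_all add: fps_pderiv_1 fps_pderiv_mult)

text \<open>Differentiating \<open>t u ^ e\<close> brings out the factor e, so the derivative of
  \<open>t u\<close> matters only where e is nonzero in the ground ring. If it is 1 there for
  \<open>u = z\<close> and 0 for the other variables, only the formal derivative in \<open>z\<close>
  survives.\<close>

lemma fps_pderiv_poly_eval:
  fixes F :: "('v, 'a::comm_ring_1) mpoly" and t :: "'v \<Rightarrow> ('v, 'a) mpoly fps"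
  defines "h \<equiv> \<lambda>a. fps_const (single 0 a)"
  assumes t: "\<And>\<mu> u. \<mu> \<in> keys F \<Longrightarrow> u \<in> keys \<mu> \<Longrightarrow>
    (of_nat (lookup \<mu> u) :: 'a) = 0 \<or> fps_pderiv z (t u) = (if u = z then 1 else 0)"
  shows "fps_pderiv z (poly_eval h t F) = poly_eval h t (hasse z 1 F)"
proof -
  interpret h: comm_ring_hom h
    unfolding h_def by (rule comm_ring_hom_comp[OF single_zero_hom fps_const_hom])
  interpret e: comm_ring_hom "poly_eval h t"
    by (rule poly_eval_hom) (rule h.comm_ring_hom_axioms)
  have single: "poly_eval h t (single \<mu> a) = h a * mon_eval t \<mu>" for \<mu> a
    by (rule poly_eval_single) (rule h.hom_zero)
  have *: "fps_pderiv z (h a * mon_eval t \<mu>) = poly_eval h t (hasse z 1 (single \<mu> a))"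
    if \<mu>: "\<mu> \<in> keys F" for \<mu> a
  proof -
    obtain \<nu> where \<nu>: "\<mu> = \<nu> + single z (lookup \<mu> z)" "z \<notin> keys \<nu>"
      by (rule single_split)
    define m where "m = lookup \<mu> z"
    have \<mu>_eq: "\<mu> = \<nu> + single z m" using \<nu>(1) by (simp only: m_def)
    have pw: "fps_pderiv z (t u ^ lookup \<mu> u) = of_nat (lookup \<mu> u) * t u ^ (lookup \<mu> u - 1) * (if u = z then 1 else 0)"
      for u
    proof (cases "u \<in> keys \<mu>")
      case True
      from t[OF \<mu> this] show ?thesis
      proof
        assume "(of_nat (lookup \<mu> u) :: 'a) = 0"
        then have "(of_nat (lookup \<mu> u) :: ('v, 'a) mpoly fps) = 0"
          by (metis h.hom_of_nat h.hom_zero)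
        then show ?thesis by (simp add: fps_pderiv_power)
      next
        assume "fps_pderiv z (t u) = (if u = z then 1 else 0)"
        then show ?thesis by (simp add: fps_pderiv_power)
      qed
    qed (simp add: in_keys_iff fps_pderiv_1)
    have lk: "lookup \<nu> u = lookup \<mu> u" if "u \<in> keys \<nu>" for u
      using that \<nu>(2) unfolding \<mu>_eq by (auto simp: lookup_add lookup_single when_def)
    have "fps_pderiv z (mon_eval t \<nu>) = 0"
      unfolding mon_eval_def
    proof (rule fps_pderiv_prod_eq_0)
      fix u assume u: "u \<in> keys \<nu>"
      then have "u \<noteq> z" using \<nu>(2) by auto
      then show "fps_pderiv z (t u ^ lookup \<nu> u) = 0"
        using pw[of u] by (simp add: lk[OF u])
    qed
    moreover have "fps_pderiv z (t z ^ m) = of_nat m * t z ^ (m - 1)"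
      using pw[of z] by (simp add: m_def)
    ultimately have "fps_pderiv z (h a * mon_eval t \<mu>) = h a * (mon_eval t \<nu> * (of_nat m * t z ^ (m - 1)))"
      by (simp add: fps_pderiv_mult \<mu>_eq mon_eval_add h_def fps_pderiv_const)
    also have "\<dots> = poly_eval h t (hasse z 1 (single \<mu> a))"
      unfolding \<mu>_eq hasse_single[OF \<nu>(2)] single
      by (simp add: mon_eval_add h.hom_mult h.hom_of_nat mult_ac)
    finally show ?thesis .
  qed
  have "fps_pderiv z (poly_eval h t F) = (\<Sum>\<mu>\<in>keys F. fps_pderiv z (h (lookup F \<mu>) * mon_eval t \<mu>))"
    by (simp only: poly_eval_def fps_pderiv_sum)
  also have "\<dots> = (\<Sum>\<mu>\<in>keys F. poly_eval h t (hasse z 1 (single \<mu> (lookup F \<mu>))))"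
    by (intro sum.cong refl *)
  also have "\<dots> = poly_eval h t (hasse z 1 (\<Sum>\<mu>\<in>keys F. single \<mu> (lookup F \<mu>)))"
    by (simp only: e.hom_sum hasse_sum)
  also have "\<dots> = poly_eval h t (hasse z 1 F)"
    by (simp only: poly_mapping_sum_single[symmetric])
  finally show ?thesis .
qed

subsection \<open>Weighted homogeneous polynomials\<close>

definition weight :: "('v \<Rightarrow> nat) \<Rightarrow> ('v \<Rightarrow>\<^sub>0 nat) \<Rightarrow> nat" where
  "weight w \<mu> = (\<Sum>u\<in>keys \<mu>. lookup \<mu> u * w u)"

lemma weight_superset:
  assumes "finite A" "keys \<mu> \<subseteq> A"
  shows "weight w \<mu> = (\<Sum>u\<in>A. lookup \<mu> u * w u)"
  unfolding weight_def using assms by (intro sum.mono_neutral_left) (auto simp: in_keys_iff)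

lemma weight_zero [simp]: "weight w 0 = 0"
  by (simp add: weight_def)

lemma weight_add: "weight w (\<mu> + \<nu>) = weight w \<mu> + weight w \<nu>"
proof -
  let ?A = "keys \<mu> \<union> keys \<nu>"
  have "keys (\<mu> + \<nu>) \<subseteq> ?A" by (rule keys_add)
  then show ?thesis
    by (simp add: weight_superset[of ?A] lookup_add algebra_simps sum.distrib)
qed

lemma weight_single [simp]: "weight w (single u n) = n * w u"
  by (simp add: weight_def)

lemma weight_ge: "u \<in> keys \<mu> \<Longrightarrow> w u \<le> weight w \<mu>"
proof -
  assume u: "u \<in> keys \<mu>"
  then have "w u \<le> lookup \<mu> u * w u" by (auto simp: in_keys_iff)
  also have "\<dots> \<le> weight w \<mu>"
    unfolding weight_def by (rule member_le_sum) (use u in auto)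
  finally show ?thesis .
qed

lemma weight_eq_0:
  assumes "weight w \<mu> = 0" "\<And>u. u \<in> keys \<mu> \<Longrightarrow> 0 < w u"
  shows "\<mu> = 0"
  using assms weight_ge[of _ \<mu> w] by (metis obtain_key le_zero_eq less_irrefl)

text \<open>As a condition on keys this makes 0 homogeneous of every weight. The set
  \<open>V\<close> separates polynomials in \<open>E\<close> from those in \<open>Y\<close> inside
  one polynomial ring.\<close>

definition whom :: "('v \<Rightarrow> nat) \<Rightarrow> 'v set \<Rightarrow> nat \<Rightarrow> ('v, 'a::comm_ring_1) mpoly set" where
  "whom w V n = {F. \<forall>\<mu>\<in>keys F. keys \<mu> \<subseteq> V \<and> weight w \<mu> = n}"

lemma whomI: "(\<And>\<mu>. \<mu> \<in> keys F \<Longrightarrow> keys \<mu> \<subseteq> V \<and> weight w \<mu> = n) \<Longrightarrow> F \<in> whom w V n"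
  by (simp add: whom_def)

lemma whomD: "F \<in> whom w V n \<Longrightarrow> \<mu> \<in> keys F \<Longrightarrow> keys \<mu> \<subseteq> V \<and> weight w \<mu> = n"
  by (simp add: whom_def)

lemma whom_mono: "F \<in> whom w V n \<Longrightarrow> V \<subseteq> V' \<Longrightarrow> F \<in> whom w V' n"
  by (auto simp: whom_def)

lemma whom_zero [simp]: "0 \<in> whom w V n"
  by (simp add: whom_def)

lemma whom_add: "F \<in> whom w V n \<Longrightarrow> G \<in> whom w V n \<Longrightarrow> F + G \<in> whom w V n"
  using keys_add[of F G] by (auto simp: whom_def)

lemma whom_uminus: "F \<in> whom w V n \<Longrightarrow> - F \<in> whom w V n"
  by (simp add: whom_def in_keys_iff)

lemma whom_diff: "F \<in> whom w V n \<Longrightarrow> G \<in> whom w V n \<Longrightarrow> F - G \<in> whom w V n"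
  using whom_add[OF _ whom_uminus] by fastforce

lemma whom_sum: "(\<And>i. i \<in> A \<Longrightarrow> F i \<in> whom w V n) \<Longrightarrow> sum F A \<in> whom w V n"
  by (induction A rule: infinite_finite_induct) (auto intro: whom_add)

lemma whom_mult: "F \<in> whom w V m \<Longrightarrow> G \<in> whom w V n \<Longrightarrow> F * G \<in> whom w V (m + n)"
proof (rule whomI)
  fix \<mu> assume F: "F \<in> whom w V m" and G: "G \<in> whom w V n" and "\<mu> \<in> keys (F * G)"
  then obtain a b where ab: "\<mu> = a + b" "a \<in> keys F" "b \<in> keys G"
    using keys_mult[of F G] by blast
  then show "keys \<mu> \<subseteq> V \<and> weight w \<mu> = m + n"
    using whomD[OF F ab(2)] whomD[OF G ab(3)] keys_add[of a b] by (auto simp: weight_add)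
qed

lemma whom_single: "keys \<mu> \<subseteq> V \<Longrightarrow> weight w \<mu> = n \<Longrightarrow> single \<mu> a \<in> whom w V n"
  by (auto simp: whom_def split: if_splits)

lemma whom_const: "single 0 a \<in> whom w V 0"
  by (rule whom_single) auto

lemma whom_0:
  assumes "F \<in> whom w V 0" "\<And>u. u \<in> V \<Longrightarrow> 0 < w u"
  shows "F = single 0 (lookup F 0)"
proof (rule poly_mapping_eqI)
  fix \<mu>
  have "\<mu> = 0" if "\<mu> \<in> keys F"
    by (rule weight_eq_0[of w]) (use whomD[OF assms(1) that] assms(2) in auto)
  then show "lookup F \<mu> = lookup (single 0 (lookup F 0)) \<mu>"
    by (auto simp: lookup_single when_def in_keys_iff)
qed

lemma whom_hasse:
  assumes "F \<in> whom w V n" "j * w z \<le> n"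
  shows "hasse z j F \<in> whom w V (n - j * w z)"
proof (rule whomI)
  fix \<kappa> assume "\<kappa> \<in> keys (hasse z j F)"
  then have "\<kappa> + single z j \<in> keys F" by (rule keys_hasse)
  then have *: "keys (\<kappa> + single z j) \<subseteq> V" "weight w (\<kappa> + single z j) = n"
    using whomD[OF assms(1)] by auto
  have "keys \<kappa> \<subseteq> keys (\<kappa> + single z j)"
    by (auto simp: in_keys_iff lookup_add)
  with * show "keys \<kappa> \<subseteq> V \<and> weight w \<kappa> = n - j * w z"
    by (auto simp: weight_add)
qed

section \<open>Graded algebras with Hasse derivatives\<close>

text \<open>The degree \<open>n\<close> part of the square of the ideal of elements of positive
  degree. Lifts of bases of the \<open>M n\<close> modulo these sets are the natural candidates for
  algebra generators.\<close>

inductive_set decomposables :: "(nat \<Rightarrow> 'r::comm_ring_1 set) \<Rightarrow> nat \<Rightarrow> 'r set"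
  for M :: "nat \<Rightarrow> 'r set" and n :: nat where
  zero: "0 \<in> decomposables M n"
| step: "\<lbrakk>x \<in> M a; y \<in> M b; a > 0; b > 0; a + b = n; z \<in> decomposables M n\<rbrakk>
    \<Longrightarrow> x * y + z \<in> decomposables M n"

lemma decomposables_add:
  "z \<in> decomposables M n \<Longrightarrow> z' \<in> decomposables M n \<Longrightarrow> z + z' \<in> decomposables M n"
  by (induction rule: decomposables.induct) (auto simp: add.assoc intro: decomposables.step)

lemma decomposables_sum:
  "(\<And>i. i \<in> A \<Longrightarrow> f i \<in> decomposables M n) \<Longrightarrow> sum f A \<in> decomposables M n"
  by (induction A rule: infinite_finite_induct) (auto intro: decomposables.zero decomposables_add)

lemma decomposables_mult:
  "\<lbrakk>x \<in> M a; y \<in> M b; a > 0; b > 0; a + b = n\<rbrakk> \<Longrightarrow> x * y \<in> decomposables M n"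
  using decomposables.step[OF _ _ _ _ _ decomposables.zero] by fastforce

text \<open>The pieces are subsets of one ambient ring, which they need not span: the ultrapower
  used later also contains classes of sequences of unbounded degree. All arguments stay in one
  degree at a time.\<close>

locale graded_algebra =
  fixes c :: "'l::field \<Rightarrow> 'r::comm_ring_1" and M :: "nat \<Rightarrow> 'r set"
  assumes c_hom: "comm_ring_hom c"
    and const: "c a \<in> M 0"
    and zero: "0 \<in> M n"
    and add: "x \<in> M n \<Longrightarrow> y \<in> M n \<Longrightarrow> x + y \<in> M n"
    and mult: "x \<in> M m \<Longrightarrow> y \<in> M n \<Longrightarrow> x * y \<in> M (m + n)"
begin

sublocale c: comm_ring_hom c by (rule c_hom)

lemma scale: "x \<in> M n \<Longrightarrow> c a * x \<in> M n"
  using mult[OF const] by fastforce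

lemma uminus: "x \<in> M n \<Longrightarrow> - x \<in> M n"
  using scale[of x n "-1"] by (simp add: c.hom_uminus c.hom_one)

lemma sum: "(\<And>i. i \<in> A \<Longrightarrow> f i \<in> M n) \<Longrightarrow> sum f A \<in> M n"
  by (induction A rule: infinite_finite_induct) (auto intro: zero add)

lemma one: "1 \<in> M 0"
  using const[of 1] by (simp add: c.hom_one)

lemma power: "x \<in> M n \<Longrightarrow> x ^ k \<in> M (k * n)"
  by (induction k) (auto intro: one mult)

lemma prod: "finite A \<Longrightarrow> (\<And>i. i \<in> A \<Longrightarrow> f i \<in> M (d i)) \<Longrightarrow> prod f A \<in> M (sum d A)"
  by (induction A rule: finite_induct) (auto intro: one mult)

lemma decomposables_scale: "z \<in> decomposables M n \<Longrightarrow> c a * z \<in> decomposables M n"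
proof (induction rule: decomposables.induct)
  case (step x k y l z)
  have "(c a * x) * y + c a * z \<in> decomposables M n"
    using step scale by (intro decomposables.step) auto
  then show ?case by (simp add: algebra_simps)
qed (simp add: decomposables.zero)

lemma decomposables_uminus: "z \<in> decomposables M n \<Longrightarrow> - z \<in> decomposables M n"
  using decomposables_scale[of z n "-1"] by (simp add: c.hom_uminus c.hom_one)

lemma decomposables_subset: "z \<in> decomposables M n \<Longrightarrow> z \<in> M n"
  by (induction rule: decomposables.induct) (auto intro: zero add mult)

sublocale eval: comm_ring_hom "poly_eval c v" for v
  by (rule poly_eval_hom[OF c_hom])

lemma eval_single: "poly_eval c v (single \<mu> a) = c a * mon_eval v \<mu>"
  by (rule poly_eval_single) (rule c.hom_zero)

lemma mon_eval_mem:
  assumes "\<And>u. u \<in> keys \<mu> \<Longrightarrow> v u \<in> M (w u)"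
  shows "mon_eval v \<mu> \<in> M (weight w \<mu>)"
  unfolding mon_eval_def weight_def by (intro prod power assms finite_keys)

lemma eval_mem:
  assumes "F \<in> whom w V n" "\<And>u. u \<in> V \<Longrightarrow> v u \<in> M (w u)"
  shows "poly_eval c v F \<in> M n"
  unfolding poly_eval_def
proof (intro sum scale)
  fix \<mu> assume "\<mu> \<in> keys F"
  from whomD[OF assms(1) this] have "keys \<mu> \<subseteq> V" "weight w \<mu> = n" by auto
  then show "mon_eval v \<mu> \<in> M n"
    using mon_eval_mem[of \<mu> v w] assms(2) by auto
qed

lemma mon_eval_decomposable:
  assumes V: "\<And>u. u \<in> keys \<mu> \<Longrightarrow> v u \<in> M (w u) \<and> 0 < w u \<and> w u < weight w \<mu>" and "\<mu> \<noteq> 0"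
  shows "mon_eval v \<mu> \<in> decomposables M (weight w \<mu>)"
proof -
  obtain u where u: "u \<in> keys \<mu>"
    using \<open>\<mu> \<noteq> 0\<close> by (rule obtain_key)
  define \<mu>' where "\<mu>' = \<mu> - single u 1"
  have \<mu>: "\<mu> = single u 1 + \<mu>'" and "keys \<mu>' \<subseteq> keys \<mu>"
    using split_off_variable[OF u] by (simp_all only: \<mu>'_def)
  then have "mon_eval v \<mu>' \<in> M (weight w \<mu>')"
    by (intro mon_eval_mem) (use V in blast)
  moreover have "weight w \<mu> = w u + weight w \<mu>'"
    by (simp add: \<mu> weight_add)
  moreover have "mon_eval v \<mu> = v u * mon_eval v \<mu>'"
    by (simp add: \<mu> mon_eval_add)
  ultimately show ?thesis
    using V[OF u] by (auto intro!: decomposables_mult)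
qed

lemma eval_decomposable:
  assumes "F \<in> whom w {u \<in> V. w u < n} n" "n > 0" "\<And>u. u \<in> V \<Longrightarrow> v u \<in> M (w u) \<and> 0 < w u"
  shows "poly_eval c v F \<in> decomposables M n"
  unfolding poly_eval_def
proof (intro decomposables_sum decomposables_scale)
  fix \<mu> assume "\<mu> \<in> keys F"
  from whomD[OF assms(1) this] have *: "keys \<mu> \<subseteq> {u \<in> V. w u < n}" "weight w \<mu> = n" by auto
  then have "\<mu> \<noteq> 0" using assms(2) by auto
  with * show "mon_eval v \<mu> \<in> decomposables M n"
    using mon_eval_decomposable[of \<mu> v w] assms(3) by auto
qed

text \<open>Both factors of a product have degree below \<open>n\<close>, hence are values of
  polynomials, and a monomial of weight below \<open>n\<close> has no room for a variable of weight
  \<open>n\<close> or more.\<close>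

lemma decomposables_eval:
  assumes surj: "\<And>m x. m < n \<Longrightarrow> x \<in> M m \<Longrightarrow> \<exists>F\<in>whom w V m. poly_eval c v F = x"
    and x: "x \<in> decomposables M n"
  shows "\<exists>F\<in>whom w {u \<in> V. w u < n} n. poly_eval c v F = x"
  using x
proof induction
  case zero
  show ?case by (intro bexI[of _ 0]) (auto simp: eval.hom_zero)
next
  case (step x a y b z)
  obtain F where F: "F \<in> whom w V a" "poly_eval c v F = x"
    using surj[of a x] step by auto
  obtain G where G: "G \<in> whom w V b" "poly_eval c v G = y"
    using surj[of b y] step by auto
  obtain K where K: "K \<in> whom w {u \<in> V. w u < n} n" "poly_eval c v K = z"
    using step by auto
  have low: "F \<in> whom w {u \<in> V. w u < n} m" if "F \<in> whom w V m" "m < n" for F m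
  proof (rule whomI)
    fix \<mu> assume "\<mu> \<in> keys F"
    from whomD[OF that(1) this] weight_ge[of _ \<mu> w] that(2)
    show "keys \<mu> \<subseteq> {u \<in> V. w u < n} \<and> weight w \<mu> = m" by fastforce
  qed
  have "F * G \<in> whom w {u \<in> V. w u < n} (a + b)"
    by (intro whom_mult low F G) (use step in auto)
  then have "F * G + K \<in> whom w {u \<in> V. w u < n} n"
    using K(1) step by (auto intro: whom_add)
  then show ?case
    by (rule bexI[rotated]) (simp add: eval.hom_add eval.hom_mult F G K)
qed

end

text \<open>
  In the application \<open>R n\<close> is the ultraproduct of the spaces of forms of degree \<open>n\<close> over the algebraic
  closure, \<open>Q n\<close> is spanned by the forms over the ground field, and \<open>H i j\<close> is the \<open>j\<close>-th Hasse
  derivative in one variable. The last assumption holds because \<open>K\<close> is semi-perfect. Its index type is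
  fixed because a locale assumption cannot be polymorphic.
\<close>

locale hasse_algebra = graded_algebra c R for c :: "'l::field \<Rightarrow> 'r::comm_ring_1" and R +
  fixes Q :: "nat \<Rightarrow> 'r set" and H :: "'i \<Rightarrow> nat \<Rightarrow> 'r \<Rightarrow> 'r"
  assumes sub: "graded_algebra c Q"
    and Q_R: "x \<in> Q n \<Longrightarrow> x \<in> R n"
    and R_0: "x \<in> R 0 \<Longrightarrow> x \<in> range c"
    and H_hom: "comm_ring_hom (\<lambda>x. Abs_fps (\<lambda>j. H i j x))"
    and H_0: "H i 0 x = x"
    and H_const: "j > 0 \<Longrightarrow> H i j (c a) = 0"
    and H_R: "x \<in> R n \<Longrightarrow> j \<le> n \<Longrightarrow> H i j x \<in> R (n - j)"
    and H_zero: "x \<in> R n \<Longrightarrow> j > n \<Longrightarrow> H i j x = 0"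
    and H_Q: "x \<in> Q n \<Longrightarrow> j \<le> n \<Longrightarrow> H i j x \<in> Q (n - j)"
    and enough: "x \<in> R n \<Longrightarrow> n > 0 \<Longrightarrow> (\<And>i j. j > 0 \<Longrightarrow> H i j x = 0) \<Longrightarrow> x = 0"
    and reduced: "CHAR('l) > 0 \<Longrightarrow> x ^ CHAR('l) = 0 \<Longrightarrow> x = 0"
    and perfect: "CHAR('l) > 0 \<Longrightarrow> \<exists>b. b ^ CHAR('l) = (a :: 'l)"
    and frobenius_span: "\<lbrakk>CHAR('l) > 0; finite (I :: nat set);
      \<And>k. k \<in> I \<Longrightarrow> r k \<in> R (d k) \<and> s k \<in> Q (e k) \<and> 0 < d k \<and> CHAR('l) * d k + e k = n;
      (\<Sum>k\<in>I. r k ^ CHAR('l) * s k) \<in> Q n\<rbrakk>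
      \<Longrightarrow> (\<Sum>k\<in>I. r k ^ CHAR('l) * s k) \<in> decomposables Q n"
begin

sublocale Q: graded_algebra c Q by (rule sub)

text \<open>The index set is enumerated by an initial segment of the naturals; the application is to
  a sum over monomials.\<close>

lemma frobenius_span':
  assumes p: "CHAR('l) > 0" and "finite I"
    and mem: "\<And>k. k \<in> I \<Longrightarrow> r k \<in> R (d k) \<and> s k \<in> Q (e k) \<and> 0 < d k \<and> CHAR('l) * d k + e k = n"
    and Q: "(\<Sum>k\<in>I. r k ^ CHAR('l) * s k) \<in> Q n"
  shows "(\<Sum>k\<in>I. r k ^ CHAR('l) * s k) \<in> decomposables Q n"
proof -
  obtain b where b: "bij_betw b {0..<card I} I"
    using ex_bij_betw_nat_finite[OF \<open>finite I\<close>] by blast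
  have eq: "(\<Sum>k\<in>I. r k ^ CHAR('l) * s k) = (\<Sum>k\<in>{0..<card I}. r (b k) ^ CHAR('l) * s (b k))"
    by (rule sum.reindex_bij_betw[OF b, symmetric])
  show ?thesis
    using Q unfolding eq
  proof (rule frobenius_span[OF p, rotated 2])
    fix k assume "k \<in> {0..<card I}"
    then have "b k \<in> I" using b by (rule bij_betwE[rule_format, rotated])
    then show "r (b k) \<in> R (d (b k)) \<and> s (b k) \<in> Q (e (b k)) \<and> 0 < d (b k) \<and> CHAR('l) * d (b k) + e (b k) = n"
      by (rule mem)
  qed simp
qed

text \<open>\<open>Y\<close> lifts a basis of \<open>R n\<close> modulo decomposables, and
  \<open>E\<close> a basis of the image of \<open>Q n\<close> in the same quotient. Working modulo
  decomposables of \<open>R\<close> lets \<open>E\<close> extend to \<open>Y\<close>; that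
  \<open>E\<close> also spans modulo decomposables of \<open>Q\<close> is what the descent has to
  show.\<close>

definition generating_pair :: "nat \<Rightarrow> 'r set \<Rightarrow> 'r set \<Rightarrow> bool" where
  "generating_pair n E Y \<longleftrightarrow> E \<subseteq> Y \<and> E \<subseteq> Q n \<and> Y \<subseteq> R n \<and>
    (\<forall>x\<in>R n. \<exists>S a. finite S \<and> S \<subseteq> Y \<and> x - (\<Sum>y\<in>S. c (a y) * y) \<in> decomposables R n) \<and>
    (\<forall>x\<in>Q n. \<exists>S a. finite S \<and> S \<subseteq> E \<and> x - (\<Sum>y\<in>S. c (a y) * y) \<in> decomposables R n) \<and>
    (\<forall>S a y. finite S \<longrightarrow> S \<subseteq> Y \<longrightarrow> (\<Sum>y\<in>S. c (a y) * y) \<in> decomposables R n \<longrightarrow> y \<in> S \<longrightarrow> a y = 0)"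

lemma generating_pair_exists: "\<exists>E Y. generating_pair n E Y"
proof -
  interpret V: vector_space "\<lambda>a x. c a * x"
    by unfold_locales (auto simp: c.hom_add c.hom_mult c.hom_one algebra_simps)
  let ?W = "decomposables R n"
  have W: "V.subspace ?W"
    by (intro V.subspaceI) (auto intro: decomposables.zero decomposables_add decomposables_scale)
  obtain B0 where B0: "B0 \<subseteq> ?W" "V.independent B0" "?W \<subseteq> V.span B0"
    using V.maximal_independent_subset by metis
  then have span0: "V.span B0 = ?W"
    using V.span_minimal[OF B0(1) W] by blast
  \<comment> \<open>\<open>B1\<close> adds vectors of \<open>Q n\<close> to a basis of the
    decomposables, and \<open>B2\<close> then adds vectors of \<open>R n\<close>; the added vectors
    \<open>B1 - B0\<close> and \<open>B2 - B0\<close> are the two sets of generators.\<close>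
  obtain B1 where B1: "B0 \<subseteq> B1" "B1 \<subseteq> B0 \<union> Q n" "V.independent B1" "B0 \<union> Q n \<subseteq> V.span B1"
    using V.maximal_independent_subset_extend[of B0 "B0 \<union> Q n"] B0(2) by auto
  obtain B2 where B2: "B1 \<subseteq> B2" "B2 \<subseteq> B1 \<union> R n" "V.independent B2" "B1 \<union> R n \<subseteq> V.span B2"
    using V.maximal_independent_subset_extend[of B1 "B1 \<union> R n"] B1(3) by auto
  have spanning: "\<exists>S a. finite S \<and> S \<subseteq> B - B0 \<and> x - (\<Sum>y\<in>S. c (a y) * y) \<in> ?W"
    if B: "B0 \<subseteq> B" "x \<in> V.span B" for B x
  proof -
    have "B = B0 \<union> (B - B0)" using B(1) by blast
    then obtain u e where ue: "x = u + e" "u \<in> V.span B0" "e \<in> V.span (B - B0)"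
      using B(2) V.span_Un[of B0 "B - B0"] by auto
    then obtain S a where S: "finite S" "S \<subseteq> B - B0" "e = (\<Sum>y\<in>S. c (a y) * y)"
      by (auto simp: V.span_explicit)
    then show ?thesis using ue span0 by (intro exI[of _ S] exI[of _ a]) auto
  qed
  show ?thesis
  proof (rule exI[of _ "B1 - B0"], rule exI[of _ "B2 - B0"], unfold generating_pair_def, intro conjI ballI allI impI)
    show "\<exists>S a. finite S \<and> S \<subseteq> B2 - B0 \<and> x - (\<Sum>y\<in>S. c (a y) * y) \<in> ?W" if "x \<in> R n" for x
      using that B1(1) B2(1,4) by (intro spanning) auto
    show "\<exists>S a. finite S \<and> S \<subseteq> B1 - B0 \<and> x - (\<Sum>y\<in>S. c (a y) * y) \<in> ?W" if "x \<in> Q n" for x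
      using that B1(1,4) by (intro spanning) auto
    show "a y = 0" if S: "finite S" "S \<subseteq> B2 - B0" "(\<Sum>y\<in>S. c (a y) * y) \<in> ?W" "y \<in> S" for S a y
    proof -
      obtain T b where T: "finite T" "T \<subseteq> B0" "(\<Sum>y\<in>S. c (a y) * y) = (\<Sum>y\<in>T. c (b y) * y)"
        using S(3) unfolding span0[symmetric] by (auto simp: V.span_explicit)
      have disj: "S \<inter> T = {}" using S(2) T(2) by auto
      \<comment> \<open>A relation modulo decomposables turns into a linear relation on
        \<open>B2\<close> once its decomposable value is written in \<open>B0\<close> and moved to
        the other side.\<close>
      define u where "u y = (if y \<in> S then a y else - b y)" for y
      have "(\<Sum>y\<in>S \<union> T. c (u y) * y) = (\<Sum>y\<in>S. c (u y) * y) + (\<Sum>y\<in>T. c (u y) * y)"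
        by (rule sum.union_disjoint) (use S T disj in auto)
      also have "(\<Sum>y\<in>S. c (u y) * y) = (\<Sum>y\<in>S. c (a y) * y)"
        by (intro sum.cong) (auto simp: u_def)
      also have "(\<Sum>y\<in>T. c (u y) * y) = (\<Sum>y\<in>T. - (c (b y) * y))"
        using disj by (intro sum.cong) (auto simp: u_def c.hom_uminus)
      finally have 0: "(\<Sum>y\<in>S \<union> T. c (u y) * y) = 0"
        by (simp add: T(3) sum_negf)
      have "u y = 0"
        by (rule V.independentD[OF B2(3) _ _ 0]) (use S T B1(1) B2(1) in auto)
      then show "a y = 0" using S(4) by (simp add: u_def)
    qed
    show "B1 - B0 \<subseteq> B2 - B0" "B1 - B0 \<subseteq> Q n"
      using B1(2) B2(1) by auto
    then show "B2 - B0 \<subseteq> R n"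
      using B2(2) Q_R by blast
  qed
qed

end

text \<open>
  The generators are tagged with their degrees, so that they can serve as the variables of a weighted
  polynomial ring.
\<close>

locale generated_hasse_algebra = hasse_algebra c R Q H
  for c :: "'l::field \<Rightarrow> 'r::comm_ring_1" and R Q and H :: "'i \<Rightarrow> nat \<Rightarrow> 'r \<Rightarrow> 'r" +
  fixes E Y :: "(nat \<times> 'r) set"
  assumes E_Y: "E \<subseteq> Y"
    and Y_pos: "v \<in> Y \<Longrightarrow> 0 < fst v"
    and Y_R: "v \<in> Y \<Longrightarrow> snd v \<in> R (fst v)"
    and E_Q: "v \<in> E \<Longrightarrow> snd v \<in> Q (fst v)"
    and Y_span: "n > 0 \<Longrightarrow> x \<in> R n \<Longrightarrow> \<exists>S a. finite S \<and> S \<subseteq> {v \<in> Y. fst v = n} \<and>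
      x - (\<Sum>v\<in>S. c (a v) * snd v) \<in> decomposables R n"
    and E_span: "n > 0 \<Longrightarrow> x \<in> Q n \<Longrightarrow> \<exists>S a. finite S \<and> S \<subseteq> {v \<in> E. fst v = n} \<and>
      x - (\<Sum>v\<in>S. c (a v) * snd v) \<in> decomposables R n"
    and Y_indep: "finite S \<Longrightarrow> S \<subseteq> {v \<in> Y. fst v = n} \<Longrightarrow>
      (\<Sum>v\<in>S. c (a v) * snd v) \<in> decomposables R n \<Longrightarrow> v \<in> S \<Longrightarrow> a v = 0"
begin

abbreviation "hp \<equiv> whom (fst :: nat \<times> 'r \<Rightarrow> nat)"
abbreviation "ev \<equiv> poly_eval c (snd :: nat \<times> 'r \<Rightarrow> 'r)"

lemma ev_R: "F \<in> hp Y n \<Longrightarrow> ev F \<in> R n"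
  by (rule eval_mem) (auto intro: Y_R)

lemma linear_combination:
  assumes "finite S" "S \<subseteq> {v \<in> V. fst v = n}"
  shows "\<exists>F\<in>hp V n. ev F = (\<Sum>v\<in>S. c (a v) * snd v)"
proof (intro bexI[of _ "\<Sum>v\<in>S. single (single v 1) (a v)"])
  show "(\<Sum>v\<in>S. single (single v 1) (a v)) \<in> hp V n"
    by (intro whom_sum whom_single) (use assms in auto)
  show "ev (\<Sum>v\<in>S. single (single v 1) (a v)) = (\<Sum>v\<in>S. c (a v) * snd v)"
    by (simp add: eval.hom_sum eval_single)
qed

text \<open>Graded Nakayama argument: \<open>x\<close> is a linear combination of generators of
  degree \<open>n\<close> plus a decomposable element, which by induction is a polynomial in
  generators of smaller degree.\<close>

lemma surj: "x \<in> R n \<Longrightarrow> \<exists>F\<in>hp Y n. ev F = x"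
proof (induction n arbitrary: x rule: less_induct)
  case (less n)
  show ?case
  proof (cases "n = 0")
    case True
    then obtain a where "x = c a" using R_0 less.prems by blast
    then show ?thesis using True
      by (intro bexI[of _ "single 0 a"]) (auto simp: eval_single intro: whom_const)
  next
    case False
    then have "n > 0" by simp
    from Y_span[OF this less.prems] obtain S a where S: "finite S" "S \<subseteq> {v \<in> Y. fst v = n}"
      "x - (\<Sum>v\<in>S. c (a v) * snd v) \<in> decomposables R n"
      by (elim exE conjE) (rule that)
    obtain F where F: "F \<in> hp Y n" "ev F = (\<Sum>v\<in>S. c (a v) * snd v)"
      using linear_combination[OF S(1,2), of a] by auto
    obtain G where G: "G \<in> hp {v \<in> Y. fst v < n} n" "ev G = x - (\<Sum>v\<in>S. c (a v) * snd v)"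
      using decomposables_eval[OF less.IH S(3)] by auto
    have "F + G \<in> hp Y n"
      using F(1) G(1) by (intro whom_add) (auto intro: whom_mono)
    then show ?thesis
      by (rule bexI[rotated]) (simp add: eval.hom_add F G)
  qed
qed

lemma ev_pvar: "ev (pvar v) = snd v"
  by (rule poly_eval_pvar[OF c_hom])

lemma ev_const: "ev (single 0 a) = c a"
  by (simp add: eval_single)

text \<open>
  The Hasse derivatives lift to a homomorphism \<open>T\<close> from the polynomial ring in the generators to its power
  series ring. Let \<open>z\<close> be a generator outside \<open>E'\<close> of maximal degree among those with \<open>\<partial>F/\<partial>z \<noteq> 0\<close>. As \<open>T y - y\<close>
  involves only generators of lower degree than \<open>y\<close>, the chain rule gives \<open>\<partial>/\<partial>z (T F) = T (\<partial>F/\<partial>z)\<close>. The left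
  side is constant as a power series, so all Hasse derivatives of \<open>\<partial>F/\<partial>z\<close> vanish, which forces \<open>\<partial>F/\<partial>z = 0\<close>.
  The conclusion \<open>CHAR('l) dvd m\<close> means \<open>m = 0\<close> in characteristic 0.
\<close>

lemma exponents_divisible:
  fixes n
  assumes inj: "\<And>m F. m < n \<Longrightarrow> F \<in> hp Y m \<Longrightarrow> ev F = 0 \<Longrightarrow> F = 0"
    and E': "E' \<subseteq> Y"
    and E'_H: "\<And>v i j. v \<in> E' \<Longrightarrow> fst v < n \<Longrightarrow> j \<le> fst v \<Longrightarrow>
      \<exists>G\<in>hp E' (fst v - j). ev G = H i j (snd v)"
    and F: "F \<in> hp {v \<in> Y. fst v < n} n"
    and F_H: "\<And>i j. 0 < j \<Longrightarrow> j \<le> n \<Longrightarrow> \<exists>G\<in>hp E' (n - j). ev G = H i j (ev F)"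
    and z0: "z0 \<notin> E'" and \<mu>0: "\<mu>0 \<in> keys F"
  shows "CHAR('l) dvd lookup \<mu>0 z0"
proof (rule ccontr)
  assume ndvd: "\<not> CHAR('l) dvd lookup \<mu>0 z0"
  \<comment> \<open>The generators outside \<open>E'\<close> in which \<open>F\<close> has a nonzero
    partial derivative, described through exponents. Maximality of the degree of \<open>z\<close>
    among them will control which \<open>\<tau> u\<close> can contain \<open>z\<close>.\<close>
  define Z where "Z = {z. z \<notin> E' \<and> (\<exists>\<mu>\<in>keys F. \<not> CHAR('l) dvd lookup \<mu> z)}"
  have Z_keys: "Z \<subseteq> (\<Union>\<mu>\<in>keys F. keys \<mu>)"
  proof
    fix z assume "z \<in> Z"
    then obtain \<mu> where "\<mu> \<in> keys F" "\<not> CHAR('l) dvd lookup \<mu> z" by (auto simp: Z_def)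
    moreover from this(2) have "z \<in> keys \<mu>" by (metis dvd_0_right in_keys_iff)
    ultimately show "z \<in> (\<Union>\<mu>\<in>keys F. keys \<mu>)" by blast
  qed
  have "finite Z" by (rule finite_subset[OF Z_keys]) simp
  moreover have "Z \<noteq> {}" unfolding Z_def using z0 \<mu>0 ndvd by blast
  ultimately obtain z where z: "z \<in> Z" and z_max: "\<And>u. u \<in> Z \<Longrightarrow> fst u \<le> fst z"
    using Max_in[of "fst ` Z"] Max_ge[of "fst ` Z"]
    by (metis (no_types, lifting) finite_imageI image_iff image_is_empty)
  obtain \<mu> where \<mu>: "\<mu> \<in> keys F" "\<not> CHAR('l) dvd lookup \<mu> z" and z_E': "z \<notin> E'"
    using z unfolding Z_def by blast
  have "z \<in> keys \<mu>" using \<mu>(2) by (metis dvd_0_right in_keys_iff)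
  then have z_Y: "z \<in> Y" and z_n: "fst z < n"
    using whomD[OF F \<mu>(1)] by auto
  then have z_pos: "0 < fst z" using Y_pos by auto
  define F' where "F' = hasse z 1 F"
  have F': "F' \<in> hp {v \<in> Y. fst v < n} (n - fst z)"
    unfolding F'_def using whom_hasse[OF F, of 1 z] z_n by simp
  have F'_Y: "F' \<in> hp Y (n - fst z)"
    by (rule whom_mono[OF F']) auto
  \<comment> \<open>\<open>F'\<close> has the positive degree \<open>n - fst z\<close>, so once
    these derivatives vanish, \<open>enough\<close> gives \<open>ev F' = 0\<close>, and injectivity
    below \<open>n\<close> gives \<open>F' = 0\<close>.\<close>
  have "H i j (ev F') = 0" if j: "j > 0" for i j
  proof -
    \<comment> \<open>The coefficients of \<open>\<tau> v\<close> lift the Hasse derivatives of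
      \<open>v\<close>. The constant term is the variable itself, and for \<open>v\<close> in
      \<open>E'\<close> the higher coefficients are chosen in \<open>E'\<close>, so that they cannot
      involve \<open>z\<close>.\<close>
    have "\<exists>f. fps_nth f 0 = pvar v \<and> (\<forall>k>0. if k \<le> fst v
          then fps_nth f k \<in> hp (if v \<in> E' then E' else Y) (fst v - k) \<and> ev (fps_nth f k) = H i k (snd v)
          else fps_nth f k = 0)" if v: "v \<in> Y" "fst v < n" for v
    proof -
      have "\<exists>G. G \<in> hp (if v \<in> E' then E' else Y) (fst v - k) \<and> ev G = H i k (snd v)"
        if "k \<le> fst v" for k
      proof (cases "v \<in> E'")
        case True
        then show ?thesis using E'_H[OF True v(2) that] by auto
      next
        case False
        then show ?thesis using surj[OF H_R[OF Y_R[OF v(1)] that]] by auto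
      qed
      then obtain g where g: "\<And>k. k \<le> fst v \<Longrightarrow>
          g k \<in> hp (if v \<in> E' then E' else Y) (fst v - k) \<and> ev (g k) = H i k (snd v)"
        by metis
      show ?thesis
        by (rule exI[of _ "Abs_fps (\<lambda>k. if k = 0 then pvar v else if k \<le> fst v then g k else 0)"])
          (use g in auto)
    qed
    then obtain \<tau> where \<tau>0: "\<And>v. v \<in> Y \<Longrightarrow> fst v < n \<Longrightarrow> fps_nth (\<tau> v) 0 = pvar v"
      and \<tau>: "\<And>v k. v \<in> Y \<Longrightarrow> fst v < n \<Longrightarrow> k > 0 \<Longrightarrow> (if k \<le> fst v
          then fps_nth (\<tau> v) k \<in> hp (if v \<in> E' then E' else Y) (fst v - k) \<and> ev (fps_nth (\<tau> v) k) = H i k (snd v)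
          else fps_nth (\<tau> v) k = 0)"
      by metis
    define h :: "'l \<Rightarrow> (nat \<times> 'r, 'l) mpoly fps" where "h a = fps_const (single 0 a)" for a
    have h_hom: "comm_ring_hom h"
      unfolding h_def by (rule comm_ring_hom_comp[OF single_zero_hom fps_const_hom])
    interpret T: comm_ring_hom "poly_eval h \<tau>"
      by (rule poly_eval_hom[OF h_hom])
    interpret Hi: comm_ring_hom "\<lambda>x. Abs_fps (\<lambda>j. H i j x)" by (rule H_hom)
    interpret ev': comm_ring_hom "\<lambda>f. Abs_fps (\<lambda>j. ev (fps_nth f j))"
      by (rule fps_nth_hom[OF eval.comm_ring_hom_axioms])
    have \<tau>_ev: "ev (fps_nth (\<tau> v) k) = H i k (snd v)" if "v \<in> Y" "fst v < n" for v k
      using \<tau>0[OF that] \<tau>[OF that, of k] H_zero[OF Y_R[OF that(1)], of k i]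
      by (cases "k = 0") (auto simp: ev_pvar H_0 eval.hom_zero split: if_splits)
    have T_ev: "ev (fps_nth (poly_eval h \<tau> G) k) = H i k (ev G)"
      if G: "G \<in> hp {v \<in> Y. fst v < n} m" for G m k
    proof -
      have "Abs_fps (\<lambda>k. ev (fps_nth (poly_eval h \<tau> G) k))
        = poly_eval (\<lambda>a. Abs_fps (\<lambda>k. ev (fps_nth (h a) k))) (\<lambda>v. Abs_fps (\<lambda>k. ev (fps_nth (\<tau> v) k))) G"
        by (rule ev'.hom_poly_eval)
      also have "(\<lambda>a. Abs_fps (\<lambda>k. ev (fps_nth (h a) k))) = (\<lambda>a. Abs_fps (\<lambda>k. H i k (c a)))"
        by (auto simp: fun_eq_iff fps_eq_iff h_def ev_const H_0 H_const eval.hom_zero)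
      also have "poly_eval (\<lambda>a. Abs_fps (\<lambda>k. H i k (c a))) (\<lambda>v. Abs_fps (\<lambda>k. ev (fps_nth (\<tau> v) k))) G
          = poly_eval (\<lambda>a. Abs_fps (\<lambda>k. H i k (c a))) (\<lambda>v. Abs_fps (\<lambda>k. H i k (snd v))) G"
      proof (rule poly_eval_cong)
        fix \<mu> u assume "\<mu> \<in> keys G" "u \<in> keys \<mu>"
        then have "u \<in> Y" "fst u < n" using whomD[OF G] by auto
        then show "Abs_fps (\<lambda>k. ev (fps_nth (\<tau> u) k)) = Abs_fps (\<lambda>k. H i k (snd u))"
          by (simp only: \<tau>_ev)
      qed
      also have "\<dots> = Abs_fps (\<lambda>k. H i k (ev G))"
        by (rule Hi.hom_poly_eval[symmetric])
      finally show ?thesis by (simp add: fps_eq_iff)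
    qed
    \<comment> \<open>The power series of total weight \<open>m\<close> when the formal variable has
      weight 1. Writing \<open>weight fst \<mu> + k = m\<close> instead of a truncated difference
      forces the coefficients with \<open>k > m\<close> to vanish.\<close>
    define W where "W m = {f :: (nat \<times> 'r, 'l) mpoly fps.
        \<forall>k. \<forall>\<mu>\<in>keys (fps_nth f k). keys \<mu> \<subseteq> Y \<and> weight fst \<mu> + k = m}" for m
    interpret W: graded_algebra h W
    proof (rule graded_algebra.intro)
      show "h a \<in> W 0" for a
        by (auto simp: W_def h_def split: if_splits)
      show "x + y \<in> W m" if "x \<in> W m" "y \<in> W m" for x y m
      proof -
        have "keys (fps_nth (x + y) k) \<subseteq> keys (fps_nth x k) \<union> keys (fps_nth y k)" for k
          by (simp add: keys_add)
        with that show ?thesis unfolding W_def by blast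
      qed
      show "x * y \<in> W (m + m')" if x: "x \<in> W m" and y: "y \<in> W m'" for x y m m'
        unfolding W_def
      proof (intro CollectI allI ballI)
        fix k \<mu> assume "\<mu> \<in> keys (fps_nth (x * y) k)"
        then have "(\<Sum>i=0..k. lookup (fps_nth x i * fps_nth y (k - i)) \<mu>) \<noteq> 0"
          by (simp add: in_keys_iff fps_mult_nth lookup_sum)
        then obtain i where i: "i \<le> k" "\<mu> \<in> keys (fps_nth x i * fps_nth y (k - i))"
          by (auto simp: in_keys_iff elim: sum.not_neutral_contains_not_neutral)
        then obtain a b where ab: "\<mu> = a + b" "a \<in> keys (fps_nth x i)" "b \<in> keys (fps_nth y (k - i))"
          using keys_mult by blast
        have "keys a \<subseteq> Y \<and> weight fst a + i = m" "keys b \<subseteq> Y \<and> weight fst b + (k - i) = m'"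
          using x y ab(2,3) by (auto simp: W_def)
        then show "keys \<mu> \<subseteq> Y \<and> weight fst \<mu> + k = m + m'"
          using i(1) keys_add[of a b] by (auto simp: ab(1) weight_add)
      qed
    qed (auto simp: W_def h_hom)
    have T_W: "poly_eval h \<tau> F \<in> W n"
    proof (rule W.eval_mem[OF F])
      fix u assume u: "u \<in> {v \<in> Y. fst v < n}"
      then have uY: "u \<in> Y" "fst u < n" by auto
      show "\<tau> u \<in> W (fst u)"
        unfolding W_def
      proof (intro CollectI allI ballI)
        fix k \<kappa> assume \<kappa>: "\<kappa> \<in> keys (fps_nth (\<tau> u) k)"
        show "keys \<kappa> \<subseteq> Y \<and> weight fst \<kappa> + k = fst u"
        proof (cases "k = 0")
          case True
          then show ?thesis
            using \<kappa> \<tau>0[OF uY] uY by (auto simp: pvar_def split: if_splits)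
        next
          case False
          then have k: "k > 0" by simp
          have le: "k \<le> fst u"
            using \<tau>[OF uY k] \<kappa> by (cases "k \<le> fst u") auto
          then have "fps_nth (\<tau> u) k \<in> hp (if u \<in> E' then E' else Y) (fst u - k)"
            using \<tau>[OF uY k] by simp
          from whomD[OF this \<kappa>] show ?thesis using le E' by (auto split: if_splits)
        qed
      qed
    qed
    \<comment> \<open>For \<open>j \<le> n\<close> the coefficient and the polynomial
      \<open>G\<close> over \<open>E'\<close> have the same value in degree
      \<open>n - j < n\<close>; they coincide by injectivity, so the coefficient does not involve
      \<open>z\<close>.\<close>
    have T_const: "hasse z 1 (fps_nth (poly_eval h \<tau> F) j) = 0"
    proof (cases "j \<le> n")
      case False
      have "\<mu> \<notin> keys (fps_nth (poly_eval h \<tau> F) j)" for \<mu>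
        using T_W False unfolding W_def by fastforce
      then show ?thesis
        by (intro hasse_notin) auto
    next
      case True
      obtain G where G: "G \<in> hp E' (n - j)" "ev G = H i j (ev F)"
        using F_H[OF j True] by auto
      have "fps_nth (poly_eval h \<tau> F) j \<in> hp Y (n - j)"
        using T_W unfolding W_def by (intro whomI) fastforce
      moreover have "G \<in> hp Y (n - j)"
        using G(1) E' by (rule whom_mono)
      ultimately have "fps_nth (poly_eval h \<tau> F) j - G \<in> hp Y (n - j)"
        by (rule whom_diff)
      moreover have "ev (fps_nth (poly_eval h \<tau> F) j - G) = 0"
        by (simp add: eval.hom_diff T_ev[OF F] G(2))
      ultimately have "fps_nth (poly_eval h \<tau> F) j - G = 0"
        by (intro inj[of "n - j"]) (use j True in auto)
      then show ?thesis
        using whomD[OF G(1)] z_E' by (auto intro!: hasse_notin)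
    qed
    have "fps_pderiv z (poly_eval h \<tau> F) = poly_eval h \<tau> F'"
      unfolding F'_def h_def
    proof (rule fps_pderiv_poly_eval)
      fix \<nu> u assume \<nu>: "\<nu> \<in> keys F" and u: "u \<in> keys \<nu>"
      then have uY: "u \<in> Y" "fst u < n" using whomD[OF F] by auto
      have "fps_pderiv z (\<tau> u) = (if u = z then 1 else 0)" if nd: "\<not> CHAR('l) dvd lookup \<nu> u"
      proof -
        \<comment> \<open>For \<open>u\<close> in \<open>E'\<close> the choice of lifts excludes
          \<open>z\<close>. Otherwise \<open>u\<close> lies in \<open>Z\<close>, so
          \<open>fst u \<le> fst z\<close>, and a monomial of weight \<open>fst u - k\<close> is too
          light to contain \<open>z\<close>.\<close>
        have "hasse z 1 (fps_nth (\<tau> u) k) = 0" if k: "k > 0" for k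
        proof (cases "k \<le> fst u")
          case True
          have *: "fps_nth (\<tau> u) k \<in> hp (if u \<in> E' then E' else Y) (fst u - k)"
            using \<tau>[OF uY k] True by simp
          show ?thesis
          proof (rule hasse_notin)
            fix \<kappa> assume \<kappa>: "\<kappa> \<in> keys (fps_nth (\<tau> u) k)"
            show "z \<notin> keys \<kappa>"
            proof (cases "u \<in> E'")
              case True
              then show ?thesis using whomD[OF * \<kappa>] z_E' by auto
            next
              case False
              then have "u \<in> Z" unfolding Z_def using nd \<nu> by blast
              then have "fst u \<le> fst z" by (rule z_max)
              then show ?thesis
                using whomD[OF * \<kappa>] weight_ge[of z \<kappa> fst] True k by fastforce
            qed
          qed simp
        qed (use \<tau>[OF uY k] in simp)
        moreover have "hasse z 1 (fps_nth (\<tau> u) 0) = (if u = z then 1 else 0)"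
          by (simp only: \<tau>0[OF uY] hasse_pvar)
        ultimately have "hasse z 1 (fps_nth (\<tau> u) k) = fps_nth (if u = z then 1 else 0) k" for k
          by (cases "k = 0") auto
        then show ?thesis
          by (simp add: fps_pderiv_def fps_eq_iff)
      qed
      then show "(of_nat (lookup \<nu> u) :: 'l) = 0 \<or> fps_pderiv z (\<tau> u) = (if u = z then 1 else 0)"
        unfolding of_nat_eq_0_iff_char_dvd by blast
    qed
    then have "fps_nth (poly_eval h \<tau> F') j = 0"
      using T_const by (metis fps_pderiv_def fps_nth_Abs_fps)
    then show ?thesis
      using T_ev[OF F', of j] by (simp add: eval.hom_zero)
  qed
  then have "ev F' = 0"
    using enough[OF ev_R[OF F'_Y]] z_n by simp
  then have "F' = 0"
    using inj[OF _ F'_Y] z_pos z_n by simp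
  \<comment> \<open>The coefficient of \<open>F'\<close> at \<open>\<mu>\<close> with one
    \<open>z\<close> removed is the exponent of \<open>z\<close> times the coefficient of
    \<open>F\<close> at \<open>\<mu>\<close>; both factors are nonzero in the ground field.\<close>
  then have "of_nat ((lookup (\<mu> - single z 1) z + 1) choose 1) * lookup F (\<mu> - single z 1 + single z 1) = 0"
    by (simp only: F'_def lookup_zero flip: lookup_hasse)
  moreover have "\<mu> - single z 1 + single z 1 = \<mu>"
    using split_off_variable(1)[OF \<open>z \<in> keys \<mu>\<close>] by (simp only: add.commute)
  moreover have "lookup (\<mu> - single z 1) z + 1 = lookup \<mu> z"
    using \<open>z \<in> keys \<mu>\<close> by (auto simp: lookup_minus in_keys_iff)
  ultimately have "of_nat (lookup \<mu> z) * lookup F \<mu> = 0"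
    by (simp only: choose_one)
  then show False
    using \<mu> by (auto simp: of_nat_eq_0_iff_char_dvd in_keys_iff)
qed

section \<open>Algebraic independence of the generators and generation of \<open>Q\<close>\<close>

lemma c_eq_0:
  assumes "c a = 0"
  shows "a = 0"
proof (rule ccontr)
  assume "a \<noteq> 0"
  then have "c (a * inverse a) = 1" by (simp add: c.hom_one)
  with assms show False by (simp add: c.hom_mult)
qed

lemma CHAR_r: "CHAR('r) = CHAR('l)"
proof (rule CHAR_eqI)
  have "(of_nat n :: 'r) = 0 \<longleftrightarrow> (of_nat n :: 'l) = 0" for n
  proof -
    have "(of_nat n :: 'r) = c (of_nat n)" by (rule c.hom_of_nat[symmetric])
    then show ?thesis by (auto simp: c.hom_zero dest: c_eq_0)
  qed
  then show "(of_nat CHAR('l) :: 'r) = 0" "\<And>x. (of_nat x :: 'r) = 0 \<Longrightarrow> CHAR('l) dvd x"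
    by (auto simp: of_nat_eq_0_iff_char_dvd)
qed

lemma hp_0: "F \<in> hp Y 0 \<Longrightarrow> F = single 0 (lookup F 0)"
  by (erule whom_0) (rule Y_pos)

lemma prime_CHAR: "CHAR('l) > 0 \<Longrightarrow> prime CHAR('l)"
  by (rule prime_CHAR_semidom)

text \<open>
  By \<open>exponents_divisible\<close> with empty \<open>E'\<close>, every exponent in a relation between generators is divisible by
  the characteristic, so the relation is a \<open>p\<close>-th power of a relation of smaller degree.
\<close>

lemma injective_step:
  assumes IH: "\<And>m F. m < n \<Longrightarrow> F \<in> hp Y m \<Longrightarrow> ev F = 0 \<Longrightarrow> F = 0"
    and n: "n > 0" and F: "F \<in> hp Y n" and ev: "ev F = 0"
  shows "F = 0"
proof -
  \<comment> \<open>The monomials containing a generator of degree \<open>n\<close>. Weight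
    \<open>n\<close> leaves no room for anything else, so each is one generator with exponent
    1.\<close>
  let ?L = "{\<mu> \<in> keys F. \<not> keys \<mu> \<subseteq> {v \<in> Y. fst v < n}}"
  define S where "S = {v \<in> Y. fst v = n \<and> single v (1::nat) \<in> keys F}"
  have inj_single: "inj_on (\<lambda>v. single v (1::nat)) S"
    by (intro inj_onI) (metis keys_single singletonD singletonI one_neq_zero)
  have L: "?L = (\<lambda>v. single v (1::nat)) ` S"
  proof (intro equalityI subsetI)
    fix \<mu> assume "\<mu> \<in> ?L"
    then obtain u where \<mu>: "\<mu> \<in> keys F" and u: "u \<in> keys \<mu>" and nu: "u \<notin> {v \<in> Y. fst v < n}"
      by blast
    have Y: "keys \<mu> \<subseteq> Y" and wt: "weight fst \<mu> = n" using whomD[OF F \<mu>] by auto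
    then have un: "u \<in> Y" "fst u = n" using nu u weight_ge[of u \<mu> fst] by auto
    define \<nu> where "\<nu> = \<mu> - single u 1"
    have \<mu>_eq: "\<mu> = single u 1 + \<nu>" and "keys \<nu> \<subseteq> keys \<mu>"
      using split_off_variable[OF u] by (simp_all only: \<nu>_def)
    then have "weight fst \<nu> = 0" using wt un by (simp add: weight_add)
    then have "\<nu> = 0"
      by (rule weight_eq_0) (use Y_pos Y \<open>keys \<nu> \<subseteq> keys \<mu>\<close> in blast)
    then show "\<mu> \<in> (\<lambda>v. single v (1::nat)) ` S"
      using \<mu> \<mu>_eq un by (auto simp: S_def)
  next
    fix \<mu> assume "\<mu> \<in> (\<lambda>v. single v (1::nat)) ` S"
    then obtain v where "v \<in> S" "\<mu> = single v 1" by blast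
    then show "\<mu> \<in> ?L" by (simp add: S_def)
  qed
  have "finite ?L" by simp
  then have "finite S" unfolding L using inj_single by (rule finite_imageD)
  define G where "G = (\<Sum>v\<in>S. single (single v (1::nat)) (lookup F (single v 1)))"
  have F_split: "F = G + (\<Sum>\<mu>\<in>keys F - ?L. single \<mu> (lookup F \<mu>))"
  proof -
    have "F = (\<Sum>\<mu>\<in>keys F. single \<mu> (lookup F \<mu>))" by (rule poly_mapping_sum_single)
    also have "\<dots> = (\<Sum>\<mu>\<in>keys F - ?L. single \<mu> (lookup F \<mu>)) + (\<Sum>\<mu>\<in>?L. single \<mu> (lookup F \<mu>))"
      by (rule sum.subset_diff) auto
    also have "(\<Sum>\<mu>\<in>?L. single \<mu> (lookup F \<mu>)) = G"
      unfolding L G_def using inj_single by (rule sum.reindex_cong) auto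
    finally show ?thesis by (simp only: add.commute)
  qed
  define F2 where "F2 = (\<Sum>\<mu>\<in>keys F - ?L. single \<mu> (lookup F \<mu>))"
  have F2: "F2 \<in> hp {v \<in> Y. fst v < n} n"
    unfolding F2_def by (intro whom_sum whom_single) (use whomD[OF F] in auto)
  have "ev F2 \<in> decomposables R n"
    by (rule eval_decomposable[OF F2 n]) (auto intro: Y_R Y_pos)
  moreover have "ev G = - ev F2"
    using ev F_split unfolding F2_def[symmetric] by (simp add: eval.hom_add eq_neg_iff_add_eq_0)
  \<comment> \<open>The linear part of the relation is minus the value of a polynomial in generators
    of smaller degree, hence decomposable; independence modulo decomposables then kills its
    coefficients.\<close>
  ultimately have dec: "(\<Sum>v\<in>S. c (lookup F (single v 1)) * snd v) \<in> decomposables R n"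
    by (simp add: G_def eval.hom_sum eval_single decomposables_uminus)
  have S_sub: "S \<subseteq> {v \<in> Y. fst v = n}" by (auto simp: S_def)
  have "v \<notin> S" for v
  proof
    assume "v \<in> S"
    then have "single v (1::nat) \<in> keys F" by (simp add: S_def)
    moreover have "lookup F (single v (1::nat)) = 0"
      by (rule Y_indep[OF \<open>finite S\<close> S_sub dec \<open>v \<in> S\<close>])
    ultimately show False by (simp add: in_keys_iff)
  qed
  then have "S = {}" by blast
  then have "?L = {}" by (simp add: L)
  then have Flow: "F \<in> hp {v \<in> Y. fst v < n} n"
    using whomD[OF F] by (intro whomI) blast
  interpret Hi: comm_ring_hom "\<lambda>x. Abs_fps (\<lambda>j. H i j x)" for i by (rule H_hom)
  have H_0': "H i k 0 = 0" for i k
    using Hi.hom_zero[of i] by (simp add: fps_eq_iff)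
  have dvd: "CHAR('l) dvd lookup \<mu> z" if "\<mu> \<in> keys F" for \<mu> z
  proof (rule exponents_divisible[where E' = "{}" and F = F, OF IH _ _ Flow])
    show "\<exists>G\<in>hp {} (n - j). ev G = H i j (ev F)" for i j
      by (intro bexI[of _ 0]) (auto simp: ev H_0' eval.hom_zero)
  qed (use that in auto)
  show ?thesis
  proof (rule ccontr)
    assume "F \<noteq> 0"
    have p: "CHAR('l) > 0"
    proof (rule ccontr)
      assume "\<not> CHAR('l) > 0"
      then have zero: "\<mu> = 0" if "\<mu> \<in> keys F" for \<mu>
        using dvd[OF that] by (intro poly_mapping_eqI) auto
      obtain \<mu> where "\<mu> \<in> keys F"
        using \<open>F \<noteq> 0\<close> by (rule obtain_key)
      then show False using whomD[OF F, of \<mu>] zero[of \<mu>] n by auto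
    qed
    note prime = prime_CHAR[OF p]
    define p where "p = CHAR('l)"
    have p1: "p > 1" using prime unfolding p_def by (rule prime_gt_1_nat)
    define \<delta> :: "(nat \<times> 'r \<Rightarrow>\<^sub>0 nat) \<Rightarrow> (nat \<times> 'r \<Rightarrow>\<^sub>0 nat)" where
      "\<delta> = Poly_Mapping.map (\<lambda>k. k div p)"
    have \<delta>: "lookup (\<delta> \<mu>) u = lookup \<mu> u div p" for \<mu> u
      by (auto simp: \<delta>_def Poly_Mapping.map.rep_eq when_def)
    have \<delta>': "lookup \<mu> u = lookup (\<delta> \<mu>) u * p" if "\<mu> \<in> keys F" for \<mu> u
      using dvd[OF that, of u] by (simp add: \<delta> p_def)
    have keys_\<delta>: "keys (\<delta> \<mu>) = keys \<mu>" if "\<mu> \<in> keys F" for \<mu>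
      using \<delta>'[OF that] p1 by (auto simp: in_keys_iff)
    have weight_\<delta>: "weight fst \<mu> = weight fst (\<delta> \<mu>) * p" if "\<mu> \<in> keys F" for \<mu>
      unfolding weight_def keys_\<delta>[OF that] by (simp add: \<delta>'[OF that] sum_distrib_left sum_distrib_right mult_ac)
    have mon_\<delta>: "mon_eval snd \<mu> = mon_eval snd (\<delta> \<mu>) ^ p" if "\<mu> \<in> keys F" for \<mu> :: "nat \<times> 'r \<Rightarrow>\<^sub>0 nat"
      unfolding mon_eval_def keys_\<delta>[OF that] by (simp add: \<delta>'[OF that] power_mult prod_power_distrib)
    have inj_\<delta>: "inj_on \<delta> (keys F)"
      by (intro inj_onI poly_mapping_eqI) (metis \<delta>')
    obtain rt :: "'l \<Rightarrow> 'l" where rt: "\<And>a. rt a ^ p = a"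
      using perfect[OF p] unfolding p_def by metis
    \<comment> \<open>The p-th root of \<open>F\<close>: exponents are divided by p and coefficients
      replaced by p-th roots. By additivity of the Frobenius map, \<open>ev G ^ p = ev F\<close>, so
      reducedness makes \<open>G\<close> a relation of smaller degree.\<close>
    define G where "G = (\<Sum>\<mu>\<in>keys F. single (\<delta> \<mu>) (rt (lookup F \<mu>)))"
    have "ev G ^ p = (\<Sum>\<mu>\<in>keys F. (c (rt (lookup F \<mu>)) * mon_eval snd (\<delta> \<mu>)) ^ p)"
      unfolding G_def eval.hom_sum eval_single
      by (rule freshmans_dream_sum) (simp_all add: CHAR_r prime p_def)
    also have "\<dots> = ev F"
      unfolding poly_eval_def
      by (intro sum.cong refl) (simp add: power_mult_distrib rt mon_\<delta> flip: c.hom_power)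
    finally have "ev G = 0"
      using ev reduced[OF p] unfolding p_def by simp
    moreover have "G \<in> hp Y (n div p)"
      unfolding G_def
    proof (intro whom_sum whom_single)
      fix \<mu> assume \<mu>: "\<mu> \<in> keys F"
      show "keys (\<delta> \<mu>) \<subseteq> Y" using keys_\<delta>[OF \<mu>] whomD[OF F \<mu>] by simp
      show "weight fst (\<delta> \<mu>) = n div p" using weight_\<delta>[OF \<mu>] whomD[OF F \<mu>] p1 by simp
    qed
    moreover have "n div p < n" using p1 n by simp
    ultimately have "G = 0" using IH by blast
    obtain \<mu> where \<mu>: "\<mu> \<in> keys F"
      using \<open>F \<noteq> 0\<close> by (rule obtain_key)
    have "0 = lookup G (\<delta> \<mu>)" using \<open>G = 0\<close> by simp
    also have "\<dots> = (\<Sum>\<nu>\<in>keys F. if \<nu> = \<mu> then rt (lookup F \<nu>) else 0)"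
      unfolding G_def lookup_sum
      by (intro sum.cong refl) (use inj_\<delta> \<mu> in \<open>auto simp: lookup_single when_def dest: inj_onD\<close>)
    also have "\<dots> = rt (lookup F \<mu>)" using \<mu> by simp
    finally have "lookup F \<mu> = 0"
      using rt[of "lookup F \<mu>"] p1 by (simp add: power_0_left)
    with \<mu> show False by (simp add: in_keys_iff)
  qed
qed

text \<open>The Hasse derivatives of \<open>x\<close> of positive order lie in \<open>Q\<close> in
  smaller degrees, so they are polynomials in \<open>E\<close>. Then
  \<open>exponents_divisible\<close> with \<open>E' = E\<close> leaves, besides monomials in
  \<open>E\<close>, only products of a p-th power with a monomial in \<open>E\<close>.\<close>

lemma decomposables_descend_step:
  assumes inj: "\<And>m F. m < n \<Longrightarrow> F \<in> hp Y m \<Longrightarrow> ev F = 0 \<Longrightarrow> F = 0"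
    and Q_surj: "\<And>m x. m < n \<Longrightarrow> x \<in> Q m \<Longrightarrow> \<exists>F\<in>hp E m. ev F = x"
    and n: "n > 0" and x: "x \<in> Q n" "x \<in> decomposables R n"
  shows "x \<in> decomposables Q n"
proof -
  obtain F where F: "F \<in> hp {v \<in> Y. fst v < n} n" "ev F = x"
    using decomposables_eval[OF surj x(2)] by auto
  have dvd: "CHAR('l) dvd lookup \<mu> z" if "\<mu> \<in> keys F" "z \<notin> E" for \<mu> z
  proof (rule exponents_divisible[OF inj E_Y _ F(1) _ that(2,1)])
    show "\<exists>G\<in>hp E (fst v - j). ev G = H i j (snd v)" if "v \<in> E" "fst v < n" "j \<le> fst v" for v i j
      using Q_surj[OF _ H_Q[OF E_Q]] that by auto
    show "\<exists>G\<in>hp E (n - j). ev G = H i j (ev F)" if "0 < j" "j \<le> n" for i j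
      using Q_surj[OF _ H_Q[OF x(1)], of j] that n by (simp add: F(2))
  qed
  define p where "p = CHAR('l)"
  define A where "A = {\<mu> \<in> keys F. keys \<mu> \<subseteq> E}"
  let ?t = "\<lambda>\<mu>. c (lookup F \<mu>) * mon_eval snd \<mu>"
  have x_split: "x = sum ?t A + sum ?t (keys F - A)"
    unfolding F(2)[symmetric] poly_eval_def by (subst sum.subset_diff[of A]) (auto simp: A_def)
  have A_dec: "sum ?t A \<in> decomposables Q n"
  proof (intro decomposables_sum Q.decomposables_scale)
    fix \<mu> assume "\<mu> \<in> A"
    then have \<mu>: "\<mu> \<in> keys F" "keys \<mu> \<subseteq> E" by (auto simp: A_def)
    from whomD[OF F(1) \<mu>(1)] have *: "keys \<mu> \<subseteq> {v \<in> Y. fst v < n}" "weight fst \<mu> = n" by auto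
    then have "\<mu> \<noteq> 0" using n by auto
    have "mon_eval snd \<mu> \<in> decomposables Q (weight fst \<mu>)"
    proof (rule Q.mon_eval_decomposable[OF _ \<open>\<mu> \<noteq> 0\<close>])
      fix u assume "u \<in> keys \<mu>"
      then have "u \<in> E" "u \<in> Y" "fst u < n" using \<mu>(2) *(1) by auto
      then show "snd u \<in> Q (fst u) \<and> 0 < fst u \<and> fst u < weight fst \<mu>"
        using E_Q Y_pos *(2) by auto
    qed
    then show "mon_eval snd \<mu> \<in> decomposables Q n" by (simp add: *)
  qed
  show ?thesis
  proof (cases "p = 0")
    case True
    have "keys F - A = {}"
    proof (rule ccontr)
      assume "keys F - A \<noteq> {}"
      then obtain \<mu> u where "\<mu> \<in> keys F" "u \<in> keys \<mu>" "u \<notin> E" unfolding A_def by blast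
      then show False using dvd[of \<mu> u] True by (simp add: p_def in_keys_iff)
    qed
    then show ?thesis using x_split A_dec by (simp only: sum.empty add_0_right)
  next
    case False
    then have p: "CHAR('l) > 0" by (simp add: p_def)
    obtain rt :: "'l \<Rightarrow> 'l" where rt: "\<And>a. rt a ^ p = a"
      using perfect[OF p] unfolding p_def by metis
    \<comment> \<open>The part of a monomial outside \<open>E\<close>, together with the
      coefficient, is the p-th power of \<open>r \<mu>\<close>; the part inside \<open>E\<close> is
      \<open>s \<mu>\<close>.\<close>
    define r where "r \<mu> = c (rt (lookup F \<mu>)) * (\<Prod>v\<in>keys \<mu> - E. snd v ^ (lookup \<mu> v div p))" for \<mu>
    define s where "s \<mu> = (\<Prod>v\<in>keys \<mu> \<inter> E. snd v ^ lookup \<mu> v)" for \<mu> :: "nat \<times> 'r \<Rightarrow>\<^sub>0 nat"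
    define d where "d \<mu> = (\<Sum>v\<in>keys \<mu> - E. (lookup \<mu> v div p) * fst v)" for \<mu> :: "nat \<times> 'r \<Rightarrow>\<^sub>0 nat"
    define e where "e \<mu> = (\<Sum>v\<in>keys \<mu> \<inter> E. lookup \<mu> v * fst v)" for \<mu> :: "nat \<times> 'r \<Rightarrow>\<^sub>0 nat"
    have t_eq: "?t \<mu> = r \<mu> ^ p * s \<mu>" if "\<mu> \<in> keys F" for \<mu>
    proof -
      have "mon_eval snd \<mu> = (\<Prod>v\<in>keys \<mu> - E. snd v ^ lookup \<mu> v) * s \<mu>"
        unfolding mon_eval_def s_def
        by (subst prod.subset_diff[of "keys \<mu> \<inter> E"]) (auto simp: Diff_Int mult.commute intro!: arg_cong2[of _ _ _ _ "(*)"] prod.cong)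
      also have "(\<Prod>v\<in>keys \<mu> - E. snd v ^ lookup \<mu> v) = (\<Prod>v\<in>keys \<mu> - E. (snd v ^ (lookup \<mu> v div p)) ^ p)"
        using dvd[OF that] by (intro prod.cong refl) (simp add: p_def flip: power_mult)
      finally show ?thesis
        by (simp add: r_def power_mult_distrib prod_power_distrib rt mult_ac flip: c.hom_power)
    qed
    have mem: "r \<mu> \<in> R (d \<mu>) \<and> s \<mu> \<in> Q (e \<mu>) \<and> 0 < d \<mu> \<and> CHAR('l) * d \<mu> + e \<mu> = n"
      if "\<mu> \<in> keys F - A" for \<mu>
    proof (intro conjI)
      have \<mu>: "\<mu> \<in> keys F" "\<not> keys \<mu> \<subseteq> E" using that by (auto simp: A_def)
      have Y: "keys \<mu> \<subseteq> Y" and wt: "weight fst \<mu> = n" using whomD[OF F(1) \<mu>(1)] by auto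
      show "r \<mu> \<in> R (d \<mu>)"
        unfolding r_def d_def using Y by (intro scale prod power Y_R) auto
      show "s \<mu> \<in> Q (e \<mu>)"
        unfolding s_def e_def by (intro Q.prod Q.power E_Q) auto
      have pd: "p * (lookup \<mu> v div p) = lookup \<mu> v" if "v \<in> keys \<mu> - E" for v
        using dvd[OF \<mu>(1)] that by (simp add: p_def)
      obtain v where v: "v \<in> keys \<mu> - E" using \<mu>(2) by blast
      then have "v \<in> Y" "lookup \<mu> v \<noteq> 0" using Y by (auto simp: in_keys_iff)
      then have "0 < lookup \<mu> v div p * fst v"
        using pd[OF v] Y_pos[of v] by (cases "lookup \<mu> v div p = 0") auto
      also have "\<dots> \<le> d \<mu>" unfolding d_def by (rule member_le_sum[OF v]) auto
      finally show "0 < d \<mu>" .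
      have "CHAR('l) * d \<mu> = (\<Sum>v\<in>keys \<mu> - E. lookup \<mu> v * fst v)"
        unfolding d_def sum_distrib_left p_def[symmetric]
        by (intro sum.cong refl) (metis pd mult.assoc)
      then have "CHAR('l) * d \<mu> + e \<mu> = weight fst \<mu>"
        unfolding weight_def e_def
        by (subst sum.subset_diff[of "keys \<mu> \<inter> E" "keys \<mu>"]) (auto simp: Diff_Int)
      then show "CHAR('l) * d \<mu> + e \<mu> = n" using wt by simp
    qed
    have eq: "sum ?t (keys F - A) = (\<Sum>\<mu>\<in>keys F - A. r \<mu> ^ CHAR('l) * s \<mu>)"
      by (intro sum.cong refl) (use t_eq in \<open>auto simp: p_def\<close>)
    \<comment> \<open>The individual \<open>r \<mu>\<close> need not lie in \<open>Q\<close>, but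
      \<open>frobenius_span\<close> only asks this of the whole sum, which is the difference of two
      elements of \<open>Q\<close>.\<close>
    have "sum ?t (keys F - A) = x + - sum ?t A" using x_split by simp
    then have "sum ?t (keys F - A) \<in> Q n"
      using Q.add[OF x(1) Q.uminus[OF Q.decomposables_subset[OF A_dec]]] by simp
    then have "sum ?t (keys F - A) \<in> decomposables Q n"
      unfolding eq by (intro frobenius_span'[where d = d and e = e, OF p]) (use mem in auto)
    then show ?thesis by (subst x_split) (rule decomposables_add[OF A_dec])
  qed
qed

text \<open>Generation in degree \<open>n\<close> comes from
  \<open>decomposables_descend_step\<close>, which rests on injectivity and generation in smaller
  degrees, so both go up in one induction. In degree 0 everything is a constant.\<close>

lemma injective_and_generated:
  "(\<forall>F\<in>hp Y n. ev F = 0 \<longrightarrow> F = 0) \<and> (\<forall>x\<in>Q n. \<exists>F\<in>hp E n. ev F = x)"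
proof (induction n rule: less_induct)
  case (less n)
  then have inj: "\<And>m F. m < n \<Longrightarrow> F \<in> hp Y m \<Longrightarrow> ev F = 0 \<Longrightarrow> F = 0"
    and Q_surj: "\<And>m x. m < n \<Longrightarrow> x \<in> Q m \<Longrightarrow> \<exists>F\<in>hp E m. ev F = x"
    by blast+
  show ?case
  proof (cases "n = 0")
    case True
    have "F = 0" if "F \<in> hp Y 0" "ev F = 0" for F
    proof -
      have "c (lookup F 0) = 0" using hp_0[OF that(1)] that(2) by (metis ev_const)
      then show ?thesis using hp_0[OF that(1)] c_eq_0 by fastforce
    qed
    moreover have "\<exists>F\<in>hp E 0. ev F = x" if x: "x \<in> Q 0" for x
    proof -
      obtain a where "x = c a" using R_0[OF Q_R[OF x]] by blast
      then show ?thesis by (intro bexI[of _ "single 0 a"]) (auto simp: ev_const whom_const)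
    qed
    ultimately show ?thesis using True by blast
  next
    case False
    then have n: "n > 0" by simp
    have "\<exists>F\<in>hp E n. ev F = x" if x: "x \<in> Q n" for x
    proof -
      from E_span[OF n x] obtain S a where S: "finite S" "S \<subseteq> {v \<in> E. fst v = n}"
        "x - (\<Sum>v\<in>S. c (a v) * snd v) \<in> decomposables R n"
        by (elim exE conjE) (rule that)
      have "(\<Sum>v\<in>S. c (a v) * snd v) \<in> Q n"
        using S(2) E_Q by (intro Q.sum Q.scale) auto
      then have mem: "x - (\<Sum>v\<in>S. c (a v) * snd v) \<in> Q n"
        using Q.add[OF x Q.uminus] by fastforce
      have "x - (\<Sum>v\<in>S. c (a v) * snd v) \<in> decomposables Q n"
        by (rule decomposables_descend_step[OF inj Q_surj n mem S(3)])
      from Q.decomposables_eval[OF Q_surj this]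
      obtain G where G: "G \<in> hp {v \<in> E. fst v < n} n" "ev G = x - (\<Sum>v\<in>S. c (a v) * snd v)"
        by auto
      obtain K where K: "K \<in> hp E n" "ev K = (\<Sum>v\<in>S. c (a v) * snd v)"
        using linear_combination[OF S(1,2), of a] by auto
      have "K + G \<in> hp E n"
        using K(1) G(1) by (intro whom_add) (auto intro: whom_mono)
      then show ?thesis
        by (rule bexI[rotated]) (simp add: eval.hom_add K G)
    qed
    moreover have "F = 0" if "F \<in> hp Y n" "ev F = 0" for F
      by (rule injective_step[OF inj n that])
    ultimately show ?thesis by blast
  qed
qed

lemma generated_decomposables_descend:
  "n > 0 \<Longrightarrow> x \<in> Q n \<Longrightarrow> x \<in> decomposables R n \<Longrightarrow> x \<in> decomposables Q n"
  by (rule decomposables_descend_step) (use injective_and_generated in blast)+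

end

context hasse_algebra
begin

theorem decomposables_descend:
  assumes "n > 0" "x \<in> Q n" "x \<in> decomposables R n"
  shows "x \<in> decomposables Q n"
proof -
  obtain E Y where gen: "\<And>n. generating_pair n (E n) (Y n)"
    using generating_pair_exists by metis
  note gen' = gen[unfolded generating_pair_def]
  note E_Y = gen'[THEN conjunct1]
  note E_Q = gen'[THEN conjunct2, THEN conjunct1]
  note Y_R = gen'[THEN conjunct2, THEN conjunct2, THEN conjunct1]
  note Y_span = gen'[THEN conjunct2, THEN conjunct2, THEN conjunct2, THEN conjunct1, THEN bspec]
  note gen'' = gen'[THEN conjunct2, THEN conjunct2, THEN conjunct2, THEN conjunct2]
  note E_span = gen''[THEN conjunct1, THEN bspec]
  note indep = gen''[THEN conjunct2, THEN spec, THEN spec, THEN spec, THEN mp, THEN mp, THEN mp, THEN mp]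
  \<comment> \<open>Pairing with the degree makes the choices in different degrees disjoint, and
    gives the variables their weights.\<close>
  define E' where "E' = {(n, y). 0 < n \<and> y \<in> E n}"
  define Y' where "Y' = {(n, y). 0 < n \<and> y \<in> Y n}"
  have pairs: "\<exists>S' b. finite S' \<and> S' \<subseteq> {v \<in> {(n, y). 0 < n \<and> y \<in> B n}. fst v = n} \<and>
      x - (\<Sum>v\<in>S'. c (b v) * snd v) \<in> decomposables R n"
    if n: "n > 0" and ex: "\<exists>S a. finite S \<and> S \<subseteq> B n \<and> x - (\<Sum>y\<in>S. c (a y) * y) \<in> decomposables R n" for B n x
  proof -
    obtain S a where S: "finite S" "S \<subseteq> B n" "x - (\<Sum>y\<in>S. c (a y) * y) \<in> decomposables R n"
      using ex by (elim exE conjE) (rule that)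
    have "(\<Sum>v\<in>Pair n ` S. c (a (snd v)) * snd v) = (\<Sum>y\<in>S. c (a y) * y)"
      by (subst sum.reindex) (auto simp: inj_on_def)
    then show ?thesis using S n
      by (intro exI[of _ "Pair n ` S"] exI[of _ "\<lambda>v. a (snd v)"]) auto
  qed
  interpret generated_hasse_algebra c R Q H E' Y'
  proof unfold_locales
    fix n x assume "n > 0" "x \<in> R n"
    then show "\<exists>S a. finite S \<and> S \<subseteq> {v \<in> Y'. fst v = n} \<and> x - (\<Sum>v\<in>S. c (a v) * snd v) \<in> decomposables R n"
      unfolding Y'_def by (intro pairs Y_span)
  next
    fix n x assume "n > 0" "x \<in> Q n"
    then show "\<exists>S a. finite S \<and> S \<subseteq> {v \<in> E'. fst v = n} \<and> x - (\<Sum>v\<in>S. c (a v) * snd v) \<in> decomposables R n"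
      unfolding E'_def by (intro pairs E_span)
  next
    fix S :: "(nat \<times> 'r) set" and n a v
    assume S: "finite S" "S \<subseteq> {v \<in> Y'. fst v = n}"
      "(\<Sum>v\<in>S. c (a v) * snd v) \<in> decomposables R n" "v \<in> S"
    have S_eq: "S = Pair n ` snd ` S" using S(2) by force
    have "(\<Sum>v\<in>S. c (a v) * snd v) = (\<Sum>y\<in>snd ` S. c (a (n, y)) * y)"
      by (subst S_eq, subst sum.reindex) (auto simp: inj_on_def)
    then have "a (n, snd v) = 0"
      using S by (intro indep[of "snd ` S" n "\<lambda>y. a (n, y)"]) (auto simp: Y'_def)
    moreover have "v = (n, snd v)" using S(2,4) by (cases v) auto
    ultimately show "a v = 0" by metis
  qed (use E_Y[THEN subsetD] E_Q[THEN subsetD] Y_R[THEN subsetD] in \<open>auto simp: E'_def Y'_def\<close>)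
  show ?thesis by (rule generated_decomposables_descend) (rule assms)+
qed

end

section \<open>Ultrapowers\<close>

text \<open>Zorn's lemma is applied to filters all of whose members are infinite. Maximality gives
  the dichotomy, and freeness follows: a finite set is not a member, so its complement is.\<close>

lemma free_ultrafilter_exists:
  "\<exists>U :: nat filter. U \<noteq> bot \<and> U \<le> sequentially \<and> (\<forall>P. eventually P U \<or> eventually (\<lambda>k. \<not> P k) U)"
proof -
  define \<A> where "\<A> = {M :: nat set set. UNIV \<in> M \<and> (\<forall>A\<in>M. \<forall>B\<in>M. A \<inter> B \<in> M) \<and>
    (\<forall>A\<in>M. \<forall>B. A \<subseteq> B \<longrightarrow> B \<in> M) \<and> (\<forall>A\<in>M. infinite A)}"
  have "\<exists>M\<in>\<A>. \<forall>A\<in>\<A>. M \<subseteq> A \<longrightarrow> A = M"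
  proof (rule subset_Zorn)
    fix C assume C: "subset.chain \<A> C"
    show "\<exists>U\<in>\<A>. \<forall>A\<in>C. A \<subseteq> U"
    proof (cases "C = {}")
      case True
      have "{UNIV} \<in> \<A>" by (auto simp: \<A>_def)
      then show ?thesis using True by blast
    next
      case False
      have CA: "A \<in> \<A>" if "A \<in> C" for A using C that by (auto simp: subset.chain_def)
      have total: "A \<subseteq> B \<or> B \<subseteq> A" if "A \<in> C" "B \<in> C" for A B
        using C that by (auto simp: subset.chain_def)
      have "\<Union>C \<in> \<A>"
        unfolding \<A>_def
      proof (intro CollectI conjI ballI allI impI)
        show "UNIV \<in> \<Union>C" using False CA by (auto simp: \<A>_def)
        show "A \<inter> B \<in> \<Union>C" if AB: "A \<in> \<Union>C" "B \<in> \<Union>C" for A B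
        proof -
          obtain M M' where M: "M \<in> C" "A \<in> M" "M' \<in> C" "B \<in> M'" using AB by blast
          then obtain M'' where "M'' \<in> C" "A \<in> M''" "B \<in> M''" using total[of M M'] by blast
          then show ?thesis using CA[of M''] unfolding \<A>_def by blast
        qed
        show "B \<in> \<Union>C" if "A \<in> \<Union>C" "A \<subseteq> B" for A B
          using that CA unfolding \<A>_def by blast
        show "infinite A" if "A \<in> \<Union>C" for A
          using that CA unfolding \<A>_def by blast
      qed
      then show ?thesis by blast
    qed
  qed
  then obtain M where M: "M \<in> \<A>" and max: "\<And>A. A \<in> \<A> \<Longrightarrow> M \<subseteq> A \<Longrightarrow> A = M" by blast
  have univ: "UNIV \<in> M" and inter: "\<And>A B. A \<in> M \<Longrightarrow> B \<in> M \<Longrightarrow> A \<inter> B \<in> M"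
    and up: "\<And>A B. A \<in> M \<Longrightarrow> A \<subseteq> B \<Longrightarrow> B \<in> M" and inf: "\<And>A. A \<in> M \<Longrightarrow> infinite A"
    using M unfolding \<A>_def by blast+
  \<comment> \<open>If every member met \<open>P\<close> in an infinite set, adjoining
    \<open>P\<close> would give a larger filter of infinite sets.\<close>
  have meets: "\<exists>A\<in>M. finite (A \<inter> P)" if "P \<notin> M" for P
  proof (rule ccontr)
    assume *: "\<not> (\<exists>A\<in>M. finite (A \<inter> P))"
    define M' where "M' = {B. \<exists>A\<in>M. A \<inter> P \<subseteq> B}"
    have "M' \<in> \<A>"
      unfolding \<A>_def
    proof (intro CollectI conjI ballI allI impI)
      show "UNIV \<in> M'" using univ by (auto simp: M'_def)
      show "A \<inter> B \<in> M'" if AB: "A \<in> M'" "B \<in> M'" for A B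
      proof -
        obtain A1 B1 where "A1 \<in> M" "A1 \<inter> P \<subseteq> A" "B1 \<in> M" "B1 \<inter> P \<subseteq> B"
          using AB unfolding M'_def by blast
        then show ?thesis using inter[of A1 B1] unfolding M'_def by blast
      qed
      show "B \<in> M'" if "A \<in> M'" "A \<subseteq> B" for A B
        using that unfolding M'_def by blast
      show "infinite A" if A: "A \<in> M'" for A
      proof -
        obtain B where "B \<in> M" "B \<inter> P \<subseteq> A" using A unfolding M'_def by blast
        then show ?thesis using * finite_subset by metis
      qed
    qed
    moreover have "M \<subseteq> M'" unfolding M'_def by blast
    ultimately have "M' = M" by (rule max)
    moreover have "P \<in> M'" using univ unfolding M'_def by blast
    ultimately show False using that by blast
  qed
  define U where "U = Abs_filter (\<lambda>P. Collect P \<in> M)"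
  have ev: "eventually P U \<longleftrightarrow> Collect P \<in> M" for P
    unfolding U_def
  proof (rule eventually_Abs_filter, rule is_filter.intro)
    show "Collect (\<lambda>x. True) \<in> M" using univ by simp
    show "Collect (\<lambda>x. P x \<and> Q x) \<in> M" if "Collect P \<in> M" "Collect Q \<in> M" for P Q
      using inter[OF that] by (simp add: Collect_conj_eq)
    show "Collect Q \<in> M" if "\<forall>x. P x \<longrightarrow> Q x" "Collect P \<in> M" for P Q
      using up[OF that(2)] that(1) by blast
  qed
  have ultra: "eventually P U \<or> eventually (\<lambda>k. \<not> P k) U" for P
  proof (rule ccontr)
    assume "\<not> (eventually P U \<or> eventually (\<lambda>k. \<not> P k) U)"
    then obtain A B where AB: "A \<in> M" "finite (A \<inter> Collect P)" "B \<in> M" "finite (B \<inter> Collect (\<lambda>k. \<not> P k))"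
      using meets unfolding ev by blast
    have "A \<inter> B \<subseteq> (A \<inter> Collect P) \<union> (B \<inter> Collect (\<lambda>k. \<not> P k))" by blast
    moreover have "finite ((A \<inter> Collect P) \<union> (B \<inter> Collect (\<lambda>k. \<not> P k)))" using AB(2,4) by simp
    ultimately have "finite (A \<inter> B)" by (rule finite_subset)
    then show False using inf[OF inter[OF AB(1,3)]] by argo
  qed
  have "U \<noteq> bot"
  proof
    assume "U = bot"
    then have "{} \<in> M" using ev[of "\<lambda>_. False"] by simp
    then show False using inf[of "{}"] by simp
  qed
  moreover have "U \<le> sequentially"
  proof (rule filter_leI)
    fix P :: "nat \<Rightarrow> bool" assume "eventually P sequentially"
    then obtain m where "\<And>k. k \<ge> m \<Longrightarrow> P k" by (auto simp: eventually_sequentially)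
    then have "{k. \<not> P k} \<subseteq> {..<m}" by (auto simp flip: not_le)
    then have "finite {k. \<not> P k}" by (rule finite_subset) simp
    then have "{k. \<not> P k} \<notin> M" using inf[of "{k. \<not> P k}"] by argo
    then show "eventually P U" using ultra[of P] unfolding ev by argo
  qed
  ultimately show ?thesis using ultra by blast
qed

definition ultra :: "nat filter" where
  "ultra = (SOME U. U \<noteq> bot \<and> U \<le> sequentially \<and> (\<forall>P. eventually P U \<or> eventually (\<lambda>k. \<not> P k) U))"

lemma ultra_properties:
  "ultra \<noteq> bot \<and> ultra \<le> sequentially \<and> (\<forall>P. eventually P ultra \<or> eventually (\<lambda>k. \<not> P k) ultra)"
  unfolding ultra_def by (rule someI_ex) (rule free_ultrafilter_exists)

lemmas ultra_not_bot = ultra_properties[THEN conjunct1]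
lemmas ultra_le_sequentially = ultra_properties[THEN conjunct2, THEN conjunct1]
lemmas ultra_dichotomy = ultra_properties[THEN conjunct2, THEN conjunct2, THEN spec]

lemma ultra_False [simp]: "\<not> eventually (\<lambda>_. False) ultra"
  using ultra_not_bot by (simp add: eventually_False)

lemma ultra_ge: "\<forall>\<^sub>F k in ultra. m \<le> k"
  using filter_leD[OF ultra_le_sequentially eventually_ge_at_top] .

\<comment> \<open>One type serves all indices. The number of variables varies along the sequence,
  but the polynomials do not change their type; ultraproducts of the actual spaces of forms are cut
  out as subsets.\<close>
quotient_type 'a ultrapower = "nat \<Rightarrow> 'a" / "\<lambda>f g. \<forall>\<^sub>F k in ultra. f k = g k"
proof (rule equivpI)
  show "reflp (\<lambda>f g :: nat \<Rightarrow> 'a. \<forall>\<^sub>F k in ultra. f k = g k)"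
    by (rule reflpI) simp
  show "symp (\<lambda>f g :: nat \<Rightarrow> 'a. \<forall>\<^sub>F k in ultra. f k = g k)"
    by (rule sympI) (simp add: eq_commute)
  show "transp (\<lambda>f g :: nat \<Rightarrow> 'a. \<forall>\<^sub>F k in ultra. f k = g k)"
    by (rule transpI) (erule (1) eventually_elim2, simp)
qed

abbreviation "ultraproduct \<equiv> abs_ultrapower"

lemma ultraproduct_eq_iff: "ultraproduct f = ultraproduct g \<longleftrightarrow> (\<forall>\<^sub>F k in ultra. f k = g k)"
  by (simp add: ultrapower.abs_eq_iff)

lemma ultraproduct_cases [cases type: ultrapower]:
  obtains f where "x = ultraproduct f"
  using Quotient3_abs_rep[OF Quotient3_ultrapower, of x] by (rule that[OF sym])

instantiation ultrapower :: (comm_ring_1) comm_ring_1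
begin

lift_definition zero_ultrapower :: "'a ultrapower" is "\<lambda>_. 0" .
lift_definition one_ultrapower :: "'a ultrapower" is "\<lambda>_. 1" .
lift_definition plus_ultrapower :: "'a ultrapower \<Rightarrow> 'a ultrapower \<Rightarrow> 'a ultrapower"
  is "\<lambda>f g k. f k + g k" by (erule (1) eventually_elim2, simp)
lift_definition minus_ultrapower :: "'a ultrapower \<Rightarrow> 'a ultrapower \<Rightarrow> 'a ultrapower"
  is "\<lambda>f g k. f k - g k" by (erule (1) eventually_elim2, simp)
lift_definition uminus_ultrapower :: "'a ultrapower \<Rightarrow> 'a ultrapower"
  is "\<lambda>f k. - f k" by (erule eventually_mono, simp)
lift_definition times_ultrapower :: "'a ultrapower \<Rightarrow> 'a ultrapower \<Rightarrow> 'a ultrapower"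
  is "\<lambda>f g k. f k * g k" by (erule (1) eventually_elim2, simp)

instance
proof
  fix a b c :: "'a ultrapower"
  show "a * b * c = a * (b * c)" by transfer (simp add: mult.assoc)
  show "a * b = b * a" by transfer (simp add: mult.commute)
  show "1 * a = a" by transfer simp
  show "a + b + c = a + (b + c)" by transfer (simp add: add.assoc)
  show "a + b = b + a" by transfer (simp add: add.commute)
  show "0 + a = a" by transfer simp
  show "- a + a = 0" by transfer simp
  show "a - b = a + - b" by transfer simp
  show "(a + b) * c = a * c + b * c" by transfer (simp add: distrib_right)
  show "(0 :: 'a ultrapower) \<noteq> 1" by transfer simp
qed

end

instantiation ultrapower :: (inverse) inverse
begin

lift_definition inverse_ultrapower :: "'a ultrapower \<Rightarrow> 'a ultrapower"
  is "\<lambda>f k. inverse (f k)" by (erule eventually_mono, simp)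
lift_definition divide_ultrapower :: "'a ultrapower \<Rightarrow> 'a ultrapower \<Rightarrow> 'a ultrapower"
  is "\<lambda>f g k. f k / g k" by (erule (1) eventually_elim2, simp)

instance ..

end

instance ultrapower :: (field) field
proof
  show "inverse x * x = 1" if "x \<noteq> 0" for x :: "'a::field ultrapower"
    using that
  proof transfer
    fix f :: "nat \<Rightarrow> 'a" assume "\<not> (\<forall>\<^sub>F k in ultra. f k = 0)"
    then have "\<forall>\<^sub>F k in ultra. f k \<noteq> 0" using ultra_dichotomy by blast
    then show "\<forall>\<^sub>F k in ultra. inverse (f k) * f k = 1"
      by (rule eventually_mono) simp
  qed
  show "x / y = x * inverse y" for x y :: "'a::field ultrapower"
    by transfer (simp add: field_simps)
  show "inverse (0 :: 'a::field ultrapower) = 0"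
    by transfer simp
qed

lemma ultraproduct_0: "0 = ultraproduct (\<lambda>_. 0)"
  by (simp add: zero_ultrapower_def)

lemma ultraproduct_1: "1 = ultraproduct (\<lambda>_. 1)"
  by (simp add: one_ultrapower_def)

lemma ultraproduct_add: "ultraproduct f + ultraproduct g = ultraproduct (\<lambda>k. f k + g k)"
  by (rule plus_ultrapower.abs_eq)

lemma ultraproduct_mult: "ultraproduct f * ultraproduct g = ultraproduct (\<lambda>k. f k * g k)"
  by (rule times_ultrapower.abs_eq)

lemma ultraproduct_sum:
  "(\<Sum>i\<in>A. ultraproduct (f i)) = ultraproduct (\<lambda>k. \<Sum>i\<in>A. f i k)"
  by (induction A rule: infinite_finite_induct) (simp_all add: ultraproduct_0 ultraproduct_add)

lemma ultraproduct_power: "ultraproduct f ^ n = ultraproduct (\<lambda>k. f k ^ n)"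
  by (induction n) (simp_all add: ultraproduct_1 ultraproduct_mult)

lemma ultraproduct_of_nat: "of_nat n = ultraproduct (\<lambda>_. of_nat n)"
  by (induction n) (simp_all add: ultraproduct_0 ultraproduct_1 ultraproduct_add)

lemma CHAR_ultrapower: "CHAR('a::comm_ring_1 ultrapower) = CHAR('a)"
proof (rule CHAR_eqI)
  have "(of_nat n :: 'a ultrapower) = 0 \<longleftrightarrow> (of_nat n :: 'a) = 0" for n
    unfolding ultraproduct_of_nat ultraproduct_0 ultraproduct_eq_iff
    by (auto dest: eventually_happens' [OF ultra_not_bot])
  then show "(of_nat CHAR('a) :: 'a ultrapower) = 0" "\<And>n. (of_nat n :: 'a ultrapower) = 0 \<Longrightarrow> CHAR('a) dvd n"
    by (auto simp: of_nat_eq_0_iff_char_dvd)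
qed

lift_definition ultra_map :: "(nat \<Rightarrow> 'a \<Rightarrow> 'b) \<Rightarrow> 'a ultrapower \<Rightarrow> 'b ultrapower"
  is "\<lambda>f x k. f k (x k)" by (erule eventually_mono, simp)

lemma ultra_map_ultraproduct: "ultra_map f (ultraproduct x) = ultraproduct (\<lambda>k. f k (x k))"
  by (rule ultra_map.abs_eq)

lemma ultra_map_hom:
  assumes "\<And>k. comm_ring_hom (f k)"
  shows "comm_ring_hom (ultra_map f)"
proof
  fix x y
  interpret comm_ring_hom "f k" for k by (rule assms)
  show "ultra_map f 1 = 1"
    by (simp add: ultraproduct_1 ultra_map_ultraproduct hom_one)
  show "ultra_map f (x + y) = ultra_map f x + ultra_map f y"
    by (cases x; cases y) (simp add: ultra_map_ultraproduct ultraproduct_add hom_add)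
  show "ultra_map f (x * y) = ultra_map f x * ultra_map f y"
    by (cases x; cases y) (simp add: ultra_map_ultraproduct ultraproduct_mult hom_mult)
qed

section \<open>Forms over a field and over its algebraic closure\<close>

subsection \<open>Coefficientwise maps\<close>

lemma lookup_map0: "h 0 = 0 \<Longrightarrow> lookup (Poly_Mapping.map h F) \<mu> = h (lookup F \<mu>)"
  by (simp add: Poly_Mapping.map.rep_eq when_def)

lemma keys_map_subset: "keys (Poly_Mapping.map h F) \<subseteq> keys F"
  by (auto simp: in_keys_iff Poly_Mapping.map.rep_eq when_def split: if_splits)

lemma lookup_const_mult:
  fixes F :: "('v, 'a::comm_ring_1) mpoly"
  shows "lookup (single 0 a * F) \<mu> = a * lookup F \<mu>"
  unfolding mult_map_scale_conv_mult[symmetric] by (simp add: lookup_map0)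

lemma map_hom_poly:
  fixes h :: "'a::comm_ring_1 \<Rightarrow> 'b::comm_ring_1"
  assumes "comm_ring_hom h"
  shows "comm_ring_hom (Poly_Mapping.map h :: ('v, 'a) mpoly \<Rightarrow> ('v, 'b) mpoly)"
proof
  interpret comm_ring_hom h by fact
  note lm = lookup_map0[of h, OF hom_zero]
  fix F G :: "('v, 'a) mpoly"
  show "Poly_Mapping.map h (1 :: ('v, 'a) mpoly) = 1"
    by (rule poly_mapping_eqI) (simp add: lm lookup_one when_def hom_one hom_zero)
  have add: "Poly_Mapping.map h (F + G) = Poly_Mapping.map h F + Poly_Mapping.map h G" for F G :: "('v, 'a) mpoly"
    by (rule poly_mapping_eqI) (simp add: lm lookup_add hom_add)
  then show "Poly_Mapping.map h (F + G) = Poly_Mapping.map h F + Poly_Mapping.map h G" .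
  have single: "Poly_Mapping.map h (single \<mu> a) = single \<mu> (h a)" for \<mu> :: "'v \<Rightarrow>\<^sub>0 nat" and a
    by (rule poly_mapping_eqI) (simp add: lm lookup_single when_def hom_zero)
  have zero: "Poly_Mapping.map h 0 = (0 :: ('v, 'b) mpoly)"
    by (rule poly_mapping_eqI) (simp add: lm hom_zero)
  show "Poly_Mapping.map h (F * G) = Poly_Mapping.map h F * Poly_Mapping.map h G"
  proof (induction F rule: poly_mapping_add_induct)
    case (single \<mu> a)
    show ?case
    proof (induction G rule: poly_mapping_add_induct)
      case (single \<nu> b)
      show ?case by (simp add: mult_single \<open>\<And>\<mu> a. Poly_Mapping.map h (single \<mu> a) = single \<mu> (h a)\<close> hom_mult)
    qed (auto simp: zero add algebra_simps)
  qed (auto simp: zero add algebra_simps)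
qed

lemma map_hasse:
  assumes "comm_ring_hom h"
  shows "Poly_Mapping.map h (hasse z j F) = hasse z j (Poly_Mapping.map h F)"
proof -
  interpret comm_ring_hom h by fact
  show ?thesis
    by (rule poly_mapping_eqI) (simp add: lookup_map0[of h, OF hom_zero] lookup_hasse hom_mult hom_of_nat)
qed

lemma whom_map: "F \<in> whom w V n \<Longrightarrow> Poly_Mapping.map h F \<in> whom w V n"
  using keys_map_subset[of h F] unfolding whom_def by blast

lemma is_form_whom: "is_form n d F \<longleftrightarrow> F \<in> whom (\<lambda>_. 1) {..<n} d"
  by (simp add: is_form_def whom_def mon_degree_def weight_def)

subsection \<open>Linear functionals on the algebraic closure\<close>

definition ac_linear :: "('a::field alg_closure \<Rightarrow> 'a) \<Rightarrow> bool" where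
  "ac_linear l \<longleftrightarrow> (\<forall>x y. l (x + y) = l x + l y) \<and> (\<forall>a x. l (to_ac a * x) = a * l x)"

lemma ac_linear_0: "ac_linear l \<Longrightarrow> l 0 = 0"
  unfolding ac_linear_def by (metis add_cancel_right_right)

text \<open>A maximal independent subset \<open>B\<close> of the vectors \<open>c i\<close> is
  extended to a basis of the closure over the ground field. \<open>l i\<close> is the coordinate at
  \<open>c i\<close> if \<open>i\<close> is the index chosen for a vector of \<open>B\<close>, and 0
  otherwise; so the identity holds even when the \<open>c i\<close> are dependent.\<close>

lemma ac_linear_projections:
  fixes c :: "nat \<Rightarrow> 'a::field alg_closure"
  shows "\<exists>l. (\<forall>i. ac_linear (l i)) \<and>
    (\<forall>a. (\<Sum>i<m. to_ac (a i) * c i) = (\<Sum>i<m. c i * to_ac (l i (\<Sum>i<m. to_ac (a i) * c i))))"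
proof -
  interpret V: vector_space "\<lambda>a x. to_ac (a :: 'a) * x"
    by unfold_locales (auto simp: algebra_simps)
  let ?C = "c ` {..<m}"
  obtain B where B: "B \<subseteq> ?C" "V.independent B" "?C \<subseteq> V.span B"
    using V.maximal_independent_subset by metis
  obtain B' where B': "B \<subseteq> B'" "V.independent B'" "UNIV \<subseteq> V.span B'"
    using V.maximal_independent_subset_extend[of B UNIV] B(2) by auto
  have spanB': "x \<in> V.span B'" for x using B'(3) by auto
  have finB: "finite B" using B(1) by (rule finite_subset) simp
  \<comment> \<open>Several indices may carry the same vector; choosing the least one counts each
    vector of \<open>B\<close> once.\<close>
  define idx where "idx b = (LEAST i. i < m \<and> c i = b)" for b
  have idx: "idx b < m" "c (idx b) = b" if b: "b \<in> B" for b
  proof -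
    obtain i where "i < m \<and> c i = b" using b B(1) by auto
    then have "idx b < m \<and> c (idx b) = b" unfolding idx_def by (rule LeastI)
    then show "idx b < m" "c (idx b) = b" by auto
  qed
  have inj: "inj_on idx B" using idx(2) by (rule inj_on_inverseI)
  define l where "l i x = (if i \<in> idx ` B then V.representation B' x (c i) else 0)" for i x
  show ?thesis
  proof (rule exI[of _ l], intro conjI allI)
    fix i show "ac_linear (l i)"
      unfolding ac_linear_def l_def
      using V.representation_add[OF B'(2) spanB' spanB'] V.representation_scale[OF B'(2) spanB'] by simp
  next
    fix a
    define x where "x = (\<Sum>i<m. to_ac (a i) * c i)"
    have "x \<in> V.span B"
      unfolding x_def using B(3) by (intro V.span_sum V.span_scale) auto
    then have rep: "V.representation B' x = V.representation B x"
      using V.representation_extend[OF B'(2) _ B'(1)] by simp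
    have "(\<Sum>i<m. c i * to_ac (l i x)) = (\<Sum>i\<in>idx ` B. c i * to_ac (l i x))"
      using idx(1) by (intro sum.mono_neutral_right) (auto simp: l_def)
    also have "\<dots> = (\<Sum>b\<in>B. c (idx b) * to_ac (l (idx b) x))"
      by (rule sum.reindex_cong[OF inj]) auto
    also have "\<dots> = (\<Sum>b\<in>B. to_ac (V.representation B x b) * b)"
      by (intro sum.cong refl) (auto simp: l_def idx rep)
    also have "\<dots> = x"
      by (rule V.sum_representation_eq[OF B(2) \<open>x \<in> V.span B\<close> finB]) simp
    finally show "(\<Sum>i<m. to_ac (a i) * c i) = (\<Sum>i<m. c i * to_ac (l i (\<Sum>i<m. to_ac (a i) * c i)))"
      unfolding x_def by simp
  qed
qed

text \<open>The coordinate at the single vector 1 is a left inverse of \<open>to_ac\<close>.\<close>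

lemma ac_linear_retraction: "\<exists>l :: 'a::field alg_closure \<Rightarrow> 'a. ac_linear l \<and> (\<forall>a. l (to_ac a) = a)"
proof -
  obtain l where l: "\<forall>i. ac_linear (l i)"
    "\<forall>a. (\<Sum>i<1::nat. to_ac (a i) * (1 :: 'a alg_closure)) = (\<Sum>i<1::nat. 1 * to_ac (l i (\<Sum>i<1::nat. to_ac (a i) * 1)))"
    using ac_linear_projections[where c = "\<lambda>_. 1 :: 'a alg_closure" and m = 1] by (elim exE conjE) (rule that)
  have "l 0 (to_ac a) = a" for a
    using l(2)[THEN spec, of "\<lambda>_. a"] by simp
  then show ?thesis using l(1) by blast
qed

lemma map_ac_linear_add:
  assumes "ac_linear l"
  shows "Poly_Mapping.map l (F + G) = Poly_Mapping.map l F + Poly_Mapping.map l G"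
  using assms by (intro poly_mapping_eqI) (simp add: lookup_map0 ac_linear_0 lookup_add ac_linear_def)

lemma map_ac_linear_sum:
  assumes "ac_linear l"
  shows "Poly_Mapping.map l (sum F A) = (\<Sum>i\<in>A. Poly_Mapping.map l (F i))"
proof (induction A rule: infinite_finite_induct)
qed (auto simp: map_ac_linear_add[OF assms] intro!: poly_mapping_eqI simp: lookup_map0 ac_linear_0[OF assms])

text \<open>Functionals are not multiplicative, but they are linear over the ground field, so a
  factor with coefficients there can be pulled out monomial by monomial.\<close>

lemma map_ac_linear_mult:
  fixes F :: "('v, 'a::field) mpoly"
  assumes "ac_linear l"
  shows "Poly_Mapping.map l (G * Poly_Mapping.map to_ac F) = Poly_Mapping.map l G * F"
proof -
  have zero: "Poly_Mapping.map l 0 = (0 :: ('v, 'a) mpoly)"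
    by (rule poly_mapping_eqI) (simp add: lookup_map0 ac_linear_0[OF assms])
  interpret m: comm_ring_hom "Poly_Mapping.map to_ac :: ('v, 'a) mpoly \<Rightarrow> _"
    by (rule map_hom_poly) (unfold_locales, auto)
  have sl: "Poly_Mapping.map l (single \<mu> a) = single \<mu> (l a)" for \<mu> :: "'v \<Rightarrow>\<^sub>0 nat" and a
    by (rule poly_mapping_eqI) (simp add: lookup_map0 ac_linear_0[OF assms] lookup_single when_def)
  have sa: "Poly_Mapping.map to_ac (single \<mu> a) = single \<mu> (to_ac a)" for \<mu> :: "'v \<Rightarrow>\<^sub>0 nat" and a :: 'a
    by (rule poly_mapping_eqI) (simp add: lookup_map0 lookup_single when_def)
  note add = map_ac_linear_add[OF assms]
  show ?thesis
  proof (induction G rule: poly_mapping_add_induct)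
    case (single \<mu> a)
    show ?case
    proof (induction F rule: poly_mapping_add_induct)
      case (single \<nu> b)
      show ?case using assms by (simp add: sl sa mult_single ac_linear_def mult.commute add.commute)
    qed (auto simp: zero add m.hom_add m.hom_zero algebra_simps)
  qed (auto simp: zero add algebra_simps)
qed

subsection \<open>Polynomials in the p-th powers of the variables\<close>

lemma CHAR_mpoly: "CHAR(('v, 'a::comm_ring_1) mpoly) = CHAR('a)"
proof (rule CHAR_eqI)
  have "(of_nat n :: ('v, 'a) mpoly) = 0 \<longleftrightarrow> (of_nat n :: 'a) = 0" for n
  proof -
    have e: "(of_nat n :: ('v, 'a) mpoly) = single 0 (of_nat n)" by simp
    show ?thesis by (subst e) (metis lookup_single_eq lookup_zero single_zero)
  qed
  then show "(of_nat CHAR('a) :: ('v, 'a) mpoly) = 0" "\<And>n. (of_nat n :: ('v, 'a) mpoly) = 0 \<Longrightarrow> CHAR('a) dvd n"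
    by (auto simp: of_nat_eq_0_iff_char_dvd)
qed

lemma single_power:
  fixes \<mu> :: "'v \<Rightarrow>\<^sub>0 nat"
  shows "\<exists>\<nu>. single \<mu> a ^ m = (single \<nu> (a ^ m) :: ('v, 'a::comm_ring_1) mpoly) \<and> (\<forall>u. lookup \<nu> u = m * lookup \<mu> u)"
proof (induction m)
  case 0
  show ?case by (intro exI[of _ 0]) simp
next
  case (Suc m)
  then obtain \<nu> where \<nu>: "single \<mu> a ^ m = single \<nu> (a ^ m)" "\<And>u. lookup \<nu> u = m * lookup \<mu> u" by blast
  then show ?case by (intro exI[of _ "\<mu> + \<nu>"]) (simp add: mult_single lookup_add)
qed

lemma keys_frobenius_power:
  fixes F :: "('v, 'a::idom) mpoly"
  assumes "CHAR('a) > 0" and "\<mu> \<in> keys (F ^ CHAR('a))"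
  shows "CHAR('a) dvd lookup \<mu> u"
proof -
  let ?p = "CHAR('a)"
  have "F ^ ?p = (\<Sum>\<nu>\<in>keys F. single \<nu> (lookup F \<nu>)) ^ ?p"
    by (simp only: poly_mapping_sum_single[symmetric])
  also have "\<dots> = (\<Sum>\<nu>\<in>keys F. single \<nu> (lookup F \<nu>) ^ ?p)"
    by (rule freshmans_dream_sum) (simp_all add: CHAR_mpoly prime_CHAR_semidom assms)
  finally have "(\<Sum>\<nu>\<in>keys F. lookup (single \<nu> (lookup F \<nu>) ^ ?p) \<mu>) \<noteq> 0"
    using assms(2) by (simp add: in_keys_iff lookup_sum)
  then obtain \<nu> where \<nu>: "lookup (single \<nu> (lookup F \<nu>) ^ ?p) \<mu> \<noteq> 0"
    by (auto elim: sum.not_neutral_contains_not_neutral)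
  obtain \<kappa> where \<kappa>: "single \<nu> (lookup F \<nu>) ^ ?p = single \<kappa> (lookup F \<nu> ^ ?p)" "\<And>u. lookup \<kappa> u = ?p * lookup \<nu> u"
    using single_power[of \<nu> "lookup F \<nu>" ?p] by blast
  have "\<mu> = \<kappa>" using \<nu> unfolding \<kappa>(1) by (auto simp: lookup_single when_def split: if_splits)
  then show ?thesis using \<kappa>(2) by simp
qed

text \<open>Each coefficient is split into p-th powers along the fixed constants \<open>b j\<close>,
  and dividing the exponents by p gives the roots \<open>Y j\<close>. The number \<open>q\<close>
  does not depend on \<open>G\<close>: this is the uniformity that semi-perfectness
  provides.\<close>

lemma frobenius_decomposition:
  fixes G :: "('v, 'a::idom) mpoly" and q :: nat
  assumes p: "CHAR('a) > 0"
    and b: "\<And>a. a = (\<Sum>j<q. b j * y j a ^ CHAR('a))"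
    and dvd: "\<And>\<mu> u. \<mu> \<in> keys G \<Longrightarrow> CHAR('a) dvd lookup \<mu> u"
    and G: "G \<in> whom w V (CHAR('a) * d)"
  shows "\<exists>Y. (\<forall>j. Y j \<in> whom w V d) \<and> G = (\<Sum>j<q. single 0 (b j) * Y j ^ CHAR('a))"
proof -
  define p where "p = CHAR('a)"
  have p0: "p > 0" using p by (simp add: p_def)
  define \<delta> :: "('v \<Rightarrow>\<^sub>0 nat) \<Rightarrow> ('v \<Rightarrow>\<^sub>0 nat)" where "\<delta> = Poly_Mapping.map (\<lambda>k. k div p)"
  have \<delta>: "lookup \<mu> u = p * lookup (\<delta> \<mu>) u" if "\<mu> \<in> keys G" for \<mu> u
    using dvd[OF that, of u] by (simp add: \<delta>_def lookup_map0 p_def)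
  have pow: "single (\<delta> \<mu>) a ^ p = single \<mu> (a ^ p)" if "\<mu> \<in> keys G" for \<mu> and a :: 'a
  proof -
    obtain \<kappa> where \<kappa>: "single (\<delta> \<mu>) a ^ p = single \<kappa> (a ^ p)" "\<And>u. lookup \<kappa> u = p * lookup (\<delta> \<mu>) u"
      using single_power[of "\<delta> \<mu>" a p] by blast
    have "\<kappa> = \<mu>" by (rule poly_mapping_eqI) (simp add: \<kappa>(2) \<delta>[OF that])
    then show ?thesis using \<kappa>(1) by simp
  qed
  define Y where "Y j = (\<Sum>\<mu>\<in>keys G. single (\<delta> \<mu>) (y j (lookup G \<mu>)))" for j
  have "Y j ^ p = (\<Sum>\<mu>\<in>keys G. single \<mu> (y j (lookup G \<mu>) ^ p))" for j
  proof -
    have "Y j ^ p = (\<Sum>\<mu>\<in>keys G. single (\<delta> \<mu>) (y j (lookup G \<mu>)) ^ p)"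
      unfolding Y_def by (rule freshmans_dream_sum) (simp_all add: CHAR_mpoly prime_CHAR_semidom p p_def)
    then show ?thesis by (simp add: pow)
  qed
  then have "(\<Sum>j<q. single 0 (b j) * Y j ^ p)
      = (\<Sum>j<q. \<Sum>\<mu>\<in>keys G. single \<mu> (b j * y j (lookup G \<mu>) ^ p))"
    by (simp add: sum_distrib_left mult_single)
  also have "\<dots> = (\<Sum>\<mu>\<in>keys G. \<Sum>j<q. single \<mu> (b j * y j (lookup G \<mu>) ^ p))"
    by (rule sum.swap)
  also have "\<dots> = (\<Sum>\<mu>\<in>keys G. single \<mu> (lookup G \<mu>))"
  proof (intro sum.cong refl)
    fix \<mu> :: "'v \<Rightarrow>\<^sub>0 nat"
    have "(\<Sum>j<q. single \<mu> (f j)) = single \<mu> (\<Sum>j<q. f j)" for f :: "nat \<Rightarrow> 'a"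
      by (induction q) (simp_all add: single_add)
    then show "(\<Sum>j<q. single \<mu> (b j * y j (lookup G \<mu>) ^ p)) = single \<mu> (lookup G \<mu>)"
      using b[of "lookup G \<mu>"] by (simp add: p_def)
  qed
  also have "\<dots> = G" by (rule poly_mapping_sum_single[symmetric])
  finally have "G = (\<Sum>j<q. single 0 (b j) * Y j ^ p)" ..
  moreover have "Y j \<in> whom w V d" for j
    unfolding Y_def
  proof (intro whom_sum whom_single)
    fix \<mu> assume \<mu>: "\<mu> \<in> keys G"
    have keys: "keys (\<delta> \<mu>) = keys \<mu>" using \<delta>[OF \<mu>] p0 by (auto simp: in_keys_iff)
    then show "keys (\<delta> \<mu>) \<subseteq> V" using whomD[OF G \<mu>] by simp
    have "weight w \<mu> = p * weight w (\<delta> \<mu>)"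
      unfolding weight_def keys by (simp add: \<delta>[OF \<mu>] sum_distrib_left mult_ac)
    then show "weight w (\<delta> \<mu>) = d" using whomD[OF G \<mu>] p0 by (simp add: p_def)
  qed
  ultimately show ?thesis unfolding p_def by blast
qed

text \<open>Each line extension in the inductive notion of dimension adds its vector to the spanning
  family, at index \<open>m\<close>.\<close>

lemma dimension_spanning:
  fixes E :: "'a::field set"
  assumes "ring.dimension (ring_of_type_algebra :: 'a ring) m K E"
  shows "\<exists>b. \<forall>x\<in>E. \<exists>k. (\<forall>j<m. k j \<in> K) \<and> x = (\<Sum>j<m. b j * k j)"
proof -
  interpret R: Ring.ring "ring_of_type_algebra :: 'a ring" by (rule ring_from_type_algebra)
  show ?thesis
    using assms
  proof (induction rule: R.dimension.induct)
    case zero_dim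
    show ?case by (simp add: ring_of_type_algebra_def)
  next
    case (Suc_dim v E m K)
    then obtain b where b: "\<And>x. x \<in> E \<Longrightarrow> \<exists>k. (\<forall>j<m. k j \<in> K) \<and> x = (\<Sum>j<m. b j * k j)" by blast
    show ?case
    proof (rule exI[of _ "b(m := v)"], rule ballI)
      fix x assume "x \<in> R.line_extension K v E"
      then obtain a e where ae: "a \<in> K" "e \<in> E" "x = a * v + e"
        unfolding R.line_extension_mem_iff by (auto simp: ring_of_type_algebra_def)
      obtain k where k: "\<And>j. j < m \<Longrightarrow> k j \<in> K" "e = (\<Sum>j<m. b j * k j)" using b[OF ae(2)] by blast
      show "\<exists>k. (\<forall>j<Suc m. k j \<in> K) \<and> x = (\<Sum>j<Suc m. (b(m := v)) j * k j)"
        by (intro exI[of _ "k(m := a)"]) (use k ae in \<open>auto simp: less_Suc_eq mult.commute\<close>)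
    qed
  qed
qed

lemma semi_perfect_basis:
  assumes "semi_perfect TYPE('a::field)" "CHAR('a::field) > 0"
  shows "\<exists>(q :: nat) (b :: nat \<Rightarrow> 'a::field) y. \<forall>a. a = (\<Sum>j<q. b j * y j a ^ CHAR('a::field))"
proof -
  interpret R: Ring.ring "ring_of_type_algebra :: 'a ring" by (rule ring_from_type_algebra)
  have "R.finite_dimension (range (\<lambda>x :: 'a. x ^ CHAR('a))) UNIV"
    using assms by (auto simp: semi_perfect_def)
  then obtain q where "R.dimension q (range (\<lambda>x :: 'a. x ^ CHAR('a))) UNIV"
    by (auto simp: R.finite_dimension_def)
  from dimension_spanning[OF this] obtain b where b: "\<And>x. \<exists>k. (\<forall>j<q. k j \<in> range (\<lambda>x :: 'a. x ^ CHAR('a))) \<and> x = (\<Sum>j<q. b j * k j)"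
    by blast
  have "\<exists>y. x = (\<Sum>j<q. b j * y j ^ CHAR('a))" for x
  proof -
    obtain k where k: "\<And>j. j < q \<Longrightarrow> k j \<in> range (\<lambda>x :: 'a. x ^ CHAR('a))" "x = (\<Sum>j<q. b j * k j)"
      using b[of x] by blast
    then have "\<forall>j. \<exists>y. j < q \<longrightarrow> k j = y ^ CHAR('a)" by blast
    then obtain y where "\<And>j. j < q \<Longrightarrow> k j = y j ^ CHAR('a)" by metis
    then show ?thesis using k(2) by (intro exI[of _ y]) simp
  qed
  then obtain y where "\<And>x. x = (\<Sum>j<q. b j * y x j ^ CHAR('a))" by metis
  then show ?thesis by (intro exI[of _ q] exI[of _ b] exI[of _ "\<lambda>j x. y x j"]) blast
qed

subsection \<open>The algebra of ultraproducts of forms\<close>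

text \<open>No scalars appear because the generating sets used below absorb them. The number of
  summands is a single natural number, independent of the index in an ultrapower.\<close>

inductive_set sums_of :: "'r::comm_monoid_add set \<Rightarrow> 'r set" for G where
  zero: "0 \<in> sums_of G"
| step: "g \<in> G \<Longrightarrow> z \<in> sums_of G \<Longrightarrow> g + z \<in> sums_of G"

lemma sums_of_add: "x \<in> sums_of G \<Longrightarrow> y \<in> sums_of G \<Longrightarrow> x + y \<in> sums_of G"
  by (induction rule: sums_of.induct) (auto simp: add.assoc intro: sums_of.step)

lemma sums_of_gen: "g \<in> G \<Longrightarrow> g \<in> sums_of G"
  using sums_of.step[OF _ sums_of.zero] by fastforce

lemma sums_of_sum: "(\<And>i. i \<in> A \<Longrightarrow> f i \<in> sums_of G) \<Longrightarrow> sum f A \<in> sums_of G"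
  by (induction A rule: infinite_finite_induct) (auto intro: sums_of.zero sums_of_add)

lemma sums_of_map:
  assumes "x \<in> sums_of G" and "f 0 = 0" and "\<And>x y. f (x + y) = f x + f y"
    and "\<And>g. g \<in> G \<Longrightarrow> f g \<in> sums_of G'"
  shows "f x \<in> sums_of G'"
  using assms(1) by induction (auto simp: assms intro: sums_of.zero sums_of_add)

lemma sums_of_rep:
  "x \<in> sums_of G \<Longrightarrow> \<exists>m g. (\<forall>i<m. g i \<in> G) \<and> x = (\<Sum>i<m::nat. g i)"
proof (induction rule: sums_of.induct)
  case zero
  show ?case by (intro exI[of _ 0]) simp
next
  case (step g z)
  then obtain m g' where g': "\<And>i. i < m \<Longrightarrow> g' i \<in> G" "z = (\<Sum>i<m::nat. g' i)" by blast
  have "(\<Sum>i<m. (g'(m := g)) i) = (\<Sum>i<m. g' i)"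
    by (rule sum.cong) auto
  then show ?case
    using step(1) g' by (intro exI[of _ "Suc m"] exI[of _ "g'(m := g)"]) (auto simp: less_Suc_eq add.commute)
qed

definition ultra_const :: "'a::comm_ring_1 ultrapower \<Rightarrow> 'a multipoly ultrapower" where
  "ultra_const = ultra_map (\<lambda>_. single 0)"

definition forms_in :: "nat \<Rightarrow> nat \<Rightarrow> 'a::comm_ring_1 multipoly set" where
  "forms_in m n = whom (\<lambda>_. 1) {..<m} n"

abbreviation base_change :: "'a::field multipoly \<Rightarrow> 'a alg_closure multipoly" where
  "base_change \<equiv> Poly_Mapping.map to_ac"

definition ultra_forms :: "(nat \<Rightarrow> nat) \<Rightarrow> nat \<Rightarrow> 'a::comm_ring_1 multipoly ultrapower set" where
  "ultra_forms N n = {ultraproduct F |F. \<forall>k. F k \<in> forms_in (N k) n}"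

definition rational_forms :: "(nat \<Rightarrow> nat) \<Rightarrow> nat \<Rightarrow> 'a::field alg_closure multipoly ultrapower set" where
  "rational_forms N n = {ultraproduct (\<lambda>k. base_change (F k)) |F. \<forall>k. F k \<in> forms_in (N k) n}"

text \<open>The scalars come from the ultrapower of the closure, the ground field of
  \<open>ultra_forms\<close>. A member is represented by combinations of forms over the small field
  with a number of terms that does not grow with the index.\<close>

definition rational_span :: "(nat \<Rightarrow> nat) \<Rightarrow> nat \<Rightarrow> 'a::field alg_closure multipoly ultrapower set" where
  "rational_span N n = sums_of {ultra_const a * s |a s. s \<in> rational_forms N n}"

text \<open>The variable \<open>i k\<close> may change with the index: when the number of variables
  is unbounded along the sequence, fixed variables do not detect every nonzero class.\<close>

definition ultra_hasse :: "(nat \<Rightarrow> nat) \<Rightarrow> nat \<Rightarrow> 'a::comm_ring_1 multipoly ultrapower \<Rightarrow> 'a multipoly ultrapower" where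
  "ultra_hasse i j = ultra_map (\<lambda>k. hasse (i k) j)"

lemma to_ac_hom: "comm_ring_hom to_ac"
  by unfold_locales auto

interpretation base_change: comm_ring_hom base_change
  by (rule map_hom_poly[OF to_ac_hom])

lemma ultra_const_hom: "comm_ring_hom ultra_const"
  unfolding ultra_const_def by (rule ultra_map_hom[OF single_zero_hom])

interpretation ultra_const: comm_ring_hom ultra_const
  by (rule ultra_const_hom)

lemma ultra_const_ultraproduct: "ultra_const (ultraproduct a) = ultraproduct (\<lambda>k. single 0 (a k))"
  by (simp add: ultra_const_def ultra_map_ultraproduct)

lemma ultra_hasse_ultraproduct: "ultra_hasse i j (ultraproduct F) = ultraproduct (\<lambda>k. hasse (i k) j (F k))"
  by (simp add: ultra_hasse_def ultra_map_ultraproduct)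

lemma ultra_formsI: "(\<And>k. F k \<in> forms_in (N k) n) \<Longrightarrow> ultraproduct F \<in> ultra_forms N n"
  unfolding ultra_forms_def by blast

lemma rational_formsI:
  "(\<And>k. F k \<in> forms_in (N k) n) \<Longrightarrow> ultraproduct (\<lambda>k. base_change (F k)) \<in> rational_forms N n"
  unfolding rational_forms_def by blast

lemma ultra_formsE:
  assumes "x \<in> ultra_forms N n"
  obtains F where "x = ultraproduct F" "\<And>k. F k \<in> forms_in (N k) n"
  using assms unfolding ultra_forms_def by blast

lemma rational_formsE:
  assumes "x \<in> rational_forms N n"
  obtains F where "x = ultraproduct (\<lambda>k. base_change (F k))" "\<And>k. F k \<in> forms_in (N k) n"
  using assms unfolding rational_forms_def by blast

lemma forms_in_base_change: "F \<in> forms_in m n \<Longrightarrow> base_change F \<in> forms_in m n"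
  unfolding forms_in_def by (rule whom_map)

lemma forms_in_add: "F \<in> forms_in m n \<Longrightarrow> G \<in> forms_in m n \<Longrightarrow> F + G \<in> forms_in m n"
  unfolding forms_in_def by (rule whom_add)

lemma forms_in_mult: "F \<in> forms_in m a \<Longrightarrow> G \<in> forms_in m b \<Longrightarrow> F * G \<in> forms_in m (a + b)"
  unfolding forms_in_def by (rule whom_mult)

lemma forms_in_const: "single 0 a \<in> forms_in m 0"
  unfolding forms_in_def by (rule whom_const)

lemma forms_in_scale: "F \<in> forms_in m n \<Longrightarrow> single 0 a * F \<in> forms_in m n"
  using forms_in_mult[OF forms_in_const] by fastforce

lemma forms_in_power: "F \<in> forms_in m n \<Longrightarrow> F ^ k \<in> forms_in m (k * n)"
  by (induction k) (use forms_in_const[of 1] in \<open>auto intro: forms_in_mult\<close>)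

lemma forms_in_hasse: "F \<in> forms_in m n \<Longrightarrow> j \<le> n \<Longrightarrow> hasse z j F \<in> forms_in m (n - j)"
  unfolding forms_in_def using whom_hasse[of F "\<lambda>_. 1" "{..<m}" n j z] by simp

lemma forms_in_hasse_eq_0:
  assumes "F \<in> forms_in m n" "n < j"
  shows "hasse z j F = 0"
proof (rule poly_mapping_eqI)
  fix \<kappa>
  have "\<kappa> \<notin> keys (hasse z j F)"
  proof
    assume "\<kappa> \<in> keys (hasse z j F)"
    then have "\<kappa> + single z j \<in> keys F" by (rule keys_hasse)
    then show False
      using whomD[OF assms(1)[unfolded forms_in_def]] assms(2) by (fastforce simp: weight_add)
  qed
  then show "lookup (hasse z j F) \<kappa> = lookup 0 \<kappa>" by (simp add: in_keys_iff)
qed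

lemma forms_in_0: "F \<in> forms_in m 0 \<Longrightarrow> F = single 0 (lookup F 0)"
  unfolding forms_in_def by (erule whom_0) simp

section \<open>Graded algebra structures on ultraproducts of forms\<close>

lemma graded_ultra_forms: "graded_algebra ultra_const (ultra_forms N)"
proof (rule graded_algebra.intro[OF ultra_const_hom])
  show "ultra_const a \<in> ultra_forms N 0" for a :: "'a::field ultrapower"
    by (cases a) (auto simp: ultra_const_ultraproduct intro!: ultra_formsI forms_in_const)
  show "0 \<in> ultra_forms N n" for n
    unfolding ultraproduct_0 by (rule ultra_formsI) (simp add: forms_in_def)
  show "x + y \<in> ultra_forms N n" if "x \<in> ultra_forms N n" "y \<in> ultra_forms N n"
    for x y :: "'a multipoly ultrapower" and n
    using that by (elim ultra_formsE) (simp add: ultraproduct_add ultra_formsI forms_in_add)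
  show "x * y \<in> ultra_forms N (m + n)" if "x \<in> ultra_forms N m" "y \<in> ultra_forms N n"
    for x y :: "'a multipoly ultrapower" and m n
    using that by (elim ultra_formsE) (simp add: ultraproduct_mult ultra_formsI forms_in_mult)
qed

lemma rational_forms_mult:
  "s \<in> rational_forms N m \<Longrightarrow> t \<in> rational_forms N n \<Longrightarrow> s * t \<in> rational_forms N (m + n)"
  by (elim rational_formsE)
    (simp add: ultraproduct_mult rational_formsI forms_in_mult flip: base_change.hom_mult)

lemma rational_span_gen: "s \<in> rational_forms N n \<Longrightarrow> ultra_const a * s \<in> rational_span N n"
  unfolding rational_span_def by (rule sums_of_gen) blast

lemma rational_forms_span: "s \<in> rational_forms N n \<Longrightarrow> s \<in> rational_span N n"
  using rational_span_gen[of s N n 1] by (simp add: ultra_const.hom_one)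

lemma rational_span_mult:
  fixes x y :: "'a::field alg_closure multipoly ultrapower"
  assumes "x \<in> rational_span N m" "y \<in> rational_span N n"
  shows "x * y \<in> rational_span N (m + n)"
  unfolding rational_span_def
proof (rule sums_of_map[OF assms(1)[unfolded rational_span_def], where f = "\<lambda>x. x * y"])
  fix g :: "'a alg_closure multipoly ultrapower"
  assume "g \<in> {ultra_const a * s |a s. s \<in> rational_forms N m}"
  then obtain a s where g: "g = ultra_const a * s" "s \<in> rational_forms N m" by blast
  show "g * y \<in> sums_of {ultra_const a * s |a s. s \<in> rational_forms N (m + n)}"
  proof (rule sums_of_map[OF assms(2)[unfolded rational_span_def], where f = "\<lambda>y. g * y"])
    fix h :: "'a alg_closure multipoly ultrapower"
    assume "h \<in> {ultra_const a * s |a s. s \<in> rational_forms N n}"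
    then obtain b t where h: "h = ultra_const b * t" "t \<in> rational_forms N n" by blast
    have "g * h = ultra_const (a * b) * (s * t)"
      by (simp add: g h ultra_const.hom_mult mult_ac)
    then show "g * h \<in> sums_of {ultra_const a * s |a s. s \<in> rational_forms N (m + n)}"
      using rational_forms_mult[OF g(2) h(2)] by (intro sums_of_gen) blast
  qed (auto simp: algebra_simps)
qed (auto simp: algebra_simps)

lemma graded_rational_span: "graded_algebra ultra_const (rational_span N)"
proof (rule graded_algebra.intro[OF ultra_const_hom])
  have "1 \<in> rational_forms N 0"
    using rational_formsI[of "\<lambda>_. single 0 1" N 0, OF forms_in_const]
    by (simp add: base_change.hom_one ultraproduct_1)
  from rational_span_gen[OF this] show "ultra_const a \<in> rational_span N 0" for a :: "'a::field alg_closure ultrapower"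
    by simp
qed (auto simp: rational_span_def[of N] intro: sums_of.zero sums_of_add rational_span_mult[unfolded rational_span_def])

section \<open>Hasse derivatives on ultraproducts\<close>

lemma ultra_hasse_hom: "comm_ring_hom (\<lambda>x. Abs_fps (\<lambda>j. ultra_hasse i j x))"
proof
  fix x y :: "'a multipoly ultrapower"
  have "hasse z j (1 :: 'a multipoly) = (if j = 0 then 1 else 0)" for z j
    using hasse_const[of j z "1 :: 'a"] by auto
  then show "Abs_fps (\<lambda>j. ultra_hasse i j 1) = (1 :: 'a multipoly ultrapower fps)"
    by (auto simp: fps_eq_iff ultraproduct_1 ultraproduct_0 ultra_hasse_ultraproduct)
  show "Abs_fps (\<lambda>j. ultra_hasse i j (x + y)) = Abs_fps (\<lambda>j. ultra_hasse i j x) + Abs_fps (\<lambda>j. ultra_hasse i j y)"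
    by (cases x; cases y) (simp add: fps_eq_iff ultra_hasse_ultraproduct ultraproduct_add hasse_add)
  show "Abs_fps (\<lambda>j. ultra_hasse i j (x * y)) = Abs_fps (\<lambda>j. ultra_hasse i j x) * Abs_fps (\<lambda>j. ultra_hasse i j y)"
    by (cases x; cases y)
      (simp add: fps_eq_iff fps_mult_nth ultra_hasse_ultraproduct ultraproduct_mult ultraproduct_sum hasse_mult)
qed

text \<open>For a variable \<open>z\<close> of a monomial \<open>\<mu>\<close> of \<open>F\<close>,
  taking the full exponent of \<open>z\<close> as \<open>j\<close> makes the binomial coefficient 1,
  so in every characteristic the coefficient of \<open>\<mu>\<close> reappears in
  \<open>hasse z j F\<close>.\<close>

lemma form_eq_0_if_hasse_eq_0:
  assumes F: "F \<in> forms_in m n" and "n > 0" and "\<And>z j. 0 < j \<Longrightarrow> j \<le> n \<Longrightarrow> hasse z j F = 0"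
  shows "F = 0"
proof (rule ccontr)
  assume "F \<noteq> 0"
  then obtain \<mu> where \<mu>: "\<mu> \<in> keys F" by (rule obtain_key)
  have wt: "weight (\<lambda>_. 1) \<mu> = n" using whomD[OF F[unfolded forms_in_def] \<mu>] by simp
  have "keys \<mu> \<noteq> {}"
  proof
    assume "keys \<mu> = {}"
    then have "weight (\<lambda>_. 1) \<mu> = 0" by (simp only: weight_def sum.empty)
    then show False using wt \<open>n > 0\<close> by simp
  qed
  then obtain z where z: "z \<in> keys \<mu>" by blast
  obtain \<nu> where \<nu>: "\<mu> = \<nu> + single z (lookup \<mu> z)" "z \<notin> keys \<nu>" by (rule single_split)
  define j where "j = lookup \<mu> z"
  have \<mu>_eq: "\<mu> = \<nu> + single z j" using \<nu>(1) by (simp only: j_def)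
  have "0 < j" using z by (simp add: j_def in_keys_iff)
  moreover have "j \<le> n" using wt unfolding \<mu>_eq by (simp add: weight_add)
  ultimately have "lookup (hasse z j F) \<nu> = 0" using assms(3) by simp
  moreover have "lookup \<nu> z = 0" using \<nu>(2) by (simp add: in_keys_iff)
  ultimately have "lookup F \<mu> = 0" by (simp add: lookup_hasse flip: \<mu>_eq)
  then show False using \<mu> by (simp add: in_keys_iff)
qed

lemma ultra_hasse_enough:
  fixes x :: "'a::comm_ring_1 multipoly ultrapower"
  assumes "x \<in> ultra_forms N n" "n > 0" and zero: "\<And>i j. j > 0 \<Longrightarrow> ultra_hasse i j x = 0"
  shows "x = 0"
proof -
  obtain F where x: "x = ultraproduct F" and F: "\<And>k. F k \<in> forms_in (N k) n"
    using assms(1) by (rule ultra_formsE) blast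
  have "\<forall>\<^sub>F k in ultra. \<forall>z. hasse z j (F k) = 0" if "0 < j" for j
  proof -
    \<comment> \<open>At each index \<open>i k\<close> is a variable with nonzero derivative
      whenever there is one, so vanishing along this one sequence gives vanishing for all
      variables.\<close>
    define i where "i k = (SOME z. hasse z j (F k) \<noteq> 0)" for k
    have "\<forall>\<^sub>F k in ultra. hasse (i k) j (F k) = 0"
      using zero[OF that, of i] unfolding x ultra_hasse_ultraproduct ultraproduct_0 ultraproduct_eq_iff .
    then show ?thesis
      by (rule eventually_mono) (metis (mono_tags, lifting) i_def someI_ex)
  qed
  \<comment> \<open>Only the finitely many orders up to \<open>n\<close> matter, so the large sets
    of indices can be intersected.\<close>
  then have "\<forall>\<^sub>F k in ultra. \<forall>j\<in>{1..n}. \<forall>z. hasse z j (F k) = 0"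
    by (intro eventually_ball_finite) auto
  then have "\<forall>\<^sub>F k in ultra. F k = 0"
    by (rule eventually_mono) (auto intro: form_eq_0_if_hasse_eq_0[OF F assms(2)])
  then show ?thesis unfolding x ultraproduct_0 ultraproduct_eq_iff .
qed

lemma ultra_hasse_rational_span:
  fixes x :: "'a::field alg_closure multipoly ultrapower"
  assumes x: "x \<in> rational_span N n" and j: "j \<le> n"
  shows "ultra_hasse i j x \<in> rational_span N (n - j)"
proof -
  interpret H: comm_ring_hom "\<lambda>x :: 'a alg_closure multipoly ultrapower. Abs_fps (\<lambda>j. ultra_hasse i j x)"
    by (rule ultra_hasse_hom)
  show ?thesis
    unfolding rational_span_def
  proof (rule sums_of_map[OF x[unfolded rational_span_def]])
    show "ultra_hasse i j 0 = (0 :: 'a alg_closure multipoly ultrapower)"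
      using H.hom_zero by (simp add: fps_eq_iff)
    show "ultra_hasse i j (x + y) = ultra_hasse i j x + ultra_hasse i j y" for x y :: "'a alg_closure multipoly ultrapower"
      using H.hom_add[of x y] by (simp add: fps_eq_iff)
    fix g :: "'a alg_closure multipoly ultrapower"
    assume "g \<in> {ultra_const a * s |a s. s \<in> rational_forms N n}"
    then obtain a s where g: "g = ultra_const a * s" and s: "s \<in> rational_forms N n" by blast
    obtain F where F: "s = ultraproduct (\<lambda>k. base_change (F k))" "\<And>k. F k \<in> forms_in (N k) n"
      using s by (rule rational_formsE) blast
    obtain \<alpha> where \<alpha>: "a = ultraproduct \<alpha>" by (cases a)
    have "hasse z j (single 0 b * G) = single 0 b * hasse z j G" for z b and G :: "'a alg_closure multipoly"
      by (rule poly_mapping_eqI) (simp add: lookup_hasse lookup_const_mult mult.left_commute)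
    then have "ultra_hasse i j g = ultra_const a * ultraproduct (\<lambda>k. base_change (hasse (i k) j (F k)))"
      by (simp add: g F(1) \<alpha> ultra_const_ultraproduct ultraproduct_mult ultra_hasse_ultraproduct map_hasse[OF to_ac_hom])
    then show "ultra_hasse i j g \<in> sums_of {ultra_const a * s |a s. s \<in> rational_forms N (n - j)}"
      using rational_span_gen[OF rational_formsI[of "\<lambda>k. hasse (i k) j (F k)", OF forms_in_hasse[OF F(2) j]]]
      by (simp add: rational_span_def)
  qed
qed

section \<open>Descent of p-th powers to the ground field\<close>

lemma rational_span_rep:
  assumes "x \<in> rational_span N n"
  obtains m a F where "\<And>i k. i < m \<Longrightarrow> F i k \<in> forms_in (N k) n"
    "x = ultraproduct (\<lambda>k. \<Sum>i<m::nat. single 0 (a i k) * base_change (F i k))"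
proof -
  obtain m g where g: "\<And>i. i < m \<Longrightarrow> g i \<in> {ultra_const a * s |a s. s \<in> rational_forms N n}" "x = (\<Sum>i<m::nat. g i)"
    using sums_of_rep[OF assms[unfolded rational_span_def]] by blast
  define P where "P i a F \<longleftrightarrow> (\<forall>k. F k \<in> forms_in (N k) n) \<and>
      g i = ultraproduct (\<lambda>k. single 0 (a k) * base_change (F k))" for i a F
  have "\<exists>a F. P i a F" if i: "i < m" for i
  proof -
    obtain a s where as: "g i = ultra_const a * s" and s: "s \<in> rational_forms N n" using g(1)[OF i] by blast
    obtain F where F: "s = ultraproduct (\<lambda>k. base_change (F k))" "\<And>k. F k \<in> forms_in (N k) n"
      using s by (rule rational_formsE) blast
    obtain \<alpha> where "a = ultraproduct \<alpha>" by (cases a)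
    then have "g i = ultraproduct (\<lambda>k. single 0 (\<alpha> k) * base_change (F k))"
      by (simp add: as F(1) ultra_const_ultraproduct ultraproduct_mult)
    then have "P i \<alpha> F" using F(2) unfolding P_def by blast
    then show ?thesis by blast
  qed
  then obtain a F where aF: "\<And>i. i < m \<Longrightarrow> P i (a i) (F i)"
    by metis
  then have "x = (\<Sum>i<m. ultraproduct (\<lambda>k. single 0 (a i k) * base_change (F i k)))"
    unfolding g(2) using aF by (intro sum.cong refl) (simp add: P_def)
  then have "x = ultraproduct (\<lambda>k. \<Sum>i<m::nat. single 0 (a i k) * base_change (F i k))"
    by (simp only: ultraproduct_sum)
  then show thesis using aF unfolding P_def by (intro that) auto
qed

text \<open>The functionals are those of \<open>ac_linear_projections\<close> for the scalars
  \<open>a i\<close>, applied to each coefficient. Replacing \<open>F i\<close> by an image of the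
  whole sum allows another expression of the same sum, in terms of p-th powers, to be
  inserted.\<close>

lemma coefficient_projections:
  fixes F :: "nat \<Rightarrow> 'a::field multipoly"
  shows "\<exists>l. (\<forall>i. ac_linear (l i)) \<and>
    (\<Sum>i<m. single 0 (a i) * base_change (F i))
      = (\<Sum>i<m. single 0 (a i) * base_change (Poly_Mapping.map (l i) (\<Sum>i<m. single 0 (a i) * base_change (F i))))"
proof -
  obtain l where l: "\<forall>i. ac_linear (l i)"
    "\<forall>b. (\<Sum>i<m. to_ac (b i) * a i) = (\<Sum>i<m. a i * to_ac (l i (\<Sum>i<m. to_ac (b i) * a i)))"
    using ac_linear_projections[where c = a and m = m] by (elim exE conjE) (rule that)
  let ?f = "\<Sum>i<m. single 0 (a i) * base_change (F i)"
  have lookup_f: "lookup ?f \<mu> = (\<Sum>i<m. to_ac (lookup (F i) \<mu>) * a i)" for \<mu>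
    unfolding lookup_sum lookup_const_mult by (simp add: lookup_map0 mult.commute)
  have "?f = (\<Sum>i<m. single 0 (a i) * base_change (Poly_Mapping.map (l i) ?f))"
  proof (rule poly_mapping_eqI)
    fix \<mu>
    have "lookup (base_change (Poly_Mapping.map (l i) ?f)) \<mu> = to_ac (l i (lookup ?f \<mu>))" for i
      using l(1) by (simp add: lookup_map0 ac_linear_0)
    then have "lookup (\<Sum>i<m. single 0 (a i) * base_change (Poly_Mapping.map (l i) ?f)) \<mu>
        = (\<Sum>i<m. a i * to_ac (l i (lookup ?f \<mu>)))"
      by (simp only: lookup_sum lookup_const_mult)
    also have "\<dots> = lookup ?f \<mu>"
      unfolding lookup_f by (rule l(2)[THEN spec, symmetric])
    finally show "lookup ?f \<mu> = lookup (\<Sum>i<m. single 0 (a i) * base_change (Poly_Mapping.map (l i) ?f)) \<mu>" ..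
  qed
  then show ?thesis using l(1) by blast
qed

text \<open>
  Functionals \<open>l\<close> over the ground field turn \<open>\<Sum> R\<^sup>p G\<close> into \<open>\<Sum> l(R\<^sup>p) G\<close>, where \<open>l(R\<^sup>p)\<close> is still a polynomial in the
  \<open>p\<close>-th powers of the variables and hence a combination of boundedly many \<open>p\<close>-th powers.
\<close>

lemma frobenius_span_rational:
  fixes x :: "'a::field alg_closure multipoly ultrapower"
  assumes sp: "semi_perfect TYPE('a)" and p: "CHAR('a) > 0"
    and x: "x \<in> rational_span N n"
    and x_frob: "x \<in> sums_of {ultraproduct (\<lambda>k. R k ^ CHAR('a) * base_change (G k)) |R G d e.
      0 < d \<and> CHAR('a) * d + e = n \<and> (\<forall>k. R k \<in> forms_in (N k) d) \<and> (\<forall>k. G k \<in> forms_in (N k) e)}"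
  shows "x \<in> decomposables (rational_span N) n"
proof -
  interpret Q: graded_algebra ultra_const "rational_span N :: nat \<Rightarrow> 'a alg_closure multipoly ultrapower set"
    by (rule graded_rational_span)
  define p where "p = CHAR('a)"
  have p2: "p \<ge> 2" using prime_CHAR_semidom[OF p] unfolding p_def by (rule prime_ge_2_nat)
  obtain q and b :: "nat \<Rightarrow> 'a" and y where basis: "\<forall>a. a = (\<Sum>j<q. b j * y j a ^ CHAR('a))"
    using semi_perfect_basis[OF sp p] by (elim exE) (rule that)
  obtain m a F where F: "\<And>i k. i < m \<Longrightarrow> F i k \<in> forms_in (N k) n"
    and x_F: "x = ultraproduct (\<lambda>k. \<Sum>i<m::nat. single 0 (a i k) * base_change (F i k))"
    using x by (rule rational_span_rep) blast
  define f where "f k = (\<Sum>i<m. single 0 (a i k) * base_change (F i k))" for k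
  define P where "P y R G d e \<longleftrightarrow> y = ultraproduct (\<lambda>k. R k ^ p * base_change (G k)) \<and> 0 < d \<and> p * d + e = n \<and>
      (\<forall>k. R k \<in> forms_in (N k) d) \<and> (\<forall>k. G k \<in> forms_in (N k) e)"
    for y :: "'a alg_closure multipoly ultrapower" and R and G :: "nat \<Rightarrow> 'a multipoly" and d e
  have "x \<in> sums_of {y. \<exists>R G d e. P y R G d e}"
    using x_frob unfolding P_def p_def .
  then obtain m' g where g: "\<And>l. l < m' \<Longrightarrow> \<exists>R G d e. P (g l) R G d e" "x = (\<Sum>l<m'::nat. g l)"
    using sums_of_rep[of x "{y. \<exists>R G d e. P y R G d e}"] by blast
  from g(1) obtain R G d e where RG': "\<And>l. l < m' \<Longrightarrow> P (g l) (R l) (G l) (d l) (e l)"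
    by metis
  note RG = RG'[unfolded P_def]
  have x_R: "x = ultraproduct (\<lambda>k. \<Sum>l<m'. R l k ^ p * base_change (G l k))"
    unfolding g(2) ultraproduct_sum[symmetric] by (rule sum.cong) (use RG in simp_all)
  define C where "C k l \<longleftrightarrow> (\<forall>i. ac_linear (l i)) \<and>
      f k = (\<Sum>i<m. single 0 (a i k) * base_change (Poly_Mapping.map (l i) (f k)))" for k l
  have "\<exists>l. C k l" for k
    unfolding C_def f_def by (rule coefficient_projections)
  then obtain L where L': "\<And>k. C k (L k)"
    by metis
  have L: "ac_linear (L k i)" for k i
    using L'[of k] unfolding C_def by blast
  have f_L: "f k = (\<Sum>i<m. single 0 (a i k) * base_change (Poly_Mapping.map (L k i) (f k)))" for k
    using L'[of k] unfolding C_def by (rule conjunct2)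
  \<comment> \<open>\<open>Y\<close> holds the \<open>q\<close> roots in the expansion of the image
    of \<open>R l k ^ p\<close> under a functional. The number of roots is the same for all
    \<open>k\<close>, so the expansion passes to the ultraproduct as a finite sum.\<close>
  define D where "D i l k Y \<longleftrightarrow> (\<forall>j. Y j \<in> forms_in (N k) (d l)) \<and>
      Poly_Mapping.map (L k i) (R l k ^ p) = (\<Sum>j<q. single 0 (b j) * Y j ^ p)" for i l k Y
  have ex: "\<exists>Y. D i l k Y" if l: "l < m'" for i l k
  proof -
    have "R l k ^ p \<in> forms_in (N k) (p * d l)" using RG[OF l] by (intro forms_in_power) blast
    then have form: "Poly_Mapping.map (L k i) (R l k ^ p) \<in> whom (\<lambda>_. 1) {..<N k} (CHAR('a) * d l)"
      unfolding forms_in_def p_def by (rule whom_map)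
    have dvd: "CHAR('a) dvd lookup \<mu> u" if "\<mu> \<in> keys (Poly_Mapping.map (L k i) (R l k ^ p))" for \<mu> u
    proof -
      have "\<mu> \<in> keys (R l k ^ CHAR('a alg_closure))"
        using that keys_map_subset[of "L k i" "R l k ^ p"] by (auto simp: p_def)
      then show ?thesis using keys_frobenius_power[of \<mu> "R l k" u] p by simp
    qed
    show ?thesis
      using frobenius_decomposition[OF p basis[rule_format] dvd form] by (simp add: D_def forms_in_def p_def)
  qed
  define Y where "Y i l k = (SOME Y. D i l k Y)" for i l k
  have Y': "D i l k (Y i l k)" if "l < m'" for i l k
    unfolding Y_def by (rule someI_ex[of "D i l k", OF ex[OF that]])
  note Y = Y'[unfolded D_def]
  define t where "t i l j k = single 0 (a i k * to_ac (b j)) * (base_change (Y i l k j) ^ p * base_change (G l k))"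
    for i l j k
  \<comment> \<open>The two expressions of \<open>x\<close> agree only on a large set of indices, so
    the combined expansion is derived there.\<close>
  have "\<forall>\<^sub>F k in ultra. f k = (\<Sum>l<m'. R l k ^ p * base_change (G l k))"
    unfolding ultraproduct_eq_iff[symmetric] f_def x_F[symmetric] by (rule x_R)
  then have "\<forall>\<^sub>F k in ultra. f k = (\<Sum>i<m. \<Sum>l<m'. \<Sum>j<q. t i l j k)"
  proof (rule eventually_mono)
    fix k assume fk: "f k = (\<Sum>l<m'. R l k ^ p * base_change (G l k))"
    have "single 0 (a i k) * base_change (Poly_Mapping.map (L k i) (f k)) = (\<Sum>l<m'. \<Sum>j<q. t i l j k)" for i
    proof -
      have "Poly_Mapping.map (L k i) (f k) = (\<Sum>l<m'. Poly_Mapping.map (L k i) (R l k ^ p) * G l k)"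
        unfolding fk by (simp only: map_ac_linear_sum[OF L] map_ac_linear_mult[OF L])
      also have "\<dots> = (\<Sum>l<m'. \<Sum>j<q. single 0 (b j) * Y i l k j ^ p * G l k)"
        by (intro sum.cong refl) (use Y in \<open>simp add: sum_distrib_right\<close>)
      finally have eq: "Poly_Mapping.map (L k i) (f k) = (\<Sum>l<m'. \<Sum>j<q. single 0 (b j) * Y i l k j ^ p * G l k)" .
      have bc: "base_change (single 0 (b j)) = single 0 (to_ac (b j))" for j
        by (rule poly_mapping_eqI) (simp add: lookup_map0 lookup_single when_def)
      have "single 0 (a i k) * base_change (single 0 (b j) * Y i l k j ^ p * G l k) = t i l j k" for l j
      proof -
        have "single 0 (a i k * to_ac (b j)) = single 0 (a i k) * (single 0 (to_ac (b j)) :: 'a alg_closure multipoly)"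
          by (simp add: mult_single)
        then show ?thesis
          by (simp only: t_def base_change.hom_mult base_change.hom_power bc mult.assoc)
      qed
      then show ?thesis
        unfolding eq by (simp add: base_change.hom_sum sum_distrib_left)
    qed
    then show "f k = (\<Sum>i<m. \<Sum>l<m'. \<Sum>j<q. t i l j k)"
      by (subst f_L) simp
  qed
  then have "x = (\<Sum>i<m. \<Sum>l<m'. \<Sum>j<q. ultraproduct (t i l j))"
    unfolding x_F f_def[symmetric] ultraproduct_sum by (simp add: ultraproduct_eq_iff)
  moreover have "ultraproduct (t i l j) \<in> decomposables (rational_span N) n" if l: "l < m'" for i l j
  proof -
    have Yl: "Y i l k j \<in> forms_in (N k) (d l)" for k using Y[OF l] by blast
    have Gl: "G l k \<in> forms_in (N k) (e l)" for k using RG[OF l] by blast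
    have dl: "0 < d l" "p * d l + e l = n" using RG[OF l] by auto
    define Y' where "Y' = ultraproduct (\<lambda>k. base_change (Y i l k j))"
    define G' where "G' = ultraproduct (\<lambda>k. base_change (G l k))"
    have Y': "Y' \<in> rational_span N (d l)"
      unfolding Y'_def by (intro rational_forms_span rational_formsI Yl)
    have G': "G' \<in> rational_span N (e l)"
      unfolding G'_def by (intro rational_forms_span rational_formsI Gl)
    have pw: "z ^ p = z * z ^ (p - 1)" for z :: "'a alg_closure multipoly"
      using p2 by (cases p) auto
    have "t i l j = (\<lambda>k. single 0 (a i k * to_ac (b j)) *
        (base_change (Y i l k j) * (base_change (Y i l k j) ^ (p - 1) * base_change (G l k))))"
      by (rule ext) (simp only: t_def pw mult.assoc)
    then have "ultraproduct (t i l j) = ultra_const (ultraproduct (\<lambda>k. a i k * to_ac (b j))) * (Y' * (Y' ^ (p - 1) * G'))"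
      by (simp only: Y'_def G'_def ultra_const_ultraproduct ultraproduct_mult ultraproduct_power)
    \<comment> \<open>Since p is at least 2, splitting off a single \<open>Y'\<close> leaves a
      factor of positive degree even when \<open>G'\<close> has degree 0.\<close>
    moreover have "Y' * (Y' ^ (p - 1) * G') \<in> decomposables (rational_span N) n"
    proof (rule decomposables_mult[OF Y' Q.mult[OF Q.power[OF Y'] G'] dl(1)])
      show "0 < (p - 1) * d l + e l" using p2 dl(1) by simp
      have "d l + (p - 1) * d l = p * d l" using p2 by (cases p) auto
      then show "d l + ((p - 1) * d l + e l) = n" using dl(2) by simp
    qed
    ultimately show ?thesis by (simp add: Q.decomposables_scale)
  qed
  ultimately show ?thesis
    by (auto intro!: decomposables_sum)
qed

lemma CHAR_closure: "CHAR('a::field alg_closure ultrapower) = CHAR('a)"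
  by (simp add: CHAR_ultrapower)

theorem ultra_hasse_algebra:
  assumes sp: "semi_perfect TYPE('a::field)"
  shows "hasse_algebra (ultra_const :: 'a alg_closure ultrapower \<Rightarrow> _) (ultra_forms N) (rational_span N) ultra_hasse"
proof (intro hasse_algebra.intro hasse_algebra_axioms.intro graded_ultra_forms graded_rational_span ultra_hasse_hom)
  interpret R: graded_algebra "ultra_const :: 'a alg_closure ultrapower \<Rightarrow> _" "ultra_forms N"
    by (rule graded_ultra_forms)
  interpret Q: graded_algebra "ultra_const :: 'a alg_closure ultrapower \<Rightarrow> _" "rational_span N"
    by (rule graded_rational_span)
  have rational_ultra: "x \<in> ultra_forms N n" if "x \<in> rational_forms N n" for x :: "'a alg_closure multipoly ultrapower" and n
    using that by (elim rational_formsE) (simp add: ultra_formsI forms_in_base_change)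
  show "x \<in> ultra_forms N n" if "x \<in> rational_span N n" for x :: "'a alg_closure multipoly ultrapower" and n
    using that unfolding rational_span_def
    by induction (auto intro: R.zero R.add R.scale rational_ultra)
  show "x \<in> range ultra_const" if "x \<in> ultra_forms N 0" for x :: "'a alg_closure multipoly ultrapower"
  proof -
    obtain F where F: "x = ultraproduct F" "\<And>k. F k \<in> forms_in (N k) 0" using \<open>x \<in> ultra_forms N 0\<close> by (rule ultra_formsE) blast
    have "x = ultra_const (ultraproduct (\<lambda>k. lookup (F k) 0))"
      unfolding F(1) ultra_const_ultraproduct using forms_in_0[OF F(2)] by metis
    then show ?thesis by blast
  qed
  show "ultra_hasse i 0 x = x" for i and x :: "'a alg_closure multipoly ultrapower"
    by (cases x) (simp add: ultra_hasse_ultraproduct)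
  show "ultra_hasse i j (ultra_const a) = 0" if "j > 0" for i j and a :: "'a alg_closure ultrapower"
    using that by (cases a) (simp add: ultra_const_ultraproduct ultra_hasse_ultraproduct hasse_const ultraproduct_0)
  show "ultra_hasse i j x \<in> ultra_forms N (n - j)" if "x \<in> ultra_forms N n" "j \<le> n" for i j n and x :: "'a alg_closure multipoly ultrapower"
    using that by (elim ultra_formsE) (simp add: ultra_hasse_ultraproduct ultra_formsI forms_in_hasse)
  show "ultra_hasse i j x = 0" if "x \<in> ultra_forms N n" "n < j" for i j n and x :: "'a alg_closure multipoly ultrapower"
  proof -
    obtain F where F: "x = ultraproduct F" "\<And>k. F k \<in> forms_in (N k) n"
      using \<open>x \<in> ultra_forms N n\<close> by (rule ultra_formsE) blast
    show ?thesis
      by (simp add: F(1) ultra_hasse_ultraproduct forms_in_hasse_eq_0[OF F(2) \<open>n < j\<close>] ultraproduct_0)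
  qed
  show "ultra_hasse i j x \<in> rational_span N (n - j)" if "x \<in> rational_span N n" "j \<le> n" for i j n and x :: "'a alg_closure multipoly ultrapower"
    using that by (rule ultra_hasse_rational_span)
  show "x = 0" if "x \<in> ultra_forms N n" "0 < n" "\<And>i j. 0 < j \<Longrightarrow> ultra_hasse i j x = 0" for x :: "'a alg_closure multipoly ultrapower" and n
    using that by (rule ultra_hasse_enough)
  show "x = 0" if "CHAR('a alg_closure ultrapower) > 0" "x ^ CHAR('a alg_closure ultrapower) = 0" for x :: "'a alg_closure multipoly ultrapower"
    using that
    by (cases x) (simp add: ultraproduct_power ultraproduct_0 ultraproduct_eq_iff)
  show perfect: "\<exists>b. b ^ CHAR('a alg_closure ultrapower) = a" if pos: "CHAR('a alg_closure ultrapower) > 0" for a :: "'a alg_closure ultrapower"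
  proof -
    obtain \<alpha> where \<alpha>: "a = ultraproduct \<alpha>" by (cases a)
    obtain r where "\<And>x :: 'a alg_closure. r x ^ CHAR('a alg_closure ultrapower) = x"
      using nth_root_exists[OF pos] by metis
    then show ?thesis
      by (intro exI[of _ "ultraproduct (\<lambda>k. r (\<alpha> k))"]) (simp add: \<alpha> ultraproduct_power)
  qed
  fix I :: "nat set" and r s :: "nat \<Rightarrow> 'a alg_closure multipoly ultrapower" and d e n
  let ?p = "CHAR('a alg_closure ultrapower)"
  assume pos: "?p > 0" and "finite I"
    and mem: "\<And>k. k \<in> I \<Longrightarrow> r k \<in> ultra_forms N (d k) \<and> s k \<in> rational_span N (e k) \<and> 0 < d k \<and> ?p * d k + e k = n"
    and Q: "(\<Sum>k\<in>I. r k ^ ?p * s k) \<in> rational_span N n"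
  let ?G = "{ultraproduct (\<lambda>k. R k ^ CHAR('a) * base_change (G k)) |R G d e.
      0 < d \<and> CHAR('a) * d + e = n \<and> (\<forall>k. R k \<in> forms_in (N k) d) \<and> (\<forall>k. G k \<in> forms_in (N k) e)}"
  have "(\<Sum>k\<in>I. r k ^ ?p * s k) \<in> sums_of ?G"
  proof (rule sums_of_sum)
    fix k assume "k \<in> I"
    from mem[OF this] have k: "r k \<in> ultra_forms N (d k)" "s k \<in> rational_span N (e k)" "0 < d k" "?p * d k + e k = n" by auto
    show "r k ^ ?p * s k \<in> sums_of ?G"
    proof (rule sums_of_map[OF k(2)[unfolded rational_span_def]])
      fix g :: "'a alg_closure multipoly ultrapower"
      assume "g \<in> {ultra_const a * s |a s. s \<in> rational_forms N (e k)}"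
      then obtain a t where g: "g = ultra_const a * t" and t: "t \<in> rational_forms N (e k)" by blast
      \<comment> \<open>The scalar in front of a rational form is moved into the p-th power through
        its p-th root.\<close>
      obtain \<beta> where \<beta>: "\<beta> ^ ?p = a" using perfect[OF pos] by blast
      have "ultra_const \<beta> * r k \<in> ultra_forms N (d k)" using k(1) by (rule R.scale)
      then obtain R where R: "ultra_const \<beta> * r k = ultraproduct R" "\<And>l. R l \<in> forms_in (N l) (d k)"
        by (rule ultra_formsE) blast
      obtain G where G: "t = ultraproduct (\<lambda>l. base_change (G l))" "\<And>l. G l \<in> forms_in (N l) (e k)"
        using t by (rule rational_formsE) blast
      have "r k ^ ?p * g = (ultra_const \<beta> * r k) ^ ?p * t"
        by (simp only: g \<beta>[symmetric] ultra_const.hom_power power_mult_distrib mult_ac)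
      also have "\<dots> = ultraproduct (\<lambda>l. R l ^ CHAR('a) * base_change (G l))"
        unfolding R(1) G(1) by (simp add: ultraproduct_power ultraproduct_mult CHAR_closure)
      finally have "r k ^ ?p * g \<in> ?G"
        using k(3,4) R(2) G(2) unfolding CHAR_closure by blast
      then show "r k ^ ?p * g \<in> sums_of ?G" by (rule sums_of_gen)
    qed (auto simp: algebra_simps)
  qed
  then show "(\<Sum>k\<in>I. r k ^ ?p * s k) \<in> decomposables (rational_span N) n"
    using frobenius_span_rational[OF sp _ Q] pos by (simp add: CHAR_closure)
qed

section \<open>Strength\<close>

lemma strength_expr_mono:
  assumes "strength_expr n d f s" "s \<le> t" "0 < d"
  shows "strength_expr n d f t"
proof -
  obtain g h where gh: "\<And>i. i < s \<Longrightarrow> (\<exists>e<d. is_form n e (g i)) \<and> (\<exists>e<d. is_form n e (h i))"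
    and f: "f = (\<Sum>i<s. g i * h i)"
    using assms(1) unfolding strength_expr_def by blast
  have zero: "\<exists>e<d. is_form n e 0"
    using assms(3) by (auto simp: is_form_def)
  have "(\<Sum>i<t. (if i < s then g i else 0) * (if i < s then h i else 0)) = (\<Sum>i<s. g i * h i)"
    using assms(2) by (intro sum.mono_neutral_cong_right) auto
  then show ?thesis
    unfolding strength_expr_def
    by (intro exI[of _ "\<lambda>i. if i < s then g i else 0"] exI[of _ "\<lambda>i. if i < s then h i else 0"])
      (use gh zero f in auto)
qed

lemma strength_expr_exists:
  fixes f :: "'a::comm_ring_1 multipoly"
  assumes f: "is_form n d f" and d: "d > 1"
  shows "\<exists>s. strength_expr n d f s"
proof -
  have "\<exists>g h. (\<exists>e<d. is_form n e g) \<and> (\<exists>e<d. is_form n e h) \<and> single \<mu> (lookup f \<mu>) = g * h"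
    if \<mu>: "\<mu> \<in> keys f" for \<mu>
  proof -
    have keys: "keys \<mu> \<subseteq> {..<n}" and wt: "weight (\<lambda>_. 1) \<mu> = d"
      using f \<mu> by (auto simp: is_form_whom whom_def)
    then have "keys \<mu> \<noteq> {}" using d by (auto simp: weight_def)
    then obtain z where z: "z \<in> keys \<mu>" by blast
    define \<nu> where "\<nu> = \<mu> - single z 1"
    have \<mu>_eq: "\<mu> = single z 1 + \<nu>" and "keys \<nu> \<subseteq> keys \<mu>"
      using split_off_variable[OF z] by (simp_all only: \<nu>_def)
    then have "keys \<nu> \<subseteq> {..<n}" using keys by blast
    moreover have "weight (\<lambda>_. 1) \<nu> = d - 1" using wt by (simp add: \<mu>_eq weight_add)
    ultimately have "is_form n (d - 1) (single \<nu> (lookup f \<mu>))"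
      unfolding is_form_whom by (intro whom_single) auto
    moreover have "is_form n 1 (single (single z 1) 1 :: 'a multipoly)"
      unfolding is_form_whom by (rule whom_single) (use keys z in auto)
    moreover have "single \<mu> (lookup f \<mu>) = single (single z 1) 1 * single \<nu> (lookup f \<mu>)"
      by (simp add: mult_single \<mu>_eq)
    moreover have "d - 1 < d" using d by simp
    ultimately show ?thesis using d by blast
  qed
  then obtain g h where gh: "\<And>\<mu>. \<mu> \<in> keys f \<Longrightarrow> (\<exists>e<d. is_form n e (g \<mu>)) \<and> (\<exists>e<d. is_form n e (h \<mu>)) \<and>
      single \<mu> (lookup f \<mu>) = g \<mu> * h \<mu>"
    by metis
  obtain b where b: "bij_betw b {..<card (keys f)} (keys f)"
    using ex_bij_betw_nat_finite[of "keys f"] by (auto simp: lessThan_atLeast0)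
  have "f = (\<Sum>\<mu>\<in>keys f. single \<mu> (lookup f \<mu>))" by (rule poly_mapping_sum_single)
  also have "\<dots> = (\<Sum>\<mu>\<in>keys f. g \<mu> * h \<mu>)" by (intro sum.cong refl) (use gh in blast)
  also have "\<dots> = (\<Sum>i<card (keys f). g (b i) * h (b i))"
    by (rule sum.reindex_bij_betw[OF b, symmetric])
  finally have "f = (\<Sum>i<card (keys f). g (b i) * h (b i))" .
  moreover have "b i \<in> keys f" if "i < card (keys f)" for i
    using bij_betwE[OF b] that by simp
  ultimately have "strength_expr n d f (card (keys f))"
    unfolding strength_expr_def
    by (intro exI[of _ "\<lambda>i. g (b i)"] exI[of _ "\<lambda>i. h (b i)"]) (use gh in blast)
  then show ?thesis by blast
qed

lemma strength_expr_if_le: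
  fixes f :: "'a::comm_ring_1 multipoly"
  assumes "is_form n d f" "d > 1" "strength n d f \<le> s"
  shows "strength_expr n d f s"
proof -
  obtain t where "strength_expr n d f t"
    using strength_expr_exists[OF assms(1,2)] by blast
  then have "strength_expr n d f (strength n d f)"
    unfolding strength_def by (rule LeastI)
  then show ?thesis using assms(2,3) by (intro strength_expr_mono[of n d f "strength n d f" s]) auto
qed

text \<open>
  In an expression the degrees of the two factors of a summand need not add up to \<open>d\<close>; the summands
  where they do not contribute nothing in degree \<open>d\<close> and can be dropped.
\<close>

lemma strength_expr_homogeneous:
  fixes f :: "'a::comm_ring_1 multipoly"
  assumes f: "is_form n d f" and "strength_expr n d f s"
  shows "\<exists>g h. (\<forall>i a. g i a \<in> forms_in n a) \<and> (\<forall>i a. h i a \<in> forms_in n (d - a)) \<and>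
    f = (\<Sum>i<s. \<Sum>a\<in>{1..<d}. g i a * h i a)"
proof -
  obtain g h where gh: "\<And>i. i < s \<Longrightarrow> (\<exists>e<d. is_form n e (g i)) \<and> (\<exists>e<d. is_form n e (h i))"
    and f_eq: "f = (\<Sum>i<s. g i * h i)"
    using assms(2) unfolding strength_expr_def by blast
  then obtain a b where a: "\<And>i. i < s \<Longrightarrow> a i < d \<and> g i \<in> forms_in n (a i)"
    and b: "\<And>i. i < s \<Longrightarrow> b i < d \<and> h i \<in> forms_in n (b i)"
    unfolding is_form_whom forms_in_def by metis
  \<comment> \<open>Each product is filed under the degree of its first factor. That degree may vary
    along a sequence of forms; summing over all degrees fixes the degree of every factor, as the
    passage to an ultraproduct requires.\<close>
  define use where "use i e \<longleftrightarrow> i < s \<and> e = a i \<and> a i + b i = d" for i e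
  define g' where "g' i e = (if use i e then g i else 0)" for i e
  define h' where "h' i e = (if use i e then h i else 0)" for i e
  have "g' i e \<in> forms_in n e" for i e
    using a[of i] by (auto simp: g'_def use_def forms_in_def)
  moreover have "h' i e \<in> forms_in n (d - e)" for i e
    using b[of i] by (auto simp: h'_def use_def forms_in_def)
  moreover have "f = (\<Sum>i<s. \<Sum>e\<in>{1..<d}. g' i e * h' i e)"
  proof -
    have inner: "(\<Sum>e\<in>{1..<d}. g' i e * h' i e) = (if a i + b i = d then g i * h i else 0)" if i: "i < s" for i
    proof -
      have "(\<Sum>e\<in>{1..<d}. g' i e * h' i e) = (\<Sum>e\<in>{1..<d}. if e = a i then (if a i + b i = d then g i * h i else 0) else 0)"
        using i by (intro sum.cong refl) (auto simp: g'_def h'_def use_def)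
      also have "\<dots> = (if a i \<in> {1..<d} then (if a i + b i = d then g i * h i else 0) else 0)"
        by (simp add: sum.delta')
      \<comment> \<open>Two degrees below \<open>d\<close> with sum \<open>d\<close> are both
        positive, so \<open>a i\<close> is in the range of summation.\<close>
      also have "\<dots> = (if a i + b i = d then g i * h i else 0)"
        using a[OF i] b[OF i] by auto
      finally show ?thesis .
    qed
    have "f = (\<Sum>i<s. if a i + b i = d then g i * h i else 0)"
    proof (rule poly_mapping_eqI)
      fix \<mu>
      show "lookup f \<mu> = lookup (\<Sum>i<s. if a i + b i = d then g i * h i else 0) \<mu>"
      proof (cases "weight (\<lambda>_. 1) \<mu> = d")
        case True
        have "lookup (g i * h i) \<mu> = lookup (if a i + b i = d then g i * h i else 0) \<mu>" if i: "i < s" for i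
        proof (cases "a i + b i = d")
          case False
          have "g i * h i \<in> forms_in n (a i + b i)"
            using a[OF i] b[OF i] by (intro forms_in_mult) auto
          then have "\<mu> \<notin> keys (g i * h i)"
            using whomD[of "g i * h i" "\<lambda>_. 1" "{..<n}" "a i + b i" \<mu>] True False by (auto simp: forms_in_def)
          then show ?thesis using False by (simp add: in_keys_iff)
        qed simp
        then show ?thesis
          unfolding f_eq lookup_sum by (intro sum.cong refl) auto
      next
        case False
        have f_form: "f \<in> forms_in n d" using f by (simp add: is_form_whom forms_in_def)
        have sum_form: "(\<Sum>i<s. if a i + b i = d then g i * h i else 0) \<in> forms_in n d"
          unfolding forms_in_def
        proof (rule whom_sum)
          fix i assume "i \<in> {..<s}"
          then have "g i * h i \<in> forms_in n (a i + b i)"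
            using a[of i] b[of i] by (intro forms_in_mult) auto
          then show "(if a i + b i = d then g i * h i else 0) \<in> whom (\<lambda>_. 1) {..<n} d"
            by (auto simp: forms_in_def)
        qed
        have zero: "lookup F \<mu> = 0" if "F \<in> forms_in n d" for F :: "'a multipoly"
          using whomD[OF that[unfolded forms_in_def], of \<mu>] False by (auto simp: in_keys_iff)
        show ?thesis by (simp only: zero[OF f_form] zero[OF sum_form])
      qed
    qed
    also have "\<dots> = (\<Sum>i<s. \<Sum>e\<in>{1..<d}. g' i e * h' i e)"
      by (intro sum.cong refl) (use inner in simp)
    finally show ?thesis .
  qed
  ultimately show ?thesis by blast
qed

text \<open>Products of elements of two spans are expanded bilinearly and their scalars merged. The
  number \<open>M\<close> of products serves all indices and becomes the bound for the strength over
  the ground field.\<close>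

lemma decomposables_rational_span_rep:
  fixes x :: "'a::field alg_closure multipoly ultrapower"
  assumes "x \<in> decomposables (rational_span N) d"
  obtains M \<alpha> F G where "\<And>i k. i < M \<Longrightarrow> (\<exists>e<d. F i k \<in> forms_in (N k) e) \<and> (\<exists>e<d. G i k \<in> forms_in (N k) e)"
    "x = ultraproduct (\<lambda>k. \<Sum>i<M::nat. single 0 (\<alpha> i k) * base_change (F i k * G i k))"
proof -
  define P where "P y \<alpha> F G \<longleftrightarrow> y = ultraproduct (\<lambda>k. single 0 (\<alpha> k) * base_change (F k * G k)) \<and>
      (\<forall>k. (\<exists>e<d. F k \<in> forms_in (N k) e) \<and> (\<exists>e<d. G k \<in> forms_in (N k) e))"
    for y :: "'a alg_closure multipoly ultrapower" and \<alpha> and F G :: "nat \<Rightarrow> 'a multipoly"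
  have P_I: "ultra_const c * s * (ultra_const c' * t) \<in> {y. \<exists>\<alpha> F G. P y \<alpha> F G}"
    if s: "s \<in> rational_forms N a" and t: "t \<in> rational_forms N b" and ab: "a < d" "b < d" for c c' s t a b
  proof -
    obtain F where F: "s = ultraproduct (\<lambda>k. base_change (F k))" "\<And>k. F k \<in> forms_in (N k) a"
      using s by (rule rational_formsE) blast
    obtain G where G: "t = ultraproduct (\<lambda>k. base_change (G k))" "\<And>k. G k \<in> forms_in (N k) b"
      using t by (rule rational_formsE) blast
    obtain \<alpha> where \<alpha>: "c * c' = ultraproduct \<alpha>" by (cases "c * c'")
    have "ultra_const c * s * (ultra_const c' * t) = ultra_const (c * c') * (s * t)"
      by (simp add: ultra_const.hom_mult mult_ac)
    also have "\<dots> = ultraproduct (\<lambda>k. single 0 (\<alpha> k) * base_change (F k * G k))"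
      by (simp add: F(1) G(1) \<alpha> ultra_const_ultraproduct ultraproduct_mult base_change.hom_mult)
    finally have "P (ultra_const c * s * (ultra_const c' * t)) \<alpha> F G"
      unfolding P_def using F(2) G(2) ab by blast
    then show ?thesis by blast
  qed
  have "x \<in> sums_of {y. \<exists>\<alpha> F G. P y \<alpha> F G}"
    using assms
  proof induction
    case (step x a y b z)
    then have ab: "a < d" "b < d" by auto
    have "x * y \<in> sums_of {y. \<exists>\<alpha> F G. P y \<alpha> F G}"
    proof (rule sums_of_map[OF step(1)[unfolded rational_span_def], where f = "\<lambda>x. x * y"])
      fix g :: "'a alg_closure multipoly ultrapower"
      assume "g \<in> {ultra_const a' * s |a' s. s \<in> rational_forms N a}"
      then obtain c s where g: "g = ultra_const c * s" and s: "s \<in> rational_forms N a" by blast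
      show "g * y \<in> sums_of {y. \<exists>\<alpha> F G. P y \<alpha> F G}"
      proof (rule sums_of_map[OF step(2)[unfolded rational_span_def], where f = "\<lambda>y. g * y"])
        fix h :: "'a alg_closure multipoly ultrapower"
        assume "h \<in> {ultra_const a' * s |a' s. s \<in> rational_forms N b}"
        then obtain c' t where h: "h = ultra_const c' * t" and t: "t \<in> rational_forms N b" by blast
        show "g * h \<in> sums_of {y. \<exists>\<alpha> F G. P y \<alpha> F G}"
          unfolding g h by (rule sums_of_gen) (rule P_I[OF s t ab])
      qed (auto simp: algebra_simps)
    qed (auto simp: algebra_simps)
    then show ?case using step by (intro sums_of_add) auto
  qed (rule sums_of.zero)
  then obtain M y where y: "\<And>i. i < M \<Longrightarrow> \<exists>\<alpha> F G. P (y i) \<alpha> F G" "x = (\<Sum>i<M::nat. y i)"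
    using sums_of_rep[of x "{y. \<exists>\<alpha> F G. P y \<alpha> F G}"] by blast
  from y(1) obtain \<alpha> F G where PF: "\<And>i. i < M \<Longrightarrow> P (y i) (\<alpha> i) (F i) (G i)"
    by metis
  have "x = (\<Sum>i<M. ultraproduct (\<lambda>k. single 0 (\<alpha> i k) * base_change (F i k * G i k)))"
    unfolding y(2) by (intro sum.cong refl) (use PF in \<open>simp add: P_def\<close>)
  then have "x = ultraproduct (\<lambda>k. \<Sum>i<M::nat. single 0 (\<alpha> i k) * base_change (F i k * G i k))"
    by (simp only: ultraproduct_sum)
  then show thesis using PF unfolding P_def by (intro that) auto
qed

theorem theorem1p3:
  fixes d s :: nat
  assumes "semi_perfect TYPE('a::field)"
    and "d > 1"
  shows "\<exists>s'::nat. \<forall>(n::nat) (f :: 'a multipoly).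
           is_form n d f \<longrightarrow> strength n d f > s' \<longrightarrow> abs_strength n d f > s"
proof (rule ccontr)
  assume "\<not> ?thesis"
  then have "\<forall>k. \<exists>n (f :: 'a multipoly). is_form n d f \<and> strength n d f > k \<and> abs_strength n d f \<le> s"
    by (auto simp: not_less)
  then obtain N and f :: "nat \<Rightarrow> 'a multipoly" where f: "\<And>k. is_form (N k) d (f k)"
    and str: "\<And>k. strength (N k) d (f k) > k" and astr: "\<And>k. abs_strength (N k) d (f k) \<le> s"
    by metis
  interpret hasse_algebra "ultra_const :: 'a alg_closure ultrapower \<Rightarrow> _" "ultra_forms N" "rational_span N" ultra_hasse
    by (rule ultra_hasse_algebra[OF assms(1)])
  define x where "x = ultraproduct (\<lambda>k. base_change (f k))"
  have f': "f k \<in> forms_in (N k) d" for k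
    using f by (simp add: is_form_whom forms_in_def)
  have bf: "is_form (N k) d (base_change (f k))" for k
    using forms_in_base_change[OF f'] by (simp add: is_form_whom forms_in_def)
  have "x \<in> rational_span N d"
    unfolding x_def by (intro rational_forms_span rational_formsI f')
  moreover have "x \<in> decomposables (ultra_forms N) d"
  proof -
    define P where "P k g h \<longleftrightarrow> (\<forall>i a. g i a \<in> forms_in (N k) a) \<and> (\<forall>i a. h i a \<in> forms_in (N k) (d - a)) \<and>
        base_change (f k) = (\<Sum>i<s. \<Sum>a\<in>{1..<d}. g i a * h i a)" for k g h
    have "\<exists>g h. P k g h" for k
      unfolding P_def
      by (rule strength_expr_homogeneous[OF bf strength_expr_if_le[OF bf assms(2)]])
        (use astr in \<open>simp add: abs_strength_def\<close>)
    then obtain g h where gh: "\<And>k. P k (g k) (h k)" by metis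
    have "x = ultraproduct (\<lambda>k. \<Sum>i<s. \<Sum>a\<in>{1..<d}. g k i a * h k i a)"
      using gh unfolding x_def P_def by simp
    also have "\<dots> = (\<Sum>i<s. \<Sum>a\<in>{1..<d}. ultraproduct (\<lambda>k. g k i a) * ultraproduct (\<lambda>k. h k i a))"
      by (simp only: ultraproduct_mult ultraproduct_sum)
    also have "\<dots> \<in> decomposables (ultra_forms N) d"
    proof (intro decomposables_sum)
      fix i a assume a: "a \<in> {1..<d}"
      show "ultraproduct (\<lambda>k. g k i a) * ultraproduct (\<lambda>k. h k i a) \<in> decomposables (ultra_forms N) d"
      proof (rule decomposables_mult)
        show "ultraproduct (\<lambda>k. g k i a) \<in> ultra_forms N a"
          by (rule ultra_formsI) (use gh in \<open>simp add: P_def\<close>)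
        show "ultraproduct (\<lambda>k. h k i a) \<in> ultra_forms N (d - a)"
          by (rule ultra_formsI) (use gh in \<open>simp add: P_def\<close>)
      qed (use a in auto)
    qed
    finally show ?thesis .
  qed
  ultimately have "x \<in> decomposables (rational_span N) d"
    using assms(2) by (intro decomposables_descend) auto
  then obtain M \<alpha> F G where FG: "\<And>i k. i < M \<Longrightarrow> (\<exists>e<d. F i k \<in> forms_in (N k) e) \<and> (\<exists>e<d. G i k \<in> forms_in (N k) e)"
    and x_eq: "x = ultraproduct (\<lambda>k. \<Sum>i<M::nat. single 0 (\<alpha> i k) * base_change (F i k * G i k))"
    by (rule decomposables_rational_span_rep) blast
  obtain l :: "'a alg_closure \<Rightarrow> 'a" where l: "ac_linear l" "\<And>a. l (to_ac a) = a"
    using ac_linear_retraction by blast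
  have "\<forall>\<^sub>F k in ultra. base_change (f k) = (\<Sum>i<M. single 0 (\<alpha> i k) * base_change (F i k * G i k))"
    using x_eq unfolding x_def by (simp add: ultraproduct_eq_iff)
  \<comment> \<open>\<open>M\<close> is fixed and the ultrafilter is free, so some index
    \<open>k \<ge> M\<close> satisfies the identity; there the strength is at most
    \<open>M \<le> k\<close>, against the choice of \<open>f k\<close>.\<close>
  then have "\<forall>\<^sub>F k in ultra. base_change (f k) = (\<Sum>i<M. single 0 (\<alpha> i k) * base_change (F i k * G i k)) \<and> M \<le> k"
    using ultra_ge by (rule eventually_conj)
  then obtain k where k: "base_change (f k) = (\<Sum>i<M. single 0 (\<alpha> i k) * base_change (F i k * G i k))" "M \<le> k"
    using eventually_happens'[OF ultra_not_bot] by blast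
  \<comment> \<open>A linear retraction onto the ground field turns the expression into one over the ground field.\<close>
  have "f k = Poly_Mapping.map l (base_change (f k))"
    by (rule poly_mapping_eqI) (simp add: lookup_map0 ac_linear_0[OF l(1)] l(2))
  also have "\<dots> = (\<Sum>i<M. Poly_Mapping.map l (single 0 (\<alpha> i k)) * (F i k * G i k))"
    unfolding k(1) by (simp only: map_ac_linear_sum[OF l(1)] map_ac_linear_mult[OF l(1)])
  also have "\<dots> = (\<Sum>i<M. (single 0 (l (\<alpha> i k)) * F i k) * G i k)"
  proof (intro sum.cong refl)
    fix i
    have "Poly_Mapping.map l (single 0 (\<alpha> i k)) = (single 0 (l (\<alpha> i k)) :: 'a multipoly)"
      by (rule poly_mapping_eqI) (simp add: lookup_map0 ac_linear_0[OF l(1)] lookup_single when_def)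
    then show "Poly_Mapping.map l (single 0 (\<alpha> i k)) * (F i k * G i k) = (single 0 (l (\<alpha> i k)) * F i k) * G i k"
      by (simp add: mult.assoc)
  qed
  finally have "f k = (\<Sum>i<M. (single 0 (l (\<alpha> i k)) * F i k) * G i k)" .
  moreover have "(\<exists>e<d. is_form (N k) e (single 0 (l (\<alpha> i k)) * F i k)) \<and> (\<exists>e<d. is_form (N k) e (G i k))"
    if "i < M" for i
    using FG[OF that, of k] forms_in_scale[of "F i k" "N k"] unfolding is_form_whom forms_in_def by blast
  ultimately have "strength_expr (N k) d (f k) M"
    unfolding strength_expr_def
    by (intro exI[of _ "\<lambda>i. single 0 (l (\<alpha> i k)) * F i k"] exI[of _ "\<lambda>i. G i k"]) blast
  then have "strength (N k) d (f k) \<le> M"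
    unfolding strength_def by (rule Least_le)
  then show False using str[of k] k(2) by simp
qed

end
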